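(* Let $p$ and $q$ be different primes. (a) If $q = 2$, then $\mathcal{N}(p^2 q) = 5$. (b) If $q > 2$, then \[ \mathcal{N}(p^2 q) = 2 + \frac{q+5}{2}\, w_{p-1}(q) + w_{p+1}(q) + 2\, w_{q-1}(p) + w_{q-1}(p^2).\]
   Context: $\mathcal{N}(n)$ denotes the number of isomorphism types of groups of order $n$. For positive integers $r, s$ define $w_r(s) = 1$ if $s \mid r$ and $w_r(s) = 0$ otherwise. *)

theory Defs
  imports
    Complex_Main
    "HOL-Algebra.Coset"
    "HOL-Computational_Algebra.Primes"
begin

(* Finiteness is explicit because order G = 0 also holds for infinite groups. *)
definition groups_of_order :: "nat \<Rightarrow> nat monoid set" where
  "groups_of_order n = {G. group G \<and> finite (carrier G) \<and> order G = n}"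

definition group_isomorphism_on :: "nat \<Rightarrow> (nat monoid \<times> nat monoid) set" where
  "group_isomorphism_on n =
     {(G, H). G \<in> groups_of_order n \<and> H \<in> groups_of_order n \<and> G \<cong> H}"

(* Restricting to groups whose elements are natural numbers loses no isomorphism type, see
   finite_group_represented; the quotient is finite, see finite_isomorphism_types, so that
   card does not return its default value 0. *)
definition num_groups :: "nat \<Rightarrow> nat" where
  "num_groups n = card (groups_of_order n // group_isomorphism_on n)"

definition divisor_ind :: "nat \<Rightarrow> nat \<Rightarrow> nat" where
  "divisor_ind r s = (if s dvd r then 1 else 0)"

lemma equiv_group_isomorphism_on: "equiv (groups_of_order n) (group_isomorphism_on n)"
proof (rule equivI)
  show "group_isomorphism_on n \<subseteq> groups_of_order n \<times> groups_of_order n"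
    by (auto simp: group_isomorphism_on_def)
  show "refl_on (groups_of_order n) (group_isomorphism_on n)"
    by (auto simp: refl_on_def group_isomorphism_on_def)
  show "sym (group_isomorphism_on n)"
    by (auto simp: sym_def group_isomorphism_on_def groups_of_order_def group.iso_sym)
  show "trans (group_isomorphism_on n)"
    by (auto simp: trans_def group_isomorphism_on_def intro: iso_trans)
qed

definition initial_tables :: "nat \<Rightarrow> nat monoid set" where
  "initial_tables n =
     (\<lambda>(m, e). \<lparr>carrier = {0..<n}, monoid.mult = (\<lambda>x y. m (x, y)), one = e\<rparr>) `
       ({m. \<forall>z. (z \<in> {0..<n} \<times> {0..<n} \<longrightarrow> m z \<in> {0..<n}) \<and>
               (z \<notin> {0..<n} \<times> {0..<n} \<longrightarrow> m z = 0)} \<times> {0..<n})"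

lemma finite_initial_tables: "finite (initial_tables n)"
  unfolding initial_tables_def
  by (intro finite_imageI finite_cartesian_product finite_set_of_finite_funs) auto

lemma finite_group_represented_initial:
  assumes G: "group G" and fin: "finite (carrier G)"
  shows "\<exists>H \<in> groups_of_order (order G) \<inter> initial_tables (order G). G \<cong> H"
proof -
  interpret group G by (fact G)
  define n where "n = order G"
  obtain f where f: "bij_betw f (carrier G) {0..<n}"
    using ex_bij_betw_finite_nat[OF fin] unfolding n_def order_def by blast
  define g where "g = inv_into (carrier G) f"
  have g: "g x \<in> carrier G" if "x < n" for x
    using f that by (auto simp: g_def bij_betw_def intro!: inv_into_into)
  have gf [simp]: "g (f x) = x" if "x \<in> carrier G" for x
    using f that by (simp add: g_def bij_betw_def)
  have fl: "f x < n" if "x \<in> carrier G" for x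
    using f that by (auto simp: bij_betw_def)
  define m where "m = (\<lambda>(x, y). if x < n \<and> y < n then f (g x \<otimes>\<^bsub>G\<^esub> g y) else 0)"
  define H where "H = \<lparr>carrier = {0..<n}, monoid.mult = (\<lambda>x y. m (x, y)), one = f \<one>\<^bsub>G\<^esub>\<rparr>"
  have iso: "f \<in> iso G H"
    using f by (auto simp: iso_def hom_def H_def m_def fl)
  then have GH: "G \<cong> H"
    by (rule is_isoI)
  have grp: "group H"
    using iso_imp_img_group[OF iso] by (simp add: H_def)
  have "H \<in> initial_tables n"
    unfolding initial_tables_def H_def
    by (rule image_eqI[where x = "(m, f \<one>\<^bsub>G\<^esub>)"]) (auto simp: m_def fl g)
  moreover have "H \<in> groups_of_order n"
    using grp by (simp add: groups_of_order_def order_def H_def)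
  ultimately show ?thesis
    using GH unfolding n_def by blast
qed

lemma finite_group_represented:
  assumes "group G" and "finite (carrier G)"
  shows "\<exists>H \<in> groups_of_order (order G). G \<cong> H"
  using finite_group_represented_initial[OF assms] by blast

lemma finite_isomorphism_types: "finite (groups_of_order n // group_isomorphism_on n)"
proof (rule finite_subset)
  show "groups_of_order n // group_isomorphism_on n
      \<subseteq> (\<lambda>H. group_isomorphism_on n `` {H}) ` initial_tables n"
  proof
    fix C
    assume "C \<in> groups_of_order n // group_isomorphism_on n"
    then obtain G where G: "G \<in> groups_of_order n" and C: "C = group_isomorphism_on n `` {G}"
      by (auto elim: quotientE)
    from G have "group G" "finite (carrier G)" "order G = n"
      by (auto simp: groups_of_order_def)
    then obtain H where H: "H \<in> groups_of_order n" "H \<in> initial_tables n" "G \<cong> H"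
      using finite_group_represented_initial[of G] by blast
    then have "(G, H) \<in> group_isomorphism_on n"
      using G by (simp add: group_isomorphism_on_def)
    then have "C = group_isomorphism_on n `` {H}"
      unfolding C by (rule equiv_class_eq[OF equiv_group_isomorphism_on])
    with H show "C \<in> (\<lambda>H. group_isomorphism_on n `` {H}) ` initial_tables n"
      by blast
  qed
  show "finite ((\<lambda>H. group_isomorphism_on n `` {H}) ` initial_tables n)"
    by (intro finite_imageI finite_initial_tables)
qed

end

theory Submission
  imports Defs
    "HOL-Algebra.Multiplicative_Group"
    "HOL-Algebra.Sylow"
    "HOL-Algebra.Group_Action"
    "HOL-Algebra.Elementary_Groups"
    "HOL-Number_Theory.Residue_Primitive_Roots"
    "HOL-Computational_Algebra.Polynomial"
begin

text \<open>
  A group \<open>G\<close> of order \<open>p\<^sup>2 q\<close> has a normal Sylow subgroup. For \<open>q < p\<close>, two subgroups of order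
  \<open>p\<^sup>2\<close> are too large to differ; for \<open>p < q\<close>, a subgroup \<open>Q\<close> of order \<open>q\<close> has \<open>1\<close>, \<open>p\<close> or \<open>p\<^sup>2\<close>
  conjugates, where \<open>p\<close> conjugates are impossible and \<open>p\<^sup>2\<close> conjugates leave room for only one
  subgroup of order \<open>p\<^sup>2\<close>. Groups of order \<open>p\<^sup>2\<close> are \<open>C(p\<^sup>2)\<close> or \<open>C(p) \<times> C(p)\<close>. So \<open>G\<close> is a split
  extension in which a cyclic group acts on one of \<open>C(p\<^sup>2)\<close>, \<open>C(p) \<times> C(p)\<close>, \<open>C(q)\<close>, \<open>C(p) \<times> C(q)\<close>; the
  last case comes from \<open>C(p) \<times> C(p)\<close> acting on \<open>C(q)\<close>, where some element of order \<open>p\<close> must act trivially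
  and can be moved into the normal subgroup. This is lemma \<open>classification\<close>.

  Three isomorphism invariants tell these kinds apart: whether the elements of order dividing \<open>p\<^sup>2\<close>
  are closed under multiplication (the Sylow \<open>p\<close>-subgroup is normal), whether an element of
  order \<open>p\<^sup>2\<close> exists, and whether the group is commutative; for \<open>C(p\<^sup>2)\<close> acting on \<open>C(q)\<close>, triviality of
  the centre separates the faithful action from the one with a kernel of order \<open>p\<close>. It remains to count
  the types of each kind, and there the action matters only up to automorphisms of the normal subgroup and
  a change of generator of the acting cyclic group.

  When the normal subgroup is acted on by multiplication with a unit \<open>a\<close>, the unit groups modulo \<open>p\<^sup>2\<close>
  (for odd \<open>p\<close>) and modulo \<open>q\<close> are cyclic, so two units of the same order are powers of each other.
  Hence there is one type for each order, and it exists exactly when the order divides that of the unit group.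

  The remaining kind is \<open>C(q)\<close> acting on \<open>C(p) \<times> C(p)\<close> through a matrix \<open>A\<close> of order \<open>q\<close> modulo \<open>p\<close>.
  If \<open>q\<close> divides \<open>p - 1\<close>, then \<open>A\<close> is diagonalizable, and after a change of generator it is
  \<open>diag(\<lambda>, \<lambda>\<^sup>k)\<close> with a fixed primitive \<open>q\<close>-th root of unity \<open>\<lambda>\<close> and \<open>k < q\<close>. The parameters \<open>k\<close> and \<open>l\<close>
  give isomorphic groups iff \<open>k = l\<close> or \<open>k l = 1\<close> modulo \<open>q\<close>. The involution fixing \<open>0\<close> and inverting
  the units has the fixed points \<open>0, 1, q - 1\<close>, so there are \<open>(q + 3) / 2\<close> classes (two if \<open>q = 2\<close>).
  If \<open>q\<close> does not divide \<open>p - 1\<close>, then \<open>A\<close> has no eigenvalue, has determinant \<open>1\<close> and is conjugate to the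
  companion matrix of \<open>X\<^sup>2 - t X + 1\<close> with \<open>t\<close> its trace. The admissible \<open>t\<close> are roots of a monic
  polynomial of degree \<open>(q - 1) / 2\<close>, and the powers of one \<open>A\<close> already have \<open>(q - 1) / 2\<close> different traces.
  So all such \<open>A\<close> generate conjugate subgroups, and there is at most one type. Since the field
  with \<open>p\<^sup>2\<close> elements has a unit group of order \<open>(p - 1) (p + 1)\<close>, such an \<open>A\<close> exists iff \<open>q\<close> divides
  \<open>p + 1\<close>.
\<close>

text \<open>
  Below, \<open>order\<close> is the order of a group, not the multiplicity of a root of a polynomial.
\<close>

hide_const (open) Polynomial.order
hide_fact (open) Polynomial.order_def

section \<open>Counting isomorphism types with a given property\<close>

definition num_types :: "nat \<Rightarrow> (nat monoid \<Rightarrow> bool) \<Rightarrow> nat" where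
  "num_types n \<Phi> =
     card {C \<in> groups_of_order n // group_isomorphism_on n. \<exists>G\<in>C. \<Phi> G}"

lemma num_groups_eq_num_types: "num_groups n = num_types n (\<lambda>_. True)"
proof -
  have "{C \<in> groups_of_order n // group_isomorphism_on n. \<exists>G\<in>C. True} =
        groups_of_order n // group_isomorphism_on n"
    using in_quotient_imp_non_empty[OF equiv_group_isomorphism_on] by blast
  thus ?thesis by (simp add: num_groups_def num_types_def)
qed

text \<open>
  The count of all groups is broken up by one invariant after the other. A class of isomorphic groups lies
  entirely on one side of an invariant \<open>\<Psi>\<close>.
\<close>

lemma num_types_split:
  assumes inv: "\<And>G H. G \<in> groups_of_order n \<Longrightarrow> H \<in> groups_of_order n \<Longrightarrow> G \<cong> H \<Longrightarrow> \<Psi> G \<Longrightarrow> \<Psi> H"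
  shows "num_types n \<Phi> = num_types n (\<lambda>G. \<Phi> G \<and> \<Psi> G) + num_types n (\<lambda>G. \<Phi> G \<and> \<not> \<Psi> G)"
proof -
  let ?Q = "groups_of_order n // group_isomorphism_on n"
  have same: "\<Psi> G \<longleftrightarrow> \<Psi> H" if C: "C \<in> ?Q" "G \<in> C" "H \<in> C" for C G H
  proof -
    have 1: "(G, H) \<in> group_isomorphism_on n" "(H, G) \<in> group_isomorphism_on n"
      using quotient_eq_iff[OF equiv_group_isomorphism_on C(1) C(1)] C by auto
    thus ?thesis using inv[of G H] inv[of H G] by (auto simp: group_isomorphism_on_def)
  qed
  have eq: "{C \<in> ?Q. \<exists>G\<in>C. \<Phi> G} = {C \<in> ?Q. \<exists>G\<in>C. \<Phi> G \<and> \<Psi> G} \<union> {C \<in> ?Q. \<exists>G\<in>C. \<Phi> G \<and> \<not> \<Psi> G}"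
    by blast
  have disj: "{C \<in> ?Q. \<exists>G\<in>C. \<Phi> G \<and> \<Psi> G} \<inter> {C \<in> ?Q. \<exists>G\<in>C. \<Phi> G \<and> \<not> \<Psi> G} = {}"
    using same by blast
  show ?thesis unfolding num_types_def eq
    by (rule card_Un_disjoint) (use disj finite_isomorphism_types[of n] in auto)
qed

text \<open>
  The way to count: exhibit pairwise non-isomorphic models \<open>M i\<close> that exhaust \<open>\<Phi>\<close>. The carrier type
  of the models is arbitrary, because every finite group has an isomorphic copy on natural numbers.
\<close>

lemma num_types_eq_card:
  fixes M :: "'i \<Rightarrow> 'a monoid"
  assumes grp: "\<And>i. i \<in> I \<Longrightarrow> group (M i)" and fin: "\<And>i. i \<in> I \<Longrightarrow> finite (carrier (M i))"
    and ord: "\<And>i. i \<in> I \<Longrightarrow> order (M i) = n"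
    and iff: "\<And>G. G \<in> groups_of_order n \<Longrightarrow> \<Phi> G \<longleftrightarrow> (\<exists>i\<in>I. M i \<cong> G)"
    and dist: "\<And>i j. i \<in> I \<Longrightarrow> j \<in> I \<Longrightarrow> M i \<cong> M j \<Longrightarrow> i = j"
  shows "num_types n \<Phi> = card I"
proof -
  let ?R = "group_isomorphism_on n"
  have "\<forall>i\<in>I. \<exists>G. G \<in> groups_of_order n \<and> M i \<cong> G"
    using finite_group_represented[OF grp fin] ord by metis
  then obtain r where r: "\<And>i. i \<in> I \<Longrightarrow> r i \<in> groups_of_order n" "\<And>i. i \<in> I \<Longrightarrow> M i \<cong> r i"
    by metis
  have grpG: "group G" if "G \<in> groups_of_order n" for G using that by (simp add: groups_of_order_def)
  have "bij_betw (\<lambda>i. ?R `` {r i}) I {C \<in> groups_of_order n // ?R. \<exists>G\<in>C. \<Phi> G}"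
    unfolding bij_betw_def
  proof (intro conjI inj_onI equalityI subsetI)
    fix i j assume ij: "i \<in> I" "j \<in> I" "?R `` {r i} = ?R `` {r j}"
    hence "(r i, r j) \<in> ?R"
      using eq_equiv_class[OF _ equiv_group_isomorphism_on] r by metis
    hence "r i \<cong> r j" by (simp add: group_isomorphism_on_def)
    hence "M i \<cong> M j"
      using ij r group.iso_sym[OF grp] iso_trans by metis
    thus "i = j" using dist ij by blast
  next
    fix C assume "C \<in> (\<lambda>i. ?R `` {r i}) ` I"
    then obtain i where i: "i \<in> I" "C = ?R `` {r i}" by blast
    have "r i \<in> C" using i r equiv_class_self[OF equiv_group_isomorphism_on] by metis
    moreover have "\<Phi> (r i)" using iff i r by blast
    ultimately show "C \<in> {C \<in> groups_of_order n // ?R. \<exists>G\<in>C. \<Phi> G}"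
      using i r by (auto intro: quotientI)
  next
    fix C assume "C \<in> {C \<in> groups_of_order n // ?R. \<exists>G\<in>C. \<Phi> G}"
    then obtain G where C: "C \<in> groups_of_order n // ?R" and G: "G \<in> C" "\<Phi> G" by blast
    have Gn: "G \<in> groups_of_order n"
      using in_quotient_imp_subset[OF equiv_group_isomorphism_on C] G by blast
    then obtain i where i: "i \<in> I" "M i \<cong> G" using iff G by blast
    hence "r i \<cong> G" using r group.iso_sym[OF grp] iso_trans by metis
    hence "(r i, G) \<in> ?R" using i r Gn by (simp add: group_isomorphism_on_def)
    moreover have "C = ?R `` {G}"
    proof -
      obtain H where H: "C = ?R `` {H}" using C by (rule quotientE)
      hence "(H, G) \<in> ?R" using G by simp
      thus ?thesis using H equiv_class_eq[OF equiv_group_isomorphism_on] by blast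
    qed
    ultimately show "C \<in> (\<lambda>i. ?R `` {r i}) ` I"
      using i equiv_class_eq[OF equiv_group_isomorphism_on, of "r i" G] by auto
  qed
  from bij_betw_same_card[OF this] show ?thesis by (simp add: num_types_def)
qed

text \<open>
  The case in which all parameters \<open>a\<close> give the same group: the only remaining question is whether a parameter exists.
\<close>

lemma num_types_one_model:
  fixes M :: "'i \<Rightarrow> 'a monoid"
  assumes M: "\<And>a. a \<in> A \<Longrightarrow> group (M a) \<and> finite (carrier (M a)) \<and> order (M a) = n"
    and iso: "\<And>a b. a \<in> A \<Longrightarrow> b \<in> A \<Longrightarrow> M a \<cong> M b"
    and iff: "\<And>G. G \<in> groups_of_order n \<Longrightarrow> \<Phi> G \<longleftrightarrow> (\<exists>a\<in>A. M a \<cong> G)"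
  shows "num_types n \<Phi> = (if A = {} then 0 else 1)"
proof (cases "A = {}")
  case True
  hence "num_types n \<Phi> = card ({} :: 'i set)"
    using iff by (intro num_types_eq_card[of "{}" M]) auto
  thus ?thesis using True by simp
next
  case False
  then obtain a where a: "a \<in> A" by blast
  have "(\<exists>b\<in>A. M b \<cong> G) \<longleftrightarrow> (\<exists>i\<in>{a}. M i \<cong> G)" for G :: "nat monoid"
    using a iso_trans[OF iso[OF a]] by blast
  hence "num_types n \<Phi> = card {a}"
    using a iff M by (intro num_types_eq_card[of "{a}" M]) auto
  thus ?thesis using a by auto
qed

section \<open>Split extensions by a cyclic group\<close>

text \<open>
  The second components are exponents of a generator of a cyclic group of order \<open>n\<close>, which acts on \<open>N\<close>
  through \<open>\<alpha>\<close>. All groups of order \<open>p\<^sup>2 q\<close> have this form.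
\<close>

definition semidirect :: "('a, 'b) monoid_scheme \<Rightarrow> ('a \<Rightarrow> 'a) \<Rightarrow> nat \<Rightarrow> ('a \<times> nat) monoid" where
  "semidirect N \<alpha> n =
     \<lparr>carrier = carrier N \<times> {0..<n},
      monoid.mult = (\<lambda>(x, i) (y, j). (x \<otimes>\<^bsub>N\<^esub> (\<alpha> ^^ i) y, (i + j) mod n)),
      one = (\<one>\<^bsub>N\<^esub>, 0)\<rparr>"

text \<open>
  The condition on the period makes \<open>\<alpha>\<close> bijective on the carrier, so it is an automorphism of order dividing \<open>n\<close>.
\<close>

locale cyclic_action = N: group N for N (structure) +
  fixes \<alpha> :: "'a \<Rightarrow> 'a" and n :: nat
  assumes n_pos: "n > 0" and hom: "\<alpha> \<in> hom N N"
    and period: "\<And>x. x \<in> carrier N \<Longrightarrow> (\<alpha> ^^ n) x = x"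
begin

lemma funpow_hom: "\<alpha> ^^ i \<in> hom N N"
proof (induction i)
  case (Suc i)
  thus ?case using hom_compose[OF Suc hom] by (simp add: comp_def)
qed (auto simp: hom_def)

lemma funpow_closed [simp]: "x \<in> carrier N \<Longrightarrow> (\<alpha> ^^ i) x \<in> carrier N"
  using funpow_hom by (auto simp: hom_def)

lemma closed [simp]: "x \<in> carrier N \<Longrightarrow> \<alpha> x \<in> carrier N"
  using funpow_closed[of x 1] by simp

lemma funpow_mult: "x \<in> carrier N \<Longrightarrow> y \<in> carrier N \<Longrightarrow> (\<alpha> ^^ i) (x \<otimes> y) = (\<alpha> ^^ i) x \<otimes> (\<alpha> ^^ i) y"
  using funpow_hom by (auto simp: hom_def)

lemma funpow_one [simp]: "(\<alpha> ^^ i) \<one> = \<one>"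
  using funpow_mult[of \<one> \<one> i] N.l_cancel_one[of "(\<alpha> ^^ i) \<one>" "(\<alpha> ^^ i) \<one>"] by simp

lemma funpow_multiple: "x \<in> carrier N \<Longrightarrow> (\<alpha> ^^ (n * k)) x = x"
  by (induction k) (auto simp: funpow_add period)

lemma funpow_mod: "x \<in> carrier N \<Longrightarrow> (\<alpha> ^^ (i mod n)) x = (\<alpha> ^^ i) x"
  using funpow_multiple[of x "i div n"] funpow_add[of "i mod n" "n * (i div n)" \<alpha>] by simp

lemma carrier_semidirect: "carrier (semidirect N \<alpha> n) = carrier N \<times> {0..<n}"
  by (simp add: semidirect_def)

lemma mult_semidirect:
  "(x, i) \<otimes>\<^bsub>semidirect N \<alpha> n\<^esub> (y, j) = (x \<otimes> (\<alpha> ^^ i) y, (i + j) mod n)"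
  by (simp add: semidirect_def)

lemma one_semidirect: "\<one>\<^bsub>semidirect N \<alpha> n\<^esub> = (\<one>, 0)"
  by (simp add: semidirect_def)

lemmas semidirect_simps = carrier_semidirect mult_semidirect one_semidirect

lemma order_semidirect: "order (semidirect N \<alpha> n) = card (carrier N) * n"
  by (simp add: order_def carrier_semidirect card_cartesian_product)

lemma finite_semidirect: "finite (carrier N) \<Longrightarrow> finite (carrier (semidirect N \<alpha> n))"
  by (simp add: carrier_semidirect)

lemma group_semidirect: "group (semidirect N \<alpha> n)"
proof (rule groupI)
  fix x y z assume xyz: "x \<in> carrier (semidirect N \<alpha> n)" "y \<in> carrier (semidirect N \<alpha> n)"
    "z \<in> carrier (semidirect N \<alpha> n)"
  obtain x1 i y1 j z1 k where [simp]: "x = (x1, i)" "y = (y1, j)" "z = (z1, k)"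
    by (metis surj_pair)
  show "x \<otimes>\<^bsub>semidirect N \<alpha> n\<^esub> y \<otimes>\<^bsub>semidirect N \<alpha> n\<^esub> z =
        x \<otimes>\<^bsub>semidirect N \<alpha> n\<^esub> (y \<otimes>\<^bsub>semidirect N \<alpha> n\<^esub> z)"
    using xyz
    by (simp add: semidirect_simps funpow_mod funpow_mult funpow_add N.m_assoc mod_simps add.assoc)
next
  fix x assume x: "x \<in> carrier (semidirect N \<alpha> n)"
  obtain x1 i where [simp]: "x = (x1, i)" by (metis surj_pair)
  have i: "i < n" "x1 \<in> carrier N" using x by (auto simp: semidirect_simps)
  let ?y = "((\<alpha> ^^ (n - i)) (inv x1), (n - i) mod n)"
  have "?y \<otimes>\<^bsub>semidirect N \<alpha> n\<^esub> x = \<one>\<^bsub>semidirect N \<alpha> n\<^esub>"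
    using i by (simp add: semidirect_simps mod_simps funpow_mod flip: funpow_mult)
  moreover have "?y \<in> carrier (semidirect N \<alpha> n)" using i by (simp add: semidirect_simps)
  ultimately show "\<exists>y\<in>carrier (semidirect N \<alpha> n). y \<otimes>\<^bsub>semidirect N \<alpha> n\<^esub> x = \<one>\<^bsub>semidirect N \<alpha> n\<^esub>"
    by blast
qed (use n_pos in \<open>auto simp: semidirect_simps\<close>)

sublocale SD: group "semidirect N \<alpha> n" by (rule group_semidirect)

lemma pow_fst: "x \<in> carrier N \<Longrightarrow> (x, 0) [^]\<^bsub>semidirect N \<alpha> n\<^esub> (k::nat) = (x [^] k, 0)"
  by (induction k) (auto simp: semidirect_simps)

lemma inv_fst: "x \<in> carrier N \<Longrightarrow> inv\<^bsub>semidirect N \<alpha> n\<^esub> (x, 0) = (inv x, 0)"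
  using n_pos by (intro SD.inv_equality) (auto simp: semidirect_simps)

lemma snd_pow: "g \<in> carrier (semidirect N \<alpha> n) \<Longrightarrow> snd (g [^]\<^bsub>semidirect N \<alpha> n\<^esub> (k::nat)) = (k * snd g) mod n"
proof (induction k)
  case (Suc k)
  have "snd (x \<otimes>\<^bsub>semidirect N \<alpha> n\<^esub> y) = (snd x + snd y) mod n" for x y
    by (cases x; cases y) (simp add: semidirect_simps)
  thus ?case using Suc by (simp add: mod_simps add.commute)
qed (use n_pos in \<open>auto simp: semidirect_simps\<close>)

lemma pow_complement: "(\<one>, i mod n) [^]\<^bsub>semidirect N \<alpha> n\<^esub> (k::nat) = (\<one>, (i * k) mod n)"
  by (induction k) (auto simp: semidirect_simps mod_simps algebra_simps)

end

text \<open>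
  If \<open>G\<close> contains a copy of \<open>N\<close> and an element \<open>c\<close> that conjugates this copy by \<open>\<alpha>\<close>, then
  \<open>(x, i) \<mapsto> \<phi>(x) c\<^sup>i\<close> is a homomorphism. It has a trivial kernel as the powers of \<open>c\<close> meet the copy trivially, and
  the orders agree.
\<close>

lemma semidirect_recognition:
  assumes act: "cyclic_action N \<alpha> n" and G: "group G" and fin: "finite (carrier G)"
    and \<phi>: "\<phi> \<in> hom N G" and inj: "inj_on \<phi> (carrier N)"
    and c: "c \<in> carrier G" "c [^]\<^bsub>G\<^esub> n = \<one>\<^bsub>G\<^esub>"
    and conj: "\<And>x. x \<in> carrier N \<Longrightarrow> c \<otimes>\<^bsub>G\<^esub> \<phi> x = \<phi> (\<alpha> x) \<otimes>\<^bsub>G\<^esub> c"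
    and compl: "\<And>x i. x \<in> carrier N \<Longrightarrow> 0 < i \<Longrightarrow> i < n \<Longrightarrow> c [^]\<^bsub>G\<^esub> i \<noteq> \<phi> x"
    and ord: "order G = card (carrier N) * n"
  shows "semidirect N \<alpha> n \<cong> G"
proof -
  interpret cyclic_action N \<alpha> n by fact
  interpret G: group G by fact
  define h where "h = (\<lambda>(x, i). \<phi> x \<otimes>\<^bsub>G\<^esub> c [^]\<^bsub>G\<^esub> (i::nat))"
  have [simp]: "\<phi> x \<in> carrier G" if "x \<in> carrier N" for x using \<phi> that by (auto simp: hom_def)
  have \<phi>m: "\<phi> (x \<otimes>\<^bsub>N\<^esub> y) = \<phi> x \<otimes>\<^bsub>G\<^esub> \<phi> y" if "x \<in> carrier N" "y \<in> carrier N" for x y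
    using \<phi> that by (auto simp: hom_def)
  have conj': "c [^]\<^bsub>G\<^esub> i \<otimes>\<^bsub>G\<^esub> \<phi> x = \<phi> ((\<alpha> ^^ i) x) \<otimes>\<^bsub>G\<^esub> c [^]\<^bsub>G\<^esub> i" if "x \<in> carrier N" for x and i :: nat
    using that
  proof (induction i arbitrary: x)
    case (Suc i)
    have "c [^]\<^bsub>G\<^esub> Suc i \<otimes>\<^bsub>G\<^esub> \<phi> x = c [^]\<^bsub>G\<^esub> i \<otimes>\<^bsub>G\<^esub> (\<phi> (\<alpha> x) \<otimes>\<^bsub>G\<^esub> c)"
      using Suc c by (simp add: G.m_assoc conj)
    also have "\<dots> = (\<phi> ((\<alpha> ^^ i) (\<alpha> x)) \<otimes>\<^bsub>G\<^esub> c [^]\<^bsub>G\<^esub> i) \<otimes>\<^bsub>G\<^esub> c"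
      using Suc c by (simp flip: G.m_assoc)
    finally show ?case using Suc c by (simp add: G.m_assoc funpow_swap1)
  qed (auto simp: c)
  have cmod: "c [^]\<^bsub>G\<^esub> (i mod n) = c [^]\<^bsub>G\<^esub> i" for i :: nat
  proof -
    have "c [^]\<^bsub>G\<^esub> i = c [^]\<^bsub>G\<^esub> (n * (i div n)) \<otimes>\<^bsub>G\<^esub> c [^]\<^bsub>G\<^esub> (i mod n)"
      using c by (simp add: G.nat_pow_mult)
    thus ?thesis using c by (simp flip: G.nat_pow_pow)
  qed
  have hom: "h \<in> hom (semidirect N \<alpha> n) G"
  proof (rule homI)
    fix u v assume uv: "u \<in> carrier (semidirect N \<alpha> n)" "v \<in> carrier (semidirect N \<alpha> n)"
    obtain x i y j where [simp]: "u = (x, i)" "v = (y, j)" by (metis surj_pair)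
    have xy: "x \<in> carrier N" "y \<in> carrier N" using uv by (auto simp: semidirect_simps)
    have "h u \<otimes>\<^bsub>G\<^esub> h v = \<phi> x \<otimes>\<^bsub>G\<^esub> (c [^]\<^bsub>G\<^esub> i \<otimes>\<^bsub>G\<^esub> \<phi> y) \<otimes>\<^bsub>G\<^esub> c [^]\<^bsub>G\<^esub> j"
      using xy c by (simp add: h_def G.m_assoc)
    also have "\<dots> = \<phi> x \<otimes>\<^bsub>G\<^esub> \<phi> ((\<alpha> ^^ i) y) \<otimes>\<^bsub>G\<^esub> (c [^]\<^bsub>G\<^esub> i \<otimes>\<^bsub>G\<^esub> c [^]\<^bsub>G\<^esub> j)"
      using xy c by (simp add: conj' G.m_assoc)
    finally show "h (u \<otimes>\<^bsub>semidirect N \<alpha> n\<^esub> v) = h u \<otimes>\<^bsub>G\<^esub> h v"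
      using xy c by (simp add: h_def semidirect_simps \<phi>m cmod G.nat_pow_mult)
  qed (auto simp: h_def semidirect_simps c)
  have "inj_on h (carrier (semidirect N \<alpha> n))"
  proof -
    interpret h: group_hom "semidirect N \<alpha> n" G h
      by unfold_locales (rule hom)
    have "u = \<one>\<^bsub>semidirect N \<alpha> n\<^esub>" if u: "u \<in> carrier (semidirect N \<alpha> n)" "h u = \<one>\<^bsub>G\<^esub>" for u
    proof -
      obtain x i where [simp]: "u = (x, i)" by (metis surj_pair)
      have x: "x \<in> carrier N" "i < n" using u by (auto simp: semidirect_simps)
      have "c [^]\<^bsub>G\<^esub> i = inv\<^bsub>G\<^esub> (\<phi> x)"
        using u x c G.inv_equality[of "\<phi> x" "c [^]\<^bsub>G\<^esub> i"] G.inv_inv[of "c [^]\<^bsub>G\<^esub> i"]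
        by (simp add: h_def)
      also have "\<dots> = \<phi> (inv\<^bsub>N\<^esub> x)"
        using x group_hom.hom_inv[of N G \<phi> x] \<phi> by (simp add: group_hom_def group_hom_axioms_def)
      finally have "i = 0" using compl[of "inv\<^bsub>N\<^esub> x" i] x by auto
      hence "\<phi> x = \<phi> \<one>\<^bsub>N\<^esub>"
        using u x \<phi> group_hom.hom_one[of N G \<phi>] by (simp add: h_def group_hom_def group_hom_axioms_def)
      hence "x = \<one>\<^bsub>N\<^esub>" using inj x by (simp add: inj_on_def)
      thus ?thesis using \<open>i = 0\<close> by (simp add: semidirect_simps)
    qed
    thus ?thesis using h.inj_on_one_iff by blast
  qed
  moreover have "h ` carrier (semidirect N \<alpha> n) \<subseteq> carrier G" using hom by (auto simp: hom_def)
  moreover have "card (carrier (semidirect N \<alpha> n)) = card (carrier G)"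
    using ord by (simp add: order_def semidirect_simps card_cartesian_product)
  ultimately have "bij_betw h (carrier (semidirect N \<alpha> n)) (carrier G)"
    by (metis (no_types, lifting) bij_betw_def card_image card_subset_eq fin)
  thus ?thesis using hom by (auto simp: iso_def intro: is_isoI)
qed

text \<open>
  Here the action is not given: it is conjugation by \<open>c\<close>, read back through the embedding \<open>\<phi>\<close>.
\<close>

lemma semidirect_of_normalized_complement:
  assumes N: "group N" and G: "group G" and fin: "finite (carrier G)"
    and \<phi>: "\<phi> \<in> hom N G" and inj: "inj_on \<phi> (carrier N)"
    and img: "\<And>x. x \<in> carrier N \<Longrightarrow> c \<otimes>\<^bsub>G\<^esub> \<phi> x \<otimes>\<^bsub>G\<^esub> inv\<^bsub>G\<^esub> c \<in> \<phi> ` carrier N"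
    and c: "c \<in> carrier G" "c [^]\<^bsub>G\<^esub> n = \<one>\<^bsub>G\<^esub>" and n: "n > 0"
    and compl: "\<And>x i. x \<in> carrier N \<Longrightarrow> 0 < i \<Longrightarrow> i < n \<Longrightarrow> c [^]\<^bsub>G\<^esub> i \<noteq> \<phi> x"
    and ord: "order G = card (carrier N) * n"
  obtains \<alpha> where "cyclic_action N \<alpha> n" "\<And>x. x \<in> carrier N \<Longrightarrow> c \<otimes>\<^bsub>G\<^esub> \<phi> x = \<phi> (\<alpha> x) \<otimes>\<^bsub>G\<^esub> c"
    "semidirect N \<alpha> n \<cong> G"
proof -
  interpret N: group N by fact
  interpret G: group G by fact
  have \<phi>c [simp]: "\<phi> x \<in> carrier G" if "x \<in> carrier N" for x using \<phi> that by (auto simp: hom_def)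
  have \<phi>m: "\<phi> (x \<otimes>\<^bsub>N\<^esub> y) = \<phi> x \<otimes>\<^bsub>G\<^esub> \<phi> y" if "x \<in> carrier N" "y \<in> carrier N" for x y
    using \<phi> that by (auto simp: hom_def)
  define \<alpha> where "\<alpha> = (\<lambda>x. inv_into (carrier N) \<phi> (c \<otimes>\<^bsub>G\<^esub> \<phi> x \<otimes>\<^bsub>G\<^esub> inv\<^bsub>G\<^esub> c))"
  have \<alpha>c [simp]: "\<alpha> x \<in> carrier N" if "x \<in> carrier N" for x
    unfolding \<alpha>_def using img[OF that] by (rule inv_into_into)
  have \<phi>\<alpha>: "\<phi> (\<alpha> x) = c \<otimes>\<^bsub>G\<^esub> \<phi> x \<otimes>\<^bsub>G\<^esub> inv\<^bsub>G\<^esub> c" if "x \<in> carrier N" for x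
    unfolding \<alpha>_def using img[OF that] by (rule f_inv_into_f)
  have conj: "c \<otimes>\<^bsub>G\<^esub> \<phi> x = \<phi> (\<alpha> x) \<otimes>\<^bsub>G\<^esub> c" if "x \<in> carrier N" for x
    using that c by (simp add: \<phi>\<alpha> G.m_assoc)
  have inj': "x = y" if "x \<in> carrier N" "y \<in> carrier N" "\<phi> x = \<phi> y" for x y
    using inj that by (auto simp: inj_on_def)
  have hom: "\<alpha> \<in> hom N N"
  proof (rule homI)
    fix x y assume xy: "x \<in> carrier N" "y \<in> carrier N"
    have "\<phi> (\<alpha> (x \<otimes>\<^bsub>N\<^esub> y)) \<otimes>\<^bsub>G\<^esub> c = c \<otimes>\<^bsub>G\<^esub> \<phi> x \<otimes>\<^bsub>G\<^esub> \<phi> y"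
      using xy c by (simp flip: conj add: \<phi>m G.m_assoc)
    also have "\<dots> = \<phi> (\<alpha> x) \<otimes>\<^bsub>G\<^esub> (c \<otimes>\<^bsub>G\<^esub> \<phi> y)"
      using xy c by (simp add: conj G.m_assoc)
    also have "\<dots> = \<phi> (\<alpha> x \<otimes>\<^bsub>N\<^esub> \<alpha> y) \<otimes>\<^bsub>G\<^esub> c"
      using xy c by (simp add: conj \<phi>m G.m_assoc)
    finally show "\<alpha> (x \<otimes>\<^bsub>N\<^esub> y) = \<alpha> x \<otimes>\<^bsub>N\<^esub> \<alpha> y" using xy c by (intro inj') auto
  qed simp
  have powc: "(\<alpha> ^^ i) x \<in> carrier N \<and> \<phi> ((\<alpha> ^^ i) x) \<otimes>\<^bsub>G\<^esub> c [^]\<^bsub>G\<^esub> i = c [^]\<^bsub>G\<^esub> i \<otimes>\<^bsub>G\<^esub> \<phi> x"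
    if "x \<in> carrier N" for x and i :: nat
    using that
  proof (induction i arbitrary: x)
    case (Suc i)
    have "c [^]\<^bsub>G\<^esub> Suc i \<otimes>\<^bsub>G\<^esub> \<phi> x = c [^]\<^bsub>G\<^esub> i \<otimes>\<^bsub>G\<^esub> \<phi> (\<alpha> x) \<otimes>\<^bsub>G\<^esub> c"
      using Suc.prems c by (simp add: G.m_assoc conj)
    also have "\<dots> = \<phi> ((\<alpha> ^^ i) (\<alpha> x)) \<otimes>\<^bsub>G\<^esub> c [^]\<^bsub>G\<^esub> i \<otimes>\<^bsub>G\<^esub> c"
      using Suc.IH[of "\<alpha> x"] Suc.prems by simp
    also have "\<dots> = \<phi> ((\<alpha> ^^ Suc i) x) \<otimes>\<^bsub>G\<^esub> c [^]\<^bsub>G\<^esub> Suc i"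
      using Suc.IH[of "\<alpha> x"] Suc.prems c by (simp add: funpow_swap1 flip: G.m_assoc)
    finally show ?case using Suc.IH[of "\<alpha> x"] Suc.prems by (simp add: funpow_swap1)
  qed (auto simp: c)
  have per: "(\<alpha> ^^ n) x = x" if "x \<in> carrier N" for x
    using powc[of x n] that c by (intro inj') auto
  have act: "cyclic_action N \<alpha> n"
    using N n hom per by (simp add: cyclic_action_def cyclic_action_axioms_def)
  show ?thesis
    using that[OF act conj semidirect_recognition[OF act G fin \<phi> inj c conj compl ord]] by blast
qed

text \<open>
  Two actions give isomorphic groups if one is conjugate to a power of the other with an exponent prime to \<open>n\<close>:
  \<open>c\<^sup>k\<close> generates the same cyclic group as \<open>c\<close>.
\<close>

lemma semidirect_isoI:
  assumes "cyclic_action N \<alpha> n" "cyclic_action M \<beta> n" and fin: "finite (carrier N)"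
    and \<theta>: "\<theta> \<in> iso N M" and k: "coprime k n"
    and conj: "\<And>x. x \<in> carrier N \<Longrightarrow> \<theta> (\<alpha> x) = (\<beta> ^^ k) (\<theta> x)"
  shows "semidirect N \<alpha> n \<cong> semidirect M \<beta> n"
proof -
  interpret A: cyclic_action N \<alpha> n by fact
  interpret B: cyclic_action M \<beta> n by fact
  have bij: "bij_betw \<theta> (carrier N) (carrier M)" and hom: "\<theta> \<in> hom N M" using \<theta> by (auto simp: iso_def)
  have finM: "finite (carrier M)" using bij fin bij_betw_finite by blast
  have \<theta>c [simp]: "\<theta> x \<in> carrier M" if "x \<in> carrier N" for x using hom that by (auto simp: hom_def)
  have \<theta>m: "\<theta> (x \<otimes>\<^bsub>N\<^esub> y) = \<theta> x \<otimes>\<^bsub>M\<^esub> \<theta> y" if "x \<in> carrier N" "y \<in> carrier N" for x y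
    using hom that by (auto simp: hom_def)
  show ?thesis
  proof (rule semidirect_recognition[OF assms(1) B.group_semidirect B.finite_semidirect[OF finM],
        where \<phi> = "\<lambda>x. (\<theta> x, 0)" and c = "(\<one>\<^bsub>M\<^esub>, k mod n)"])
    show "(\<lambda>x. (\<theta> x, 0)) \<in> hom N (semidirect M \<beta> n)"
      by (rule homI) (auto simp: B.semidirect_simps \<theta>m A.n_pos)
    show "inj_on (\<lambda>x. (\<theta> x, 0::nat)) (carrier N)"
      using bij by (auto simp: bij_betw_def inj_on_def)
    show "(\<one>\<^bsub>M\<^esub>, k mod n) \<in> carrier (semidirect M \<beta> n)"
      using A.n_pos by (simp add: B.semidirect_simps)
    show "(\<one>\<^bsub>M\<^esub>, k mod n) [^]\<^bsub>semidirect M \<beta> n\<^esub> n = \<one>\<^bsub>semidirect M \<beta> n\<^esub>"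
      by (simp add: B.pow_complement B.one_semidirect)
    show "(\<one>\<^bsub>M\<^esub>, k mod n) \<otimes>\<^bsub>semidirect M \<beta> n\<^esub> (\<theta> x, 0) = (\<theta> (\<alpha> x), 0) \<otimes>\<^bsub>semidirect M \<beta> n\<^esub> (\<one>\<^bsub>M\<^esub>, k mod n)"
      if "x \<in> carrier N" for x
      using that by (simp add: B.semidirect_simps conj B.funpow_mod)
    show "(\<one>\<^bsub>M\<^esub>, k mod n) [^]\<^bsub>semidirect M \<beta> n\<^esub> i \<noteq> (\<theta> x, 0)" if "0 < i" "i < n" for i x
    proof -
      have "\<not> n dvd k * i" using that k by (metis coprime_commute coprime_dvd_mult_right_iff nat_dvd_not_less)
      thus ?thesis by (auto simp: B.pow_complement dvd_eq_mod_eq_0)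
    qed
    show "order (semidirect M \<beta> n) = card (carrier N) * n"
      using bij_betw_same_card[OF bij] by (simp add: B.order_semidirect)
  qed
qed

context cyclic_action
begin

lemma comm_groupD:
  assumes "comm_group (semidirect N \<alpha> n)" "n > 1" "x \<in> carrier N"
  shows "\<alpha> x = x"
proof -
  interpret C: comm_group "semidirect N \<alpha> n" by fact
  show ?thesis
    using C.m_comm[of "(\<one>, 1)" "(x, 0)"] assms by (simp add: semidirect_simps)
qed

lemma comm_groupI:
  assumes "comm_group N" "\<And>x. x \<in> carrier N \<Longrightarrow> \<alpha> x = x"
  shows "comm_group (semidirect N \<alpha> n)"
proof -
  interpret C: comm_group N by fact
  have triv: "(\<alpha> ^^ i) x = x" if "x \<in> carrier N" for x i
    using that assms(2) by (induction i) auto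
  show ?thesis
    by (rule SD.group_comm_groupI) (auto simp: semidirect_simps triv C.m_comm add.commute)
qed

text \<open>
  For coprime orders the normal subgroup is recognized inside the abstract group.
\<close>

lemma fst_torsion:
  assumes fin: "finite (carrier N)" and cop: "coprime (card (carrier N)) n"
    and g: "g \<in> carrier (semidirect N \<alpha> n)"
  shows "g [^]\<^bsub>semidirect N \<alpha> n\<^esub> card (carrier N) = \<one>\<^bsub>semidirect N \<alpha> n\<^esub> \<longleftrightarrow> snd g = 0"
proof
  assume "g [^]\<^bsub>semidirect N \<alpha> n\<^esub> card (carrier N) = \<one>\<^bsub>semidirect N \<alpha> n\<^esub>"
  hence "(card (carrier N) * snd g) mod n = 0" using snd_pow[OF g, of "card (carrier N)"] by (simp add: one_semidirect)
  hence "n dvd card (carrier N) * snd g" by auto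
  hence "n dvd snd g" using cop by (simp add: coprime_commute coprime_dvd_mult_right_iff)
  thus "snd g = 0" using g by (auto simp: carrier_semidirect dest: nat_dvd_not_less)
next
  assume *: "snd g = 0"
  have "fst g \<in> carrier N" using g by (auto simp: carrier_semidirect)
  moreover from this have "fst g [^] card (carrier N) = \<one>"
    using N.pow_order_eq_1 fin by (simp add: order_def)
  ultimately show "g [^]\<^bsub>semidirect N \<alpha> n\<^esub> card (carrier N) = \<one>\<^bsub>semidirect N \<alpha> n\<^esub>"
    using * pow_fst[of "fst g"] by (cases g) (simp add: one_semidirect)
qed

text \<open>
  The commutators of \<open>N\<close> with the acting generator; they measure by how much \<open>\<alpha>\<close> differs from the identity.
\<close>

lemma commutator_fst:
  assumes "n > 1" "x \<in> carrier N"
  shows "(x, 0) \<otimes>\<^bsub>semidirect N \<alpha> n\<^esub> (\<one>, 1) \<otimes>\<^bsub>semidirect N \<alpha> n\<^esub> (inv x, 0) \<otimes>\<^bsub>semidirect N \<alpha> n\<^esub> (\<one>, n - 1) = (x \<otimes> inv (\<alpha> x), 0)"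
proof -
  interpret h: group_hom N N \<alpha> by unfold_locales (rule hom)
  show ?thesis using assms by (simp add: semidirect_simps)
qed

end

text \<open>
  A converse of \<open>semidirect_isoI\<close> for coprime orders: an isomorphism \<open>f\<close> preserves the normal subgroup, which consists of the
  elements of order dividing \<open>|N|\<close>. It sends the acting generator to some \<open>(u, s)\<close>, and \<open>u\<close> has no effect on the
  conjugation because \<open>M\<close> is commutative.
\<close>

lemma semidirect_isoD:
  assumes "cyclic_action N \<alpha> n" "cyclic_action M \<beta> n" and fin: "finite (carrier N)"
    and M: "comm_group M"
    and card: "card (carrier N) = card (carrier M)" and cop: "coprime (card (carrier N)) n"
    and iso: "semidirect N \<alpha> n \<cong> semidirect M \<beta> n" and n: "n > 1"
  obtains \<theta> s where "\<theta> \<in> iso N M" "\<And>x. x \<in> carrier N \<Longrightarrow> \<theta> (\<alpha> x) = (\<beta> ^^ s) (\<theta> x)"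
proof -
  interpret A: cyclic_action N \<alpha> n by fact
  interpret B: cyclic_action M \<beta> n by fact
  interpret M: comm_group M by fact
  let ?A = "semidirect N \<alpha> n" and ?B = "semidirect M \<beta> n"
  obtain f where f: "f \<in> iso ?A ?B" using iso by (auto simp: is_iso_def)
  interpret f: group_hom ?A ?B f by unfold_locales (use f in \<open>auto simp: iso_def\<close>)
  have finj: "inj_on f (carrier ?A)" using f by (auto simp: iso_def bij_betw_def)
  have "card (carrier M) > 0" using card fin A.N.one_closed by (metis card_gt_0_iff empty_iff)
  hence finM: "finite (carrier M)" using card_gt_0_iff by blast
  have f0: "snd (f (x, 0)) = 0" if "x \<in> carrier N" for x
  proof -
    have "(x, 0) \<in> carrier ?A" using that n by (simp add: A.semidirect_simps)
    moreover from this have "(x, 0) [^]\<^bsub>?A\<^esub> card (carrier M) = \<one>\<^bsub>?A\<^esub>"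
      using A.fst_torsion[OF fin cop] card by simp
    hence "f (x, 0) [^]\<^bsub>?B\<^esub> card (carrier M) = \<one>\<^bsub>?B\<^esub>" 
      using calculation f.hom_nat_pow f.hom_one by metis
    ultimately show ?thesis using B.fst_torsion[OF finM] cop card by simp
  qed
  define \<theta> where "\<theta> = (\<lambda>x. fst (f (x, 0)))"
  have f\<theta>: "f (x, 0) = (\<theta> x, 0)" if "x \<in> carrier N" for x
    using f0[OF that] by (simp add: \<theta>_def prod_eq_iff)
  have \<theta>c: "\<theta> x \<in> carrier M" if "x \<in> carrier N" for x
    using f.hom_closed[of "(x, 0)"] that n by (simp add: f\<theta> A.semidirect_simps B.semidirect_simps)
  have hom: "\<theta> \<in> hom N M"
  proof (rule homI)
    fix x y assume xy: "x \<in> carrier N" "y \<in> carrier N"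
    have "f ((x, 0) \<otimes>\<^bsub>?A\<^esub> (y, 0)) = f (x, 0) \<otimes>\<^bsub>?B\<^esub> f (y, 0)"
      using xy n by (intro f.hom_mult) (auto simp: A.semidirect_simps)
    thus "\<theta> (x \<otimes>\<^bsub>N\<^esub> y) = \<theta> x \<otimes>\<^bsub>M\<^esub> \<theta> y"
      using xy by (simp add: A.semidirect_simps B.semidirect_simps f\<theta>)
  qed (rule \<theta>c)
  have inj: "inj_on \<theta> (carrier N)"
  proof (rule inj_onI)
    fix x y assume xy: "x \<in> carrier N" "y \<in> carrier N" "\<theta> x = \<theta> y"
    hence "f (x, 0) = f (y, 0)" by (simp add: f\<theta>)
    moreover have "(x, 0) \<in> carrier ?A" "(y, 0) \<in> carrier ?A" using xy n by (auto simp: A.semidirect_simps)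
    ultimately show "x = y" using inj_onD[OF finj] by blast
  qed
  have bij: "bij_betw \<theta> (carrier N) (carrier M)"
    unfolding bij_betw_def using inj \<theta>c card finM
    by (metis card_image card_subset_eq image_subsetI)
  obtain u s where us: "f (\<one>\<^bsub>N\<^esub>, 1) = (u, s)" by (metis surj_pair)
  have c: "(\<one>\<^bsub>N\<^esub>, 1) \<in> carrier ?A" using n by (simp add: A.semidirect_simps)
  have u: "u \<in> carrier M" using f.hom_closed[OF c] us by (simp add: B.semidirect_simps)
  have "\<theta> (\<alpha> x) = (\<beta> ^^ s) (\<theta> x)" if x: "x \<in> carrier N" for x
  proof -
    have "f ((\<one>\<^bsub>N\<^esub>, 1) \<otimes>\<^bsub>?A\<^esub> (x, 0)) = f ((\<alpha> x, 0) \<otimes>\<^bsub>?A\<^esub> (\<one>\<^bsub>N\<^esub>, 1))"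
      using x n by (simp add: A.semidirect_simps)
    hence "f (\<one>\<^bsub>N\<^esub>, 1) \<otimes>\<^bsub>?B\<^esub> f (x, 0) = f (\<alpha> x, 0) \<otimes>\<^bsub>?B\<^esub> f (\<one>\<^bsub>N\<^esub>, 1)"
      using x n c f.hom_mult[of "(\<one>\<^bsub>N\<^esub>, 1)" "(x, 0)"] f.hom_mult[of "(\<alpha> x, 0)" "(\<one>\<^bsub>N\<^esub>, 1)"]
      by (simp add: A.carrier_semidirect)
    hence "u \<otimes>\<^bsub>M\<^esub> (\<beta> ^^ s) (\<theta> x) = \<theta> (\<alpha> x) \<otimes>\<^bsub>M\<^esub> u"
      using x by (simp add: us[unfolded One_nat_def] f\<theta> B.semidirect_simps)
    hence "(\<beta> ^^ s) (\<theta> x) \<otimes>\<^bsub>M\<^esub> u = \<theta> (\<alpha> x) \<otimes>\<^bsub>M\<^esub> u"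
      using x u by (simp add: M.m_comm \<theta>c)
    thus ?thesis using x u by (simp add: \<theta>c B.N.right_cancel)
  qed
  thus ?thesis using that[of \<theta> s] hom bij by (auto simp: iso_def)
qed

section \<open>Isomorphism invariants\<close>

text \<open>
  For a group of order \<open>p\<^sup>2 q\<close> and \<open>e = p\<^sup>2\<close> this says that the Sylow \<open>p\<close>-subgroup is normal. The formulation by
  elements makes the invariance under isomorphisms immediate.
\<close>

definition torsion_closed :: "nat \<Rightarrow> ('a, 'b) monoid_scheme \<Rightarrow> bool" where
  "torsion_closed e G \<longleftrightarrow>
     (\<forall>x\<in>carrier G. \<forall>y\<in>carrier G. x [^]\<^bsub>G\<^esub> e = \<one>\<^bsub>G\<^esub> \<longrightarrow> y [^]\<^bsub>G\<^esub> e = \<one>\<^bsub>G\<^esub> \<longrightarrow>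
        (x \<otimes>\<^bsub>G\<^esub> y) [^]\<^bsub>G\<^esub> e = \<one>\<^bsub>G\<^esub>)"

definition has_elem_order_square :: "nat \<Rightarrow> ('a, 'b) monoid_scheme \<Rightarrow> bool" where
  "has_elem_order_square p G \<longleftrightarrow>
     (\<exists>x\<in>carrier G. x [^]\<^bsub>G\<^esub> (p\<^sup>2) = \<one>\<^bsub>G\<^esub> \<and> x [^]\<^bsub>G\<^esub> p \<noteq> \<one>\<^bsub>G\<^esub>)"

definition nontrivial_centre :: "('a, 'b) monoid_scheme \<Rightarrow> bool" where
  "nontrivial_centre G \<longleftrightarrow>
     (\<exists>z\<in>carrier G. z \<noteq> \<one>\<^bsub>G\<^esub> \<and> (\<forall>x\<in>carrier G. z \<otimes>\<^bsub>G\<^esub> x = x \<otimes>\<^bsub>G\<^esub> z))"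

locale group_iso = G: group G + H: group H for G (structure) and H (structure) +
  fixes f assumes iso: "f \<in> iso G H"
begin

sublocale group_hom G H f using iso by unfold_locales (auto simp: iso_def)

lemma surjE:
  assumes "y \<in> carrier H" obtains x where "x \<in> carrier G" "y = f x"
  using iso assms by (auto simp: iso_def bij_betw_def)

lemma inj: "x \<in> carrier G \<Longrightarrow> y \<in> carrier G \<Longrightarrow> f x = f y \<longleftrightarrow> x = y"
  using iso by (auto simp: iso_def bij_betw_def inj_on_def)

lemma pow_one: "x \<in> carrier G \<Longrightarrow> f x [^]\<^bsub>H\<^esub> (k::nat) = \<one>\<^bsub>H\<^esub> \<longleftrightarrow> x [^]\<^bsub>G\<^esub> k = \<one>\<^bsub>G\<^esub>"
  by (metis inj hom_nat_pow hom_one G.nat_pow_closed G.one_closed)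

lemma torsion_closed:
  assumes "torsion_closed e G" shows "torsion_closed e H"
  unfolding torsion_closed_def
proof (intro ballI impI)
  fix x y assume xy: "x \<in> carrier H" "y \<in> carrier H" "x [^]\<^bsub>H\<^esub> e = \<one>\<^bsub>H\<^esub>" "y [^]\<^bsub>H\<^esub> e = \<one>\<^bsub>H\<^esub>"
  obtain x' y' where [simp]: "x' \<in> carrier G" "x = f x'" "y' \<in> carrier G" "y = f y'"
    using surjE[OF xy(1)] surjE[OF xy(2)] by metis
  have "(x' \<otimes>\<^bsub>G\<^esub> y') [^]\<^bsub>G\<^esub> e = \<one>\<^bsub>G\<^esub>" using xy assms by (auto simp: torsion_closed_def pow_one)
  thus "(x \<otimes>\<^bsub>H\<^esub> y) [^]\<^bsub>H\<^esub> e = \<one>\<^bsub>H\<^esub>" using pow_one[of "x' \<otimes>\<^bsub>G\<^esub> y'" e] by simp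
qed

lemma has_elem_order_square: "has_elem_order_square p G \<Longrightarrow> has_elem_order_square p H"
  unfolding has_elem_order_square_def by (metis pow_one hom_closed)

lemma nontrivial_centre:
  assumes "nontrivial_centre G" shows "nontrivial_centre H"
proof -
  obtain z where z: "z \<in> carrier G" "z \<noteq> \<one>\<^bsub>G\<^esub>" "\<And>x. x \<in> carrier G \<Longrightarrow> z \<otimes>\<^bsub>G\<^esub> x = x \<otimes>\<^bsub>G\<^esub> z"
    using assms by (auto simp: nontrivial_centre_def)
  have "f z \<otimes>\<^bsub>H\<^esub> y = y \<otimes>\<^bsub>H\<^esub> f z" if y: "y \<in> carrier H" for y
  proof -
    obtain x where x: "x \<in> carrier G" "y = f x" by (rule surjE[OF y])
    show ?thesis using x z(3)[OF x(1)] hom_mult[of z x] hom_mult[of x z] z(1) by simp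
  qed
  thus ?thesis unfolding nontrivial_centre_def
    using z inj[of z "\<one>\<^bsub>G\<^esub>"] by (intro bexI[of _ "f z"]) auto
qed

lemma comm_group: "comm_group G \<Longrightarrow> comm_group H"
  using comm_group.iso_imp_comm_group[OF _ is_isoI[OF iso]] H.is_monoid by blast

end

lemma iso_invariants:
  assumes "group G" "group H" "G \<cong> H"
  shows "comm_group G \<longleftrightarrow> comm_group H" "torsion_closed e G \<longleftrightarrow> torsion_closed e H"
    "has_elem_order_square p G \<longleftrightarrow> has_elem_order_square p H"
    "nontrivial_centre G \<longleftrightarrow> nontrivial_centre H"
proof -
  obtain f where f: "f \<in> iso G H" using assms by (auto simp: is_iso_def)
  obtain g where g: "g \<in> iso H G" using group.iso_sym[OF assms(1,3)] by (auto simp: is_iso_def)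
  interpret f: group_iso G H f
    using assms f by (auto simp: group_iso_def group_iso_axioms_def)
  interpret g: group_iso H G g
    using assms g by (auto simp: group_iso_def group_iso_axioms_def)
  show "comm_group G \<longleftrightarrow> comm_group H" using f.comm_group g.comm_group by blast
  show "torsion_closed e G \<longleftrightarrow> torsion_closed e H" using f.torsion_closed g.torsion_closed by blast
  show "has_elem_order_square p G \<longleftrightarrow> has_elem_order_square p H"
    using f.has_elem_order_square g.has_elem_order_square by blast
  show "nontrivial_centre G \<longleftrightarrow> nontrivial_centre H"
    using f.nontrivial_centre g.nontrivial_centre by blast
qed

context cyclic_action
begin

lemma torsion_closed_card:
  assumes "finite (carrier N)" "coprime (card (carrier N)) n"
  shows "torsion_closed (card (carrier N)) (semidirect N \<alpha> n)"
  unfolding torsion_closed_def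
proof (intro ballI impI)
  fix x y assume xy: "x \<in> carrier (semidirect N \<alpha> n)" "y \<in> carrier (semidirect N \<alpha> n)"
    "x [^]\<^bsub>semidirect N \<alpha> n\<^esub> card (carrier N) = \<one>\<^bsub>semidirect N \<alpha> n\<^esub>"
    "y [^]\<^bsub>semidirect N \<alpha> n\<^esub> card (carrier N) = \<one>\<^bsub>semidirect N \<alpha> n\<^esub>"
  hence "snd x = 0" "snd y = 0" using fst_torsion[OF assms] by auto
  hence "snd (x \<otimes>\<^bsub>semidirect N \<alpha> n\<^esub> y) = 0" by (cases x; cases y) (simp add: semidirect_simps)
  thus "(x \<otimes>\<^bsub>semidirect N \<alpha> n\<^esub> y) [^]\<^bsub>semidirect N \<alpha> n\<^esub> card (carrier N) = \<one>\<^bsub>semidirect N \<alpha> n\<^esub>"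
    using xy SD.m_closed by (subst fst_torsion[OF assms]) auto
qed

text \<open>
  The generator of the acting group and its conjugate by \<open>x\<close> both have order dividing \<open>e\<close>; their quotient is
  a commutator, which lies in \<open>N\<close>.
\<close>

lemma torsion_closedD:
  assumes closed: "torsion_closed e (semidirect N \<alpha> n)" and "n dvd e" "n > 1" and x: "x \<in> carrier N"
  shows "(x \<otimes> inv (\<alpha> x)) [^] e = \<one>"
proof -
  let ?G = "semidirect N \<alpha> n"
  let ?c = "(\<one>, 1) :: 'a \<times> nat"
  have c: "?c \<in> carrier ?G" "(\<one>, n - 1) \<in> carrier ?G" "(x, 0) \<in> carrier ?G" "(inv x, 0) \<in> carrier ?G"
    using assms by (auto simp: semidirect_simps)
  obtain k where k: "e = n * k" using \<open>n dvd e\<close> by blast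
  have tc: "(\<one>, j) [^]\<^bsub>?G\<^esub> e = \<one>\<^bsub>?G\<^esub>" if "j < n" for j
    using pow_complement[of j e] that k by (simp add: one_semidirect)
  have "((x, 0) \<otimes>\<^bsub>?G\<^esub> ?c \<otimes>\<^bsub>?G\<^esub> (inv x, 0)) [^]\<^bsub>?G\<^esub> e = (x, 0) \<otimes>\<^bsub>?G\<^esub> ?c [^]\<^bsub>?G\<^esub> e \<otimes>\<^bsub>?G\<^esub> (inv x, 0)"
  proof (induction e)
    case 0
    show ?case using x n_pos by (simp add: semidirect_simps)
  next
    case (Suc e)
    have "(inv x, 0) \<otimes>\<^bsub>?G\<^esub> ((x, 0) \<otimes>\<^bsub>?G\<^esub> ?c \<otimes>\<^bsub>?G\<^esub> (inv x, 0)) = ?c \<otimes>\<^bsub>?G\<^esub> (inv x, 0)"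
      using c SD.m_assoc inv_fst[OF x] SD.l_inv[OF c(3)] SD.l_one SD.m_closed by metis
    thus ?case using Suc c by (simp add: SD.m_assoc)
  qed
  also have "\<dots> = \<one>\<^bsub>?G\<^esub>"
    using tc[of 1] assms c inv_fst[OF x] SD.r_inv[OF c(3)] by simp
  finally have "((x, 0) \<otimes>\<^bsub>?G\<^esub> ?c \<otimes>\<^bsub>?G\<^esub> (inv x, 0) \<otimes>\<^bsub>?G\<^esub> (\<one>, n - 1)) [^]\<^bsub>?G\<^esub> e = \<one>\<^bsub>?G\<^esub>"
    using closed tc[of "n - 1"] assms c by (simp add: torsion_closed_def)
  hence "(x \<otimes> inv (\<alpha> x), 0) [^]\<^bsub>?G\<^esub> e = \<one>\<^bsub>?G\<^esub>"
    using commutator_fst[of x] assms by simp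
  thus ?thesis using x by (simp add: pow_fst one_semidirect)
qed

end

section \<open>Subgroups of finite groups\<close>

context group
begin

text \<open>
  Each element of \<open>H K\<close> is a product \<open>h k\<close> in at most \<open>|H \<inter> K|\<close> ways.
\<close>

lemma card_set_mult_ge:
  assumes H: "subgroup H G" and K: "subgroup K G" and fin: "finite H" "finite K"
  shows "card H * card K \<le> card (H <#> K) * card (H \<inter> K)"
proof -
  interpret H: subgroup H G by fact
  interpret K: subgroup K G by fact
  let ?f = "\<lambda>(h, k). h \<otimes> k"
  have img: "?f ` (H \<times> K) = H <#> K" by (auto simp: set_mult_def)
  have fiber: "card {u \<in> H \<times> K. ?f u = z} \<le> card (H \<inter> K)" if "z \<in> ?f ` (H \<times> K)" for z
  proof -
    obtain h0 k0 where 0: "h0 \<in> H" "k0 \<in> K" "z = h0 \<otimes> k0" using \<open>z \<in> _\<close> by auto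
    let ?g = "\<lambda>(h, k). inv h0 \<otimes> h"
    have "inj_on ?g {u \<in> H \<times> K. ?f u = z}"
    proof (rule inj_onI)
      fix u v assume uv: "u \<in> {u \<in> H \<times> K. ?f u = z}" "v \<in> {u \<in> H \<times> K. ?f u = z}" "?g u = ?g v"
      obtain h k h' k' where [simp]: "u = (h, k)" "v = (h', k')" by (metis surj_pair)
      have "h = h'" using uv 0 H.mem_carrier by auto
      moreover from this have "k = k'" using uv H.mem_carrier K.mem_carrier by auto
      ultimately show "u = v" by simp
    qed
    moreover have "?g ` {u \<in> H \<times> K. ?f u = z} \<subseteq> H \<inter> K"
    proof
      fix w assume "w \<in> ?g ` {u \<in> H \<times> K. ?f u = z}"
      then obtain h k where hk: "h \<in> H" "k \<in> K" "h \<otimes> k = h0 \<otimes> k0" "w = inv h0 \<otimes> h" using 0 by auto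
      have "h = h0 \<otimes> k0 \<otimes> inv k"
        using hk 0 inv_solve_right[of h "h0 \<otimes> k0" k] H.mem_carrier K.mem_carrier by auto
      hence "inv h0 \<otimes> h = k0 \<otimes> inv k"
        using hk 0 H.mem_carrier K.mem_carrier by (simp add: m_assoc inv_solve_left')
      moreover have "inv h0 \<otimes> h \<in> H" "k0 \<otimes> inv k \<in> K" using hk 0 by auto
      ultimately show "w \<in> H \<inter> K" using hk by auto
    qed
    ultimately show ?thesis using fin by (meson card_inj_on_le finite_Int)
  qed
  have "card H * card K = (\<Sum>u\<in>H \<times> K. 1)" by (simp add: card_cartesian_product)
  also have "\<dots> = (\<Sum>z\<in>?f ` (H \<times> K). \<Sum>u\<in>{u \<in> H \<times> K. ?f u = z}. 1)"
    using fin by (intro sum.image_gen) auto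
  also have "\<dots> \<le> (\<Sum>z\<in>?f ` (H \<times> K). card (H \<inter> K))"
    by (intro sum_mono) (use fiber in simp)
  finally show ?thesis by (simp add: img)
qed

lemma card_subgroup_dvd:
  assumes "subgroup H G" "subgroup K G" "H \<subseteq> K" "finite K"
  shows "card H dvd card K"
proof -
  interpret K: group "G\<lparr>carrier := K\<rparr>" using assms subgroup_imp_group by blast
  have "subgroup H (G\<lparr>carrier := K\<rparr>)" using assms subgroup_incl by blast
  hence "card (rcosets\<^bsub>G\<lparr>carrier := K\<rparr>\<^esub> H) * card H = card K"
    using K.lagrange by (simp add: order_def)
  thus ?thesis by (metis dvd_triv_right)
qed

lemma ord_dvd_card_subgroup:
  assumes "subgroup H G" "finite H" "x \<in> H"
  shows "ord x dvd card H"
proof -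
  interpret H: group "G\<lparr>carrier := H\<rparr>" using assms subgroup_imp_group by blast
  have "x [^]\<^bsub>G\<lparr>carrier := H\<rparr>\<^esub> card H = \<one>"
    using H.pow_order_eq_1[of x] assms by (simp add: order_def)
  hence "x [^] card H = \<one>" by (simp flip: nat_pow_consistent)
  thus ?thesis using pow_eq_id[OF subgroup.mem_carrier[OF assms(1,3)]] by simp
qed

lemma coprime_subgroups_Int:
  assumes "subgroup H G" "subgroup K G" "finite H" "finite K" "coprime (card H) (card K)"
  shows "H \<inter> K = {\<one>}"
proof -
  have "x = \<one>" if "x \<in> H" "x \<in> K" for x
  proof -
    have "ord x dvd card H" "ord x dvd card K" using ord_dvd_card_subgroup assms that by auto
    hence "ord x = 1" using coprime_common_divisor_nat[OF assms(5)] by blast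
    thus ?thesis using ord_eq_1 subgroup.mem_carrier[OF assms(1) that(1)] by simp
  qed
  thus ?thesis using assms subgroup.one_closed by blast
qed

text \<open>
  Conjugating \<open>n\<close> times by \<open>y\<close> raises \<open>x\<close> to the power \<open>a\<^sup>n\<close>, and \<open>y\<^sup>n = 1\<close> acts trivially.
\<close>

lemma conj_power_cong:
  fixes a n :: nat
  assumes x: "x \<in> carrier G" and y: "y \<in> carrier G" and yx: "y \<otimes> x = x [^] a \<otimes> y" and n: "y [^] n = \<one>"
  shows "[a ^ n = 1] (mod ord x)"
proof -
  have yxk: "y \<otimes> x [^] k = x [^] (a * k) \<otimes> y" for k :: nat
  proof (induction k)
    case (Suc k)
    have "y \<otimes> x [^] Suc k = x [^] (a * k) \<otimes> (y \<otimes> x)" using Suc x y by (simp flip: m_assoc)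
    thus ?case using x y yx by (simp add: nat_pow_mult add.commute flip: m_assoc)
  qed (use y in simp)
  have "y [^] k \<otimes> x = x [^] (a ^ k) \<otimes> y [^] k" for k :: nat
  proof (induction k)
    case (Suc k)
    have y': "y [^] Suc k = y \<otimes> y [^] k" using nat_pow_Suc2[OF y] .
    have "y [^] Suc k \<otimes> x = y \<otimes> (y [^] k \<otimes> x)" unfolding y' using x y by (simp add: m_assoc)
    also have "\<dots> = x [^] (a ^ Suc k) \<otimes> (y \<otimes> y [^] k)" unfolding Suc using x y yxk[of "a ^ k"] by (simp flip: m_assoc)
    finally show ?case unfolding y' .
  qed (use x in simp)
  from this[of n] have "x [^] (a ^ n) = x" using n x by simp
  hence "x [^] int (a ^ n) = x [^] int 1" using x by (simp add: int_pow_int del: of_nat_power)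
  from iffD1[OF int_pow_eq[OF x] this] have "int (ord x) dvd int 1 - int (a ^ n)" .
  hence "[int 1 = int (a ^ n)] (mod int (ord x))" by (simp only: cong_iff_dvd_diff)
  thus ?thesis by (simp only: cong_int_iff cong_sym)
qed

definition conj_subgroup :: "'a \<Rightarrow> 'a set \<Rightarrow> 'a set" where
  "conj_subgroup g H = (\<lambda>h. g \<otimes> h \<otimes> inv g) ` H"

lemma conj_hom: "g \<in> carrier G \<Longrightarrow> (\<lambda>h. g \<otimes> h \<otimes> inv g) \<in> hom G G"
proof (rule homI)
  fix x y assume g: "g \<in> carrier G" and xy: "x \<in> carrier G" "y \<in> carrier G"
  have "inv g \<otimes> (g \<otimes> (y \<otimes> inv g)) = y \<otimes> inv g"
    using g xy by (simp flip: m_assoc)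
  thus "g \<otimes> (x \<otimes> y) \<otimes> inv g = (g \<otimes> x \<otimes> inv g) \<otimes> (g \<otimes> y \<otimes> inv g)"
    using g xy by (simp add: m_assoc)
qed simp

lemma subgroup_conj:
  assumes "g \<in> carrier G" "subgroup H G" shows "subgroup (conj_subgroup g H) G"
proof -
  interpret h: group_hom G G "\<lambda>h. g \<otimes> h \<otimes> inv g"
    using conj_hom[OF assms(1)] by unfold_locales
  show ?thesis unfolding conj_subgroup_def using h.subgroup_img_is_subgroup assms by blast
qed

lemma card_conj:
  assumes "g \<in> carrier G" "H \<subseteq> carrier G" shows "card (conj_subgroup g H) = card H"
  unfolding conj_subgroup_def using assms by (intro card_image inj_onI) (auto simp: subset_iff)

lemma normal_iff_conj_subset:
  assumes "subgroup H G" 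
  shows "H \<lhd> G \<longleftrightarrow> (\<forall>g\<in>carrier G. conj_subgroup g H \<subseteq> H)"
  using assms by (auto simp: normal_inv_iff conj_subgroup_def)

lemma coset_conj_eq: "g <# H #> inv g = conj_subgroup g H"
  by (auto simp: conj_subgroup_def l_coset_def r_coset_def)

lemma normalizer_eq: "H \<subseteq> carrier G \<Longrightarrow> normalizer G H = {g \<in> carrier G. conj_subgroup g H = H}"
  by (auto simp: normalizer_def stabilizer_def coset_conj_eq)

lemma card_conjugates:
  assumes "subgroup H G" "finite (carrier G)"
  shows "card ((\<lambda>g. conj_subgroup g H) ` carrier G) * card (normalizer G H) = order G"
proof -
  have sub: "H \<subseteq> carrier G" using assms subgroup.subset by blast
  interpret A: group_action G "{H. H \<subseteq> carrier G}" "\<lambda>g. \<lambda>H \<in> {H. H \<subseteq> carrier G}. g <# H #> (inv g)"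
    by (rule action_by_conjugation_on_power_set)
  have "orbit G (\<lambda>g. \<lambda>H \<in> {H. H \<subseteq> carrier G}. g <# H #> (inv g)) H = (\<lambda>g. conj_subgroup g H) ` carrier G"
    using sub by (auto simp: orbit_def coset_conj_eq)
  thus ?thesis
    using A.orbit_stabilizer_theorem[of H] sub unfolding normalizer_def by simp
qed

lemma prime_order_subgroups_Int:
  assumes "subgroup H G" "subgroup K G" "finite H" "finite K" "card H = q" "card K = q" "prime q" "H \<noteq> K"
  shows "H \<inter> K = {\<one>}"
proof -
  have HK: "subgroup (H \<inter> K) G" using assms subgroups_Inter_pair by blast
  have "card (H \<inter> K) dvd q" using card_subgroup_dvd[OF HK assms(1)] assms by auto
  moreover have "card (H \<inter> K) \<noteq> q"
    using assms by (metis Int_lower1 Int_lower2 card_subset_eq)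
  ultimately have "card (H \<inter> K) = 1" using \<open>prime q\<close> by (metis prime_nat_iff)
  thus ?thesis using subgroup.one_closed[OF HK] by (metis card_1_singletonE singletonD)
qed

text \<open>
  Two different subgroups of order \<open>q\<close> would have \<open>q\<^sup>2\<close> products inside \<open>N\<close>.
\<close>

lemma subgroup_prime_unique:
  assumes "subgroup H G" "subgroup K G" "subgroup N G" "H \<subseteq> N" "K \<subseteq> N" "finite N"
    and "card H = q" "card K = q" "prime q" and N: "card N < q * q"
  shows "H = K"
proof (rule ccontr)
  assume "H \<noteq> K"
  have fin: "finite H" "finite K" using assms finite_subset by blast+
  have "H \<inter> K = {\<one>}" using prime_order_subgroups_Int assms fin \<open>H \<noteq> K\<close> by metis
  hence "q * q \<le> card (H <#> K)" using card_set_mult_ge[of H K] assms fin by simp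
  also have "H <#> K \<subseteq> N" using assms(3-5) subgroup.m_closed by (fastforce simp: set_mult_def)
  hence "card (H <#> K) \<le> card N" using assms card_mono by blast
  finally show False using N by simp
qed

end

context group
begin

text \<open>
  The product set of \<open>P\<close> and a conjugate has \<open>p\<^sup>4 / |P \<inter> P'|\<close> elements. This exceeds \<open>p\<^sup>2 q\<close> unless the
  two subgroups are equal.
\<close>

lemma normal_sylow_of_larger_prime_square:
  assumes fin: "finite (carrier G)" and ord: "order G = p\<^sup>2 * q" and p: "prime p" and pq: "q < p"
    and P: "subgroup P G" "card P = p\<^sup>2"
  shows "P \<lhd> G"
  unfolding normal_iff_conj_subset[OF P(1)]
proof
  fix g assume g: "g \<in> carrier G"
  let ?P = "conj_subgroup g P"
  have sub: "P \<subseteq> carrier G" using P subgroup.subset by blast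
  have P': "subgroup ?P G" "card ?P = p\<^sup>2" using subgroup_conj[OF g P(1)] card_conj[OF g sub] P by auto
  have sub': "?P \<subseteq> carrier G" using P' subgroup.subset by blast
  have fP: "finite P" "finite ?P" using finite_subset[OF sub fin] finite_subset[OF sub' fin] .
  have I: "subgroup (P \<inter> ?P) G" using subgroups_Inter_pair P P' by blast
  have "P <#> ?P \<subseteq> carrier G" using sub sub' by (rule set_mult_closed)
  hence "card (P <#> ?P) \<le> p\<^sup>2 * q" using fin ord by (metis card_mono order_def)
  hence "card (P <#> ?P) * card (P \<inter> ?P) \<le> p\<^sup>2 * q * card (P \<inter> ?P)" by (rule mult_le_mono1)
  from le_trans[OF card_set_mult_ge[OF P(1) P'(1) fP] this]
  have le: "p\<^sup>2 * p\<^sup>2 \<le> p\<^sup>2 * q * card (P \<inter> ?P)"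
    unfolding P P' .
  have pos: "p > 0" using p prime_gt_0_nat by blast
  have dvd: "card (P \<inter> ?P) dvd p\<^sup>2" using card_subgroup_dvd[OF I P(1)] fP P by simp
  then obtain i where i: "i \<le> 2" "card (P \<inter> ?P) = p ^ i" using divides_primepow_nat[OF p] by auto
  have "i = 2"
  proof (rule ccontr)
    assume "i \<noteq> 2"
    hence "p ^ i \<le> p ^ 1" using i pos by (intro power_increasing) auto
    hence "p\<^sup>2 * q * card (P \<inter> ?P) \<le> p\<^sup>2 * q * p" using i by simp
    also have "\<dots> < p\<^sup>2 * p * p" using pq pos by simp
    finally show False using le by (simp add: power2_eq_square)
  qed
  hence "P \<inter> ?P = ?P" using i P' fP by (intro card_subset_eq) auto
  thus "?P \<subseteq> P" by blast
qed

text \<open>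
  The number of conjugates of \<open>Q\<close> is the index of its normalizer \<open>N\<close> and divides \<open>p\<^sup>2\<close>. If it is \<open>p\<close>, then
  \<open>|N| = p q\<close>; a conjugate that meets \<open>N\<close> trivially would give \<open>p q\<^sup>2 > p\<^sup>2 q\<close> products, so all conjugates lie in \<open>N\<close>,
  which is too small for two subgroups of order \<open>q\<close>. If it is \<open>p\<^sup>2\<close>, the conjugates contain \<open>p\<^sup>2 (q - 1)\<close> elements of
  order \<open>q\<close>, and the \<open>p\<^sup>2\<close> remaining elements form the only subgroup of order \<open>p\<^sup>2\<close>.
\<close>

lemma normal_sylow_of_larger_prime:
  assumes fin: "finite (carrier G)" and ord: "order G = p\<^sup>2 * q"
    and p: "prime p" and q: "prime q" and pq: "p < q"
    and P: "subgroup P G" "card P = p\<^sup>2" and Q: "subgroup Q G" "card Q = q"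
  shows "P \<lhd> G \<or> Q \<lhd> G"
proof -
  let ?D = "(\<lambda>g. conj_subgroup g Q) ` carrier G"
  let ?N = "normalizer G Q"
  have pos: "p > 0" "q > 1" "p > 1" using p q prime_gt_0_nat prime_gt_1_nat by auto
  have sub: "Q \<subseteq> carrier G" "P \<subseteq> carrier G" using P Q subgroup.subset by blast+
  have fP: "finite P" "finite Q" using finite_subset[OF _ fin] sub by auto
  have N: "subgroup ?N G" using normalizer_imp_subgroup sub by blast
  have Nsub: "?N \<subseteq> carrier G" using N subgroup.subset by blast
  have fN: "finite ?N" using finite_subset[OF Nsub fin] .
  have DN: "card ?D * card ?N = p\<^sup>2 * q" using card_conjugates[OF Q(1) fin] ord by simp
  have QN: "Q \<subseteq> ?N"
  proof
    fix x assume x: "x \<in> Q"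
    hence "conj_subgroup x Q \<subseteq> Q" using Q(1) by (auto simp: conj_subgroup_def intro!: subgroup.m_closed subgroup.m_inv_closed)
    moreover have "card (conj_subgroup x Q) = card Q" using card_conj x sub by blast
    ultimately have "conj_subgroup x Q = Q" using fP by (intro card_subset_eq) auto
    thus "x \<in> ?N" using x sub by (auto simp: normalizer_eq)
  qed
  have "q dvd card ?N" using card_subgroup_dvd[OF Q(1) N QN fN] Q by simp
  then obtain m where m: "card ?N = q * m" by blast
  have Dm: "card ?D * m = p\<^sup>2"
  proof -
    have "q * (card ?D * m) = q * p\<^sup>2" using DN m by (simp add: ac_simps)
    thus ?thesis using pos by simp
  qed
  hence "card ?D dvd p\<^sup>2" by (metis dvd_triv_left)
  then obtain i where i: "i \<le> 2" "card ?D = p ^ i" using divides_primepow_nat[OF p] by auto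
  have conjQ: "subgroup R G \<and> card R = q \<and> R \<subseteq> carrier G \<and> finite R" if "R \<in> ?D" for R
    using that subgroup_conj[OF _ Q(1)] card_conj[OF _ sub(1)] Q(2) subgroup.subset finite_subset[OF _ fin]
    by (metis (no_types, lifting) imageE)
  \<comment> \<open>The number of conjugates of \<open>Q\<close> is \<open>p ^ i\<close>.\<close>
  consider "i = 0" | "i = 1" | "i = 2" using i by linarith
  thus ?thesis
  proof cases
    case 1
    hence "card ?D = 1" using i by simp
    then obtain R where R: "?D = {R}" by (rule card_1_singletonE)
    have "Q \<in> ?D"
      using sub by (intro image_eqI[of _ _ \<one>]) (auto simp: conj_subgroup_def image_iff subset_iff)
    hence "\<forall>g\<in>carrier G. conj_subgroup g Q = Q" using R by auto
    hence "Q \<lhd> G" using normal_iff_conj_subset[OF Q(1)] by blast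
    thus ?thesis ..
  next
    case 2
    have cN: "card ?N = p * q" using Dm m i 2 pos by (simp add: power2_eq_square ac_simps)
    have lt: "p * q < q * q" using pq pos by simp
    have "conj_subgroup g Q \<subseteq> Q" if g: "g \<in> carrier G" for g
    proof -
      let ?Q = "conj_subgroup g Q"
      have Q': "subgroup ?Q G" "card ?Q = q" "?Q \<subseteq> carrier G" "finite ?Q" using conjQ g by auto
      have I: "subgroup (?Q \<inter> ?N) G" using subgroups_Inter_pair Q' N by blast
      have "card (?Q \<inter> ?N) dvd q" using card_subgroup_dvd[OF I Q'(1) _ Q'(4)] Q'(2) by simp
      moreover have "card (?Q \<inter> ?N) \<noteq> 1"
      proof
        assume 1: "card (?Q \<inter> ?N) = 1"
        have "?Q <#> ?N \<subseteq> carrier G" using Q'(3) Nsub by (rule set_mult_closed)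
        hence le: "card (?Q <#> ?N) \<le> p\<^sup>2 * q" using fin ord by (metis card_mono order_def)
        have "q * (p * q) \<le> card (?Q <#> ?N) * 1"
          using card_set_mult_ge[OF Q'(1) N Q'(4) fN] unfolding Q'(2) cN 1 .
        hence "q * (p * q) \<le> p\<^sup>2 * q" using le by linarith
        hence "(p * q) * q \<le> (p * q) * p" by (simp add: power2_eq_square ac_simps)
        thus False using pos pq by simp
      qed
      ultimately have "card (?Q \<inter> ?N) = card ?Q" using q Q'(2) by (metis prime_nat_iff)
      hence "?Q \<inter> ?N = ?Q" using Q'(4) by (intro card_subset_eq) auto
      hence "?Q \<subseteq> ?N" by blast
      thus ?thesis using subgroup_prime_unique[OF Q'(1) Q(1) N _ QN fN Q'(2) Q(2) q] cN lt by simp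
    qed
    hence "Q \<lhd> G" using normal_iff_conj_subset[OF Q(1)] by blast
    thus ?thesis ..
  next
    case 3
    let ?E = "\<Union>R\<in>?D. R - {\<one>}"
    have "card ?E = (\<Sum>R\<in>?D. card (R - {\<one>}))"
    proof (rule card_UN_disjoint)
      show "finite ?D" using fin by simp
      show "\<forall>R\<in>?D. finite (R - {\<one>})" using conjQ by blast
      show "\<forall>R\<in>?D. \<forall>S\<in>?D. R \<noteq> S \<longrightarrow> (R - {\<one>}) \<inter> (S - {\<one>}) = {}"
      proof (intro ballI impI)
        fix R S assume RS: "R \<in> ?D" "S \<in> ?D" "R \<noteq> S"
        have "R \<inter> S = {\<one>}" using prime_order_subgroups_Int[of R S q] conjQ[OF RS(1)] conjQ[OF RS(2)] RS(3) q by blast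
        thus "(R - {\<one>}) \<inter> (S - {\<one>}) = {}" by blast
      qed
    qed
    also have "\<dots> = (\<Sum>R\<in>?D. q - 1)"
    proof (rule sum.cong)
      fix R assume "R \<in> ?D"
      hence "subgroup R G" "card R = q" "finite R" using conjQ by blast+
      thus "card (R - {\<one>}) = q - 1" using subgroup.one_closed[of R G] by simp
    qed simp
    also have "\<dots> = p\<^sup>2 * (q - 1)" using i 3 by simp
    finally have cE: "card ?E = p\<^sup>2 * (q - 1)" .
    have Esub: "?E \<subseteq> carrier G" using conjQ by blast
    \<comment> \<open>The nontrivial elements of the conjugates of \<open>Q\<close> lie outside each subgroup of order \<open>p\<^sup>2\<close>, which is
       thus determined as their complement.\<close>
    have compl: "S = carrier G - ?E" if S: "subgroup S G" "card S = p\<^sup>2" for S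
    proof (rule card_subset_eq)
      have Ssub: "S \<subseteq> carrier G" using S subgroup.subset by blast
      have "S \<inter> R = {\<one>}" if "R \<in> ?D" for R
      proof (rule coprime_subgroups_Int)
        have "coprime (p\<^sup>2) q" using p q pq by (metis coprime_power_left_iff less_irrefl primes_coprime)
        thus "coprime (card S) (card R)" using S conjQ[OF that] by simp
      qed (use S conjQ[OF that] finite_subset[OF Ssub fin] in auto)
      thus "S \<subseteq> carrier G - ?E" using Ssub by blast
      have "card (carrier G - ?E) = p\<^sup>2 * q - p\<^sup>2 * (q - 1)"
        using card_Diff_subset[OF finite_subset[OF Esub fin] Esub] cE ord by (simp add: order_def)
      thus "card S = card (carrier G - ?E)" using S pos by (simp flip: diff_mult_distrib2)
    qed (use fin in simp)
    have "conj_subgroup g P = P" if "g \<in> carrier G" for g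
      using compl[OF P] compl[OF subgroup_conj[OF that P(1)]] card_conj[OF that sub(2)] P by simp
    hence "P \<lhd> G" using normal_iff_conj_subset[OF P(1)] by blast
    thus ?thesis ..
  qed
qed

text \<open>
  If all elements except \<open>1\<close> have order \<open>p\<close>, let \<open>y\<close> be outside the powers \<open>X\<close> of \<open>x\<close>. The conjugate of \<open>X\<close> by \<open>y\<close>
  is \<open>X\<close>, as otherwise the products of both would fill \<open>P\<close> and \<open>inv y\<close> would be one of them, forcing \<open>y\<close> into
  \<open>X\<close>. So \<open>y\<close> conjugates \<open>x\<close> to \<open>x\<^sup>a\<close>, where \<open>a\<^sup>p = 1\<close> modulo \<open>p\<close>; by Fermat \<open>a = 1\<close>, and the two commute.
\<close>

lemma subgroup_order_prime_square:
  assumes P: "subgroup P G" "card P = p\<^sup>2" and p: "prime p" and fin: "finite (carrier G)"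
  shows "(\<exists>x\<in>P. ord x = p\<^sup>2) \<or>
    (\<exists>x\<in>P. \<exists>y\<in>P. ord x = p \<and> ord y = p \<and> x \<otimes> y = y \<otimes> x \<and> (\<forall>i::int. y \<noteq> x [^] i))"
proof (rule disjCI)
  assume no: "\<not> (\<exists>x\<in>P. \<exists>y\<in>P. ord x = p \<and> ord y = p \<and> x \<otimes> y = y \<otimes> x \<and> (\<forall>i::int. y \<noteq> x [^] i))"
  interpret P: subgroup P G by fact
  have pos: "p > 1" using p prime_gt_1_nat by auto
  have fP: "finite P" using finite_subset[OF P.subset fin] .
  show "\<exists>x\<in>P. ord x = p\<^sup>2"
  proof (rule ccontr)
    assume nosq: "\<not> (\<exists>x\<in>P. ord x = p\<^sup>2)"
    have ordp: "ord x = p" if "x \<in> P" "x \<noteq> \<one>" for x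
    proof -
      have "ord x dvd p\<^sup>2" using ord_dvd_card_subgroup[OF P(1) fP] P that by auto
      then obtain i where i: "i \<le> 2" "ord x = p ^ i" using divides_primepow_nat[OF p] by auto
      have "i \<noteq> 0" using i ord_eq_1[of x] that by auto
      moreover have "i \<noteq> 2" using i nosq that by auto
      ultimately have "i = 1" using i by linarith
      thus ?thesis using i by simp
    qed
    have "card P \<noteq> 1" using P pos by simp
    hence "P \<noteq> {\<one>}" by auto
    then obtain x where x: "x \<in> P" "x \<noteq> \<one>" using P.one_closed by blast
    have xc: "x \<in> carrier G" using x by auto
    let ?X = "range (\<lambda>i::int. x [^] i)"
    have X: "subgroup ?X G" by (rule subgroup_of_powers[OF xc])
    have Xeq: "?X = (\<lambda>i. x [^] i) ` {0..<int p}"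
    proof safe
      fix i :: int
      have "x [^] i = x [^] (i mod int p)"
        using int_pow_eq[OF xc, of i "i mod int p"] ordp x by (simp flip: mod_eq_dvd_iff)
      thus "x [^] i \<in> (\<lambda>i. x [^] i) ` {0..<int p}" using pos by (intro image_eqI[of _ _ "i mod int p"]) auto
    qed simp
    have "inj_on (\<lambda>i::int. x [^] i) {0..<int p}"
    proof (rule inj_onI)
      fix i j :: int assume ij: "i \<in> {0..<int p}" "j \<in> {0..<int p}" "x [^] i = x [^] j"
      hence "int p dvd j - i" using int_pow_eq[OF xc] ordp x by simp
      thus "i = j" using ij by (metis atLeastLessThan_iff mod_eq_dvd_iff mod_pos_pos_trivial)
    qed
    hence cX: "card ?X = p" unfolding Xeq by (simp add: card_image)
    have Xsub: "?X \<subseteq> P" using subgroup_int_pow_closed[OF P(1) x(1)] by auto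
    have "?X \<noteq> P" using cX P pos by (auto simp: power2_eq_square)
    then obtain y where y: "y \<in> P" "y \<notin> ?X" using Xsub by blast
    have yc: "y \<in> carrier G" using y by auto
    have "y \<noteq> \<one>" using y X subgroup.one_closed by blast
    hence oy: "ord y = p" using ordp y by blast
    let ?Y = "conj_subgroup y ?X"
    have Y: "subgroup ?Y G" "card ?Y = p" using subgroup_conj[OF yc X] card_conj[OF yc] subgroup.subset[OF X] cX by auto
    have Ysub: "?Y \<subseteq> P" using Xsub y by (auto simp: conj_subgroup_def intro!: P.m_closed P.m_inv_closed)
    have fXY: "finite ?X" "finite ?Y" using finite_subset[OF Xsub fP] finite_subset[OF Ysub fP] .
    have "?X = ?Y"
    proof (rule ccontr)
      assume "?X \<noteq> ?Y"
      hence "?X \<inter> ?Y = {\<one>}" using prime_order_subgroups_Int[OF X Y(1) fXY cX Y(2) p] by simp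
      hence "p * p \<le> card (?X <#> ?Y)" using card_set_mult_ge[OF X Y(1) fXY] cX Y by simp
      moreover have sub: "?X <#> ?Y \<subseteq> P" using Xsub Ysub by (auto simp: set_mult_def subset_iff)
      ultimately have "?X <#> ?Y = P" using P fP by (metis card_seteq power2_eq_square)
      moreover have "inv y \<in> P" using y by auto
      ultimately have "inv y \<in> ?X <#> ?Y" by simp
      then obtain i j :: int where ij: "inv y = x [^] i \<otimes> (y \<otimes> x [^] j \<otimes> inv y)"
        by (auto simp: set_mult_def conj_subgroup_def)
      hence "(x [^] i \<otimes> y \<otimes> x [^] j) \<otimes> inv y = \<one> \<otimes> inv y" using xc yc by (simp add: m_assoc)
      hence "x [^] i \<otimes> y \<otimes> x [^] j = \<one>" using xc yc right_cancel by (metis int_pow_closed inv_closed m_closed one_closed)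
      hence "x [^] i \<otimes> y = inv (x [^] j)" using xc yc by (metis int_pow_closed inv_equality inv_inv m_closed)
      hence "y = inv (x [^] i) \<otimes> inv (x [^] j)" using xc yc by (metis int_pow_closed inv_closed inv_solve_left)
      also have "\<dots> \<in> ?X" using X by (intro subgroup.m_closed subgroup.m_inv_closed) auto
      finally show False using y by simp
    qed
    moreover have "y \<otimes> x \<otimes> inv y \<in> ?Y"
      unfolding conj_subgroup_def using xc by (intro image_eqI[of _ _ x]) (auto intro: range_eqI[of _ _ 1])
    ultimately have "y \<otimes> x \<otimes> inv y \<in> (\<lambda>i. x [^] i) ` {0..<int p}" using Xeq by simp
    then obtain a' :: int where a': "a' \<ge> 0" "y \<otimes> x \<otimes> inv y = x [^] a'" by auto
    define a where "a = nat a'"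
    have a: "y \<otimes> x \<otimes> inv y = x [^] a" using a' by (simp add: a_def int_pow_def)
    hence yx: "y \<otimes> x = x [^] a \<otimes> y" using xc yc by (metis inv_solve_right' m_closed nat_pow_closed)
    have 1: "[a ^ p = 1] (mod p)"
      using conj_power_cong[OF xc yc yx, of p] oy pow_ord_eq_1[OF yc] ordp[OF x] by simp
    have "[a ^ p = a] (mod p)"
    proof (cases "p dvd a")
      case True
      thus ?thesis using pos by (simp add: cong_def mod_eq_0_iff_dvd dvd_power dvd_trans)
    next
      case False
      hence "[a ^ (p - 1) * a = 1 * a] (mod p)" using fermat_theorem[OF p] cong_scalar_right by blast
      thus ?thesis using pos by (simp add: power_eq_if mult.commute)
    qed
    hence "[a = 1] (mod p)" using 1 by (metis cong_sym cong_trans)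
    hence "[int a = int 1] (mod int p)" by (simp only: cong_int_iff)
    hence "int (ord x) dvd int a - int 1" unfolding ordp[OF x] by (simp add: cong_iff_dvd_diff)
    from iffD2[OF int_pow_eq[OF xc] this] have "x [^] a = x" using xc by (simp add: int_pow_int)
    hence "x \<otimes> y = y \<otimes> x" using yx by simp
    thus False using no x y ordp oy by auto
  qed
qed

end

section \<open>Embeddings of cyclic groups and of products of two cyclic groups\<close>

lemma finite_integer_mod_group [simp]: "n > 0 \<Longrightarrow> finite (carrier (integer_mod_group n))"
  by (simp add: carrier_integer_mod_group)

lemma card_integer_mod_group [simp]: "n > 0 \<Longrightarrow> card (carrier (integer_mod_group n)) = n"
  by (simp add: carrier_integer_mod_group)

abbreviation cyclic_pair :: "nat \<Rightarrow> nat \<Rightarrow> (int \<times> int) monoid" where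
  "cyclic_pair m k \<equiv> integer_mod_group m \<times>\<times> integer_mod_group k"

lemma group_cyclic_pair [simp]: "group (cyclic_pair m k)"
  by (simp add: DirProd_group)

lemma comm_group_cyclic_pair [simp]: "comm_group (cyclic_pair m k)"
  by (rule group.group_comm_groupI[OF group_cyclic_pair]) (auto simp: add.commute)

lemma finite_cyclic_pair [simp]: "m > 0 \<Longrightarrow> k > 0 \<Longrightarrow> finite (carrier (cyclic_pair m k))"
  by (simp add: DirProd_def)

lemma card_cyclic_pair [simp]: "m > 0 \<Longrightarrow> k > 0 \<Longrightarrow> card (carrier (cyclic_pair m k)) = m * k"
  by (simp add: DirProd_def card_cartesian_product)

context group
begin

lemma int_pow_mod_ord: "x \<in> carrier G \<Longrightarrow> x [^] (i mod int (ord x)) = x [^] (i::int)"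
  by (erule iffD2[OF int_pow_eq]) (rule dvd_minus_mod)

lemma conj_eq_iff:
  "g \<in> carrier G \<Longrightarrow> x \<in> carrier G \<Longrightarrow> w \<in> carrier G \<Longrightarrow> g \<otimes> x \<otimes> inv g = w \<longleftrightarrow> g \<otimes> x = w \<otimes> g"
  by (subst inv_solve_right') auto

lemma commute_int_pow:
  assumes "x \<in> carrier G" "y \<in> carrier G" "x \<otimes> y = y \<otimes> x"
  shows "x [^] (i::int) \<otimes> y = y \<otimes> x [^] i"
proof -
  have "y \<otimes> x [^] i \<otimes> inv y = (y \<otimes> x \<otimes> inv y) [^] i"
    using hom_int_pow[OF conj_hom[OF assms(2)] assms(1)] is_group by simp
  also have "y \<otimes> x \<otimes> inv y = x" using assms conj_eq_iff[of y x x] by simp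
  finally show ?thesis using assms conj_eq_iff[of y "x [^] i" "x [^] i"] by simp
qed

lemma commute_int_pow2:
  assumes "x \<in> carrier G" "y \<in> carrier G" "x \<otimes> y = y \<otimes> x"
  shows "x [^] (i::int) \<otimes> y [^] (j::int) = y [^] j \<otimes> x [^] i"
  using commute_int_pow[of y "x [^] i" j] commute_int_pow[OF assms, of i] assms by simp

lemma cyclic_embedding:
  assumes x: "x \<in> carrier G" "ord x = n" and n: "n > 0"
  shows "(\<lambda>i::int. x [^] i) \<in> hom (integer_mod_group n) G"
    "inj_on (\<lambda>i::int. x [^] i) (carrier (integer_mod_group n))"
proof -
  show "(\<lambda>i::int. x [^] i) \<in> hom (integer_mod_group n) G"
    using x int_pow_mod_ord[OF x(1)] by (intro homI) (auto simp: int_pow_mult)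
  show "inj_on (\<lambda>i::int. x [^] i) (carrier (integer_mod_group n))"
  proof (rule inj_onI)
    fix i j :: int
    assume ij: "i \<in> carrier (integer_mod_group n)" "j \<in> carrier (integer_mod_group n)" "x [^] i = x [^] j"
    hence "j mod int n = i mod int n" using int_pow_eq[OF x(1)] x by (simp add: mod_eq_dvd_iff)
    thus "i = j" using ij n by (simp add: carrier_integer_mod_group)
  qed
qed

lemma pair_embedding:
  assumes x: "x \<in> carrier G" "ord x = m" and y: "y \<in> carrier G" "ord y = k" and mk: "m > 0" "k > 0"
    and comm: "x \<otimes> y = y \<otimes> x"
    and indep: "\<And>(i::int) (j::int). x [^] i = y [^] j \<Longrightarrow> y [^] j = \<one>"
  shows "(\<lambda>(i, j). x [^] i \<otimes> y [^] j) \<in> hom (cyclic_pair m k) G"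
    "inj_on (\<lambda>(i, j). x [^] i \<otimes> y [^] j) (carrier (cyclic_pair m k))"
proof -
  show "(\<lambda>(i, j). x [^] i \<otimes> y [^] j) \<in> hom (cyclic_pair m k) G"
  proof (rule homI)
    fix u v assume "u \<in> carrier (cyclic_pair m k)" "v \<in> carrier (cyclic_pair m k)"
    obtain i j i' j' where [simp]: "u = (i, j)" "v = (i', j')" by (metis surj_pair)
    have "(x [^] i \<otimes> y [^] j) \<otimes> (x [^] i' \<otimes> y [^] j') = x [^] i \<otimes> (y [^] j \<otimes> x [^] i') \<otimes> y [^] j'"
      using x y by (simp add: m_assoc)
    also have "\<dots> = x [^] i \<otimes> (x [^] i' \<otimes> y [^] j) \<otimes> y [^] j'"
      by (simp only: commute_int_pow2[OF x(1) y(1) comm, of i' j])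
    also have "\<dots> = x [^] (i + i') \<otimes> y [^] (j + j')"
      using x y by (simp add: m_assoc int_pow_mult)
    finally show "(case u \<otimes>\<^bsub>cyclic_pair m k\<^esub> v of (i, j) \<Rightarrow> x [^] i \<otimes> y [^] j) =
        (case u of (i, j) \<Rightarrow> x [^] i \<otimes> y [^] j) \<otimes> (case v of (i, j) \<Rightarrow> x [^] i \<otimes> y [^] j)"
      using x y int_pow_mod_ord[OF x(1)] int_pow_mod_ord[OF y(1)] by simp
  qed (use x y in auto)
  show "inj_on (\<lambda>(i, j). x [^] i \<otimes> y [^] j) (carrier (cyclic_pair m k))"
  proof (rule inj_onI)
    fix u v assume uv: "u \<in> carrier (cyclic_pair m k)" "v \<in> carrier (cyclic_pair m k)"
      "(case u of (i, j) \<Rightarrow> x [^] i \<otimes> y [^] j) = (case v of (i, j) \<Rightarrow> x [^] i \<otimes> y [^] j)"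
    obtain i j i' j' where [simp]: "u = (i, j)" "v = (i', j')" by (metis surj_pair)
    have eq: "x [^] i \<otimes> y [^] j = x [^] i' \<otimes> y [^] j'" using uv by simp
    hence "x [^] i = (x [^] i' \<otimes> y [^] j') \<otimes> inv (y [^] j)"
      using x y by (simp add: inv_solve_right)
    hence "x [^] i = x [^] i' \<otimes> y [^] (j' - j)" using x y by (simp add: m_assoc int_pow_diff)
    hence "inv (x [^] i') \<otimes> x [^] i = y [^] (j' - j)" using x y by (simp add: inv_solve_left')
    moreover have "inv (x [^] i') \<otimes> x [^] i = x [^] (i - i')"
      using x int_pow_mult[OF x(1), of "- i'" i] by (simp add: int_pow_neg)
    ultimately have xy: "x [^] (i - i') = y [^] (j' - j)" by simp
    have 1: "y [^] (j' - j) = \<one>" by (rule indep[OF xy])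
    hence 2: "x [^] (i - i') = \<one>" using xy by simp
    have "int k dvd j' - j" "int m dvd i - i'"
      using 1 2 int_pow_eq_id[OF x(1)] int_pow_eq_id[OF y(1)] x y by auto
    thus "u = v" using uv mk
      by (auto simp: carrier_integer_mod_group simp flip: mod_eq_dvd_iff)
  qed
qed

text \<open>
  The powers of \<open>y\<close> form a group of prime order, so a nontrivial power of \<open>y\<close> among the powers of \<open>x\<close> would bring \<open>y\<close> with it.
\<close>

lemma prime_ord_indep:
  assumes x: "x \<in> carrier G" and y: "y \<in> carrier G" "ord y = p" and p: "prime p" and notin: "\<And>i::int. y \<noteq> x [^] i"
    and eq: "x [^] (i::int) = y [^] (j::int)"
  shows "y [^] j = \<one>"
proof (rule ccontr)
  assume "y [^] j \<noteq> \<one>"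
  hence "\<not> int p dvd j" using int_pow_eq_id[OF y(1)] y by simp
  hence "coprime j (int p)" using p by (metis coprime_commute prime_imp_coprime prime_nat_int_transfer)
  then obtain u where "[j * u = 1] (mod int p)" using cong_solve_coprime_int by blast
  hence "y [^] (j * u) = y [^] (1::int)"
    using int_pow_eq[OF y(1)] y by (metis cong_iff_dvd_diff cong_sym)
  hence "y = x [^] (i * u)" using x y eq by (simp flip: int_pow_pow)
  thus False using notin by blast
qed

lemma subgroup_prime_generator:
  assumes Q: "subgroup Q G" "card Q = q" "prime q" "finite Q"
  obtains c where "c \<in> Q" "ord c = q"
proof -
  have "Q \<noteq> {\<one>}" using Q prime_gt_1_nat by force
  then obtain c where c: "c \<in> Q" "c \<noteq> \<one>" using subgroup.one_closed[OF Q(1)] by blast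
  have "ord c dvd q" using ord_dvd_card_subgroup[OF Q(1) Q(4) c(1)] Q by simp
  moreover have "ord c \<noteq> 1" using ord_eq_1 c subgroup.mem_carrier[OF Q(1)] by simp
  ultimately have "ord c = q" using Q(3) by (metis prime_nat_iff)
  thus ?thesis using that c by blast
qed

lemma card_powers:
  assumes "x \<in> carrier G" "ord x = n" "n > 0"
  shows "card (range (\<lambda>i::int. x [^] i)) = n"
proof -
  have "range (\<lambda>i::int. x [^] i) = (\<lambda>i::int. x [^] i) ` carrier (integer_mod_group n)"
  proof safe
    fix i :: int
    show "x [^] i \<in> (\<lambda>i::int. x [^] i) ` carrier (integer_mod_group n)"
      using assms int_pow_mod_ord[OF assms(1), of i]
      by (intro image_eqI[of _ _ "i mod int n"]) (auto simp: carrier_integer_mod_group)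
  qed simp
  thus ?thesis using card_image[OF cyclic_embedding(2)[OF assms]] assms by simp
qed

lemma powers_eq_subgroup:
  assumes "subgroup Q G" "finite Q" "c \<in> Q" "ord c = card Q" "card Q > 0"
  shows "range (\<lambda>i::int. c [^] i) = Q"
  using assms card_powers[OF subgroup.mem_carrier[OF assms(1,3)] assms(4,5)]
    subgroup_int_pow_closed[OF assms(1,3)] by (intro card_subset_eq) auto

lemma pow_notin_complement:
  assumes P: "subgroup P G" "finite P" and Q: "subgroup Q G" "finite Q" and cop: "coprime (card P) (card Q)"
    and c: "c \<in> Q" "ord c = n" and i: "0 < i" "i < n"
  shows "c [^] (i::nat) \<notin> P"
proof
  assume "c [^] i \<in> P"
  moreover have "c [^] i \<in> Q" using subgroup_int_pow_closed[OF Q(1) c(1), of "int i"] by (simp add: int_pow_int)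
  ultimately have "c [^] i = \<one>" using coprime_subgroups_Int[OF P(1) Q(1) P(2) Q(2) cop] by blast
  hence "n dvd i" using pow_eq_id c subgroup.mem_carrier[OF Q(1)] by auto
  thus False using i by (auto dest: dvd_imp_le)
qed

end

section \<open>Every group of order \<open>p\<^sup>2 q\<close> is one of four kinds of split extension\<close>

context group
begin

lemma normal_semidirect_of_subgroup:
  assumes fin: "finite (carrier G)" and N: "group N" and \<phi>: "\<phi> \<in> hom N G" "inj_on \<phi> (carrier N)" "\<phi> ` carrier N = P"
    and P: "P \<lhd> G" and Q: "subgroup Q G" and c: "c \<in> Q" "ord c = card Q"
    and cop: "coprime (card P) (card Q)" and ord: "order G = card P * card Q"
  obtains \<alpha> where "cyclic_action N \<alpha> (card Q)" "semidirect N \<alpha> (card Q) \<cong> G"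
proof -
  have sub: "subgroup P G" using P by (rule normal_imp_subgroup)
  have f: "finite P" "finite Q" using finite_subset[OF subgroup.subset fin] sub Q by auto
  have cc: "c \<in> carrier G" using subgroup.mem_carrier[OF Q c(1)] .
  have "card P = card (carrier N)" using card_image[OF \<phi>(2)] \<phi>(3) by simp
  moreover have "card Q > 0" using f subgroup.one_closed[OF Q] by (auto simp: card_gt_0_iff)
  moreover have "c [^] i \<noteq> \<phi> x" if "x \<in> carrier N" "0 < i" "i < card Q" for x and i :: nat
    using pow_notin_complement[OF sub f(1) Q f(2) cop c that(2,3)] \<phi>(3) that by auto
  moreover have "c [^] card Q = \<one>" using pow_ord_eq_1[OF cc] c by simp
  moreover have "c \<otimes> \<phi> x \<otimes> inv c \<in> \<phi> ` carrier N" if "x \<in> carrier N" for x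
    using normal.inv_op_closed2[OF P cc, of "\<phi> x"] \<phi>(3) that by auto
  ultimately show ?thesis
    using semidirect_of_normalized_complement[OF N is_group fin \<phi>(1,2), of c "card Q"] cc ord that by metis
qed

lemma powers_prime_square_subgroup:
  assumes P: "subgroup P G" "card P = p\<^sup>2" and p: "prime p" and fin: "finite (carrier G)"
  obtains x where "x \<in> P" "ord x = p\<^sup>2"
  | x y where "x \<in> P" "y \<in> P" "ord x = p" "ord y = p" "x \<otimes> y = y \<otimes> x" "\<And>i::int. y \<noteq> x [^] i"
  using subgroup_order_prime_square[OF assms] by blast

lemma pair_image_eq:
  assumes P: "subgroup P G" "card P = p\<^sup>2" and p: "prime p" and fin: "finite (carrier G)"
    and xy: "x \<in> P" "y \<in> P" "ord x = p" "ord y = p" "x \<otimes> y = y \<otimes> x" "\<And>i::int. y \<noteq> x [^] i"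
  shows "(\<lambda>(i, j). x [^] i \<otimes> y [^] j) \<in> hom (cyclic_pair p p) G"
    "inj_on (\<lambda>(i, j). x [^] i \<otimes> y [^] j) (carrier (cyclic_pair p p))"
    "(\<lambda>(i, j). x [^] i \<otimes> y [^] j) ` carrier (cyclic_pair p p) = P"
proof -
  interpret P: subgroup P G by fact
  have pos: "p > 0" using p prime_gt_0_nat by blast
  have c: "x \<in> carrier G" "y \<in> carrier G" using xy by auto
  note ind = prime_ord_indep[OF c(1) c(2) xy(4) p xy(6)]
  note emb = pair_embedding[OF c(1) xy(3) c(2) xy(4) pos pos xy(5) ind]
  show "(\<lambda>(i, j). x [^] i \<otimes> y [^] j) \<in> hom (cyclic_pair p p) G"
    "inj_on (\<lambda>(i, j). x [^] i \<otimes> y [^] j) (carrier (cyclic_pair p p))" by (rule emb; assumption)+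
  have fP: "finite P" using finite_subset[OF P.subset fin] .
  show "(\<lambda>(i, j). x [^] i \<otimes> y [^] j) ` carrier (cyclic_pair p p) = P"
  proof (rule card_subset_eq[OF fP])
    show "(\<lambda>(i, j). x [^] i \<otimes> y [^] j) ` carrier (cyclic_pair p p) \<subseteq> P"
      using subgroup_int_pow_closed[OF P(1) xy(1)] subgroup_int_pow_closed[OF P(1) xy(2)] by auto
    show "card ((\<lambda>(i, j). x [^] i \<otimes> y [^] j) ` carrier (cyclic_pair p p)) = card P"
      using card_image[OF emb(2)] P pos by (simp add: power2_eq_square)
  qed
qed

text \<open>
  Conjugation by \<open>g \<in> P\<close> raises \<open>z\<close> to a power \<open>a(g)\<close> with \<open>a(g)\<^sup>p = 1\<close> modulo \<open>q\<close>. There are at most \<open>p\<close> such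
  residues but \<open>p\<^sup>2\<close> elements \<open>g\<close>, so two of them act in the same way and their quotient commutes with \<open>z\<close>.
\<close>

lemma commuting_element_of_noncyclic:
  assumes P: "subgroup P G" "card P = p\<^sup>2" and p: "prime p" and fin: "finite (carrier G)"
    and Q: "Q \<lhd> G" "card Q = q" and q: "prime q" and z: "z \<in> Q" "ord z = q"
    and exp: "\<And>g. g \<in> P \<Longrightarrow> g [^] p = \<one>"
  obtains d where "d \<in> P" "d \<noteq> \<one>" "d \<otimes> z = z \<otimes> d"
proof -
  interpret P: subgroup P G by fact
  interpret Q: normal Q G by fact
  have pos: "p > 1" "q > 1" using p q prime_gt_1_nat by auto
  have zc: "z \<in> carrier G" using z by auto
  have f: "finite P" "finite Q" using finite_subset[OF P.subset fin] finite_subset[OF Q.subset fin] .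
  have Qz: "Q = range (\<lambda>i::int. z [^] i)"
    using powers_eq_subgroup[OF Q.subgroup_axioms f(2) z(1)] z Q pos by simp
  have "\<exists>a<q. g \<otimes> z = z [^] a \<otimes> g" if "g \<in> P" for g
  proof -
    have "g \<otimes> z \<otimes> inv g \<in> Q" using Q.inv_op_closed2 that z by auto
    then obtain i :: int where i: "g \<otimes> z \<otimes> inv g = z [^] i" using Qz by auto
    also have "\<dots> = z [^] nat (i mod int q)"
      using int_pow_mod_ord[OF zc, of i] z pos by (simp add: int_pow_int[symmetric])
    finally have "g \<otimes> z = z [^] nat (i mod int q) \<otimes> g" using that zc conj_eq_iff[of g z] by simp
    moreover have "nat (i mod int q) < q" using pos by (simp add: nat_less_iff)
    ultimately show ?thesis by blast
  qed
  then obtain a where a: "\<And>g. g \<in> P \<Longrightarrow> a g < q" "\<And>g. g \<in> P \<Longrightarrow> g \<otimes> z = z [^] a g \<otimes> g" by metis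
  have apow: "[a g ^ p = 1] (mod q)" if "g \<in> P" for g
    using conj_power_cong[OF zc P.mem_carrier[OF that] a(2)[OF that] exp[OF that]] z by simp
  have "a ` P \<subseteq> {x\<in>{..<q}. [x ^ p = 1] (mod q)}" using a(1) apow by auto
  hence "card (a ` P) \<le> card {x\<in>{..<q}. [x ^ p = 1] (mod q)}" by (intro card_mono) auto
  also have "\<dots> \<le> p" using roots_mod_prime_bound[OF q, of p 1] pos by simp
  also have "p < card P" using P pos by (simp add: power2_eq_square)
  finally have "\<not> inj_on a P" using pigeonhole by blast
  then obtain g h where gh: "g \<in> P" "h \<in> P" "a g = a h" "g \<noteq> h" by (auto simp: inj_on_def)
  have ghc: "g \<in> carrier G" "h \<in> carrier G" using gh by auto
  let ?d = "inv h \<otimes> g"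
  have dP: "?d \<in> P" using gh by auto
  have d1: "?d \<noteq> \<one>" using gh(4) ghc by (metis inv_equality inv_inv inv_closed)
  have "h \<otimes> (?d \<otimes> z) = g \<otimes> z" using ghc zc by (simp add: inv_solve_left' flip: m_assoc)
  also have "\<dots> = z [^] a h \<otimes> h \<otimes> ?d" using ghc zc a(2)[OF gh(1)] gh(3) by (simp add: inv_solve_left' m_assoc) (simp flip: m_assoc)
  also have "\<dots> = h \<otimes> (z \<otimes> ?d)" using ghc zc a(2)[OF gh(2)] by (simp flip: m_assoc)
  finally have "?d \<otimes> z = z \<otimes> ?d" using ghc zc by (simp add: Units_l_cancel)
  thus ?thesis using that dP d1 by blast
qed

end

lemma split_cases_normal_square:
  fixes G (structure)
  assumes G: "group G" and fin: "finite (carrier G)" and ord: "order G = p\<^sup>2 * q"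
    and p: "prime p" and q: "prime q" and pq: "p \<noteq> q"
    and P: "subgroup P G" "card P = p\<^sup>2" "P \<lhd> G"
  shows "(\<exists>\<alpha>. cyclic_action (integer_mod_group (p\<^sup>2)) \<alpha> q \<and> semidirect (integer_mod_group (p\<^sup>2)) \<alpha> q \<cong> G) \<or>
    (\<exists>\<alpha>. cyclic_action (cyclic_pair p p) \<alpha> q \<and> semidirect (cyclic_pair p p) \<alpha> q \<cong> G)"
proof -
  interpret group G by fact
  have pos: "p > 0" using p prime_gt_0_nat by blast
  obtain Q where Q: "subgroup Q G" "card Q = q ^ 1"
    using sylow_thm[OF q G, of 1 "p\<^sup>2"] ord fin by (auto simp: mult.commute)
  have f: "finite P" "finite Q" using finite_subset[OF subgroup.subset fin] P Q by auto
  have cop: "coprime (card P) (card Q)" using P Q p q pq by (simp add: primes_coprime)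
  obtain c where c: "c \<in> Q" "ord c = q" using subgroup_prime_generator[OF Q(1) _ q f(2)] Q by auto
  have o: "order G = card P * card Q" "ord c = card Q" using ord P Q c by auto
  from P(1,2) p fin show ?thesis
  proof (cases rule: powers_prime_square_subgroup)
    case (1 x)
    have xc: "x \<in> carrier G" using subgroup.mem_carrier[OF P(1) 1(1)] .
    have pp: "p\<^sup>2 > 0" using pos by simp
    note emb = cyclic_embedding[OF xc 1(2) pp]
    have "(\<lambda>i::int. x [^] i) ` carrier (integer_mod_group (p\<^sup>2)) = P"
      by (rule card_subset_eq[OF f(1)])
        (use subgroup_int_pow_closed[OF P(1) 1(1)] card_image[OF emb(2)] P pp in auto)
    from normal_semidirect_of_subgroup[OF fin _ emb this P(3) Q(1) c(1) o(2) cop o(1)]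
    obtain \<alpha> where "cyclic_action (integer_mod_group (p\<^sup>2)) \<alpha> (card Q)" "semidirect (integer_mod_group (p\<^sup>2)) \<alpha> (card Q) \<cong> G"
      by auto
    thus ?thesis using Q by auto
  next
    case (2 x y)
    note emb = pair_image_eq[OF P(1,2) p fin 2]
    from normal_semidirect_of_subgroup[OF fin _ emb P(3) Q(1) c(1) o(2) cop o(1)]
    obtain \<alpha> where "cyclic_action (cyclic_pair p p) \<alpha> (card Q)" "semidirect (cyclic_pair p p) \<alpha> (card Q) \<cong> G"
      by auto
    thus ?thesis using Q by auto
  qed
qed

text \<open>
  If the Sylow \<open>p\<close>-subgroup \<open>P\<close> is cyclic, its generator acts on \<open>Q\<close>. Otherwise \<open>P\<close> contains an element \<open>d \<noteq> 1\<close>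
  commuting with \<open>Q\<close>, and any \<open>c \<in> P\<close> that is not a power of \<open>d\<close> acts on \<open>\<langle>d\<rangle> \<times> Q\<close>, fixing \<open>d\<close>.
\<close>

lemma split_cases_normal_prime:
  fixes G (structure)
  assumes G: "group G" and fin: "finite (carrier G)" and ord: "order G = p\<^sup>2 * q"
    and p: "prime p" and q: "prime q" and pq: "p \<noteq> q"
    and Q: "subgroup Q G" "card Q = q" "Q \<lhd> G"
  shows "(\<exists>\<alpha>. cyclic_action (integer_mod_group q) \<alpha> (p\<^sup>2) \<and> semidirect (integer_mod_group q) \<alpha> (p\<^sup>2) \<cong> G) \<or>
    (\<exists>\<alpha> a. cyclic_action (cyclic_pair p q) \<alpha> p \<and> semidirect (cyclic_pair p q) \<alpha> p \<cong> G \<and>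
       (\<forall>i\<in>{0..<int p}. \<forall>j\<in>{0..<int q}. \<alpha> (i, j) = (i, a * j mod int q)))"
proof -
  interpret group G by fact
  interpret Q: normal Q G by fact
  have pos: "p > 0" "q > 0" "p > 1" using p q prime_gt_0_nat prime_gt_1_nat by auto
  obtain P where P: "subgroup P G" "card P = p\<^sup>2"
    using sylow_thm[OF p G ord fin] by blast
  have f: "finite P" "finite Q" using finite_subset[OF subgroup.subset fin] P Q by auto
  have cop: "coprime (card Q) (card P)" using P Q p q pq by (simp add: primes_coprime)
  have PQ: "P \<inter> Q = {\<one>}" using coprime_subgroups_Int[OF Q(1) P(1) f(2,1) cop] by blast
  obtain z where z: "z \<in> Q" "ord z = q" using subgroup_prime_generator[OF Q(1,2) q f(2)] by auto
  have zc: "z \<in> carrier G" using z by auto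
  have Qz: "range (\<lambda>i::int. z [^] i) = Q"
    using powers_eq_subgroup[OF Q(1) f(2) z(1)] z Q pos by simp
  have o: "order G = card Q * card P" using ord P Q by auto
  from P(1,2) p fin show ?thesis
  proof (cases rule: powers_prime_square_subgroup)
    case (1 x)
    note emb = cyclic_embedding[OF zc z(2) pos(2)]
    have "(\<lambda>i::int. z [^] i) ` carrier (integer_mod_group q) = Q"
      by (rule card_subset_eq[OF f(2)])
        (use subgroup_int_pow_closed[OF Q(1) z(1)] card_image[OF emb(2)] Q pos in auto)
    from normal_semidirect_of_subgroup[OF fin _ emb this Q(3) P(1) 1(1) _ cop o]
    obtain \<alpha> where "cyclic_action (integer_mod_group q) \<alpha> (card P)" "semidirect (integer_mod_group q) \<alpha> (card P) \<cong> G"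
      using 1 P by auto
    thus ?thesis using P by auto
  next
    case (2 x y)
    let ?f = "\<lambda>(i, j). x [^] (i::int) \<otimes> y [^] (j::int)"
    note xy = pair_image_eq[OF P(1,2) p fin 2]
    have xyc: "x \<in> carrier G" "y \<in> carrier G" using 2 subgroup.mem_carrier[OF P(1)] by auto
    have Pcomm: "g \<otimes> h = h \<otimes> g" if gh: "g \<in> P" "h \<in> P" for g h
    proof -
      obtain u v where u: "u \<in> carrier (cyclic_pair p p)" "g = ?f u" "v \<in> carrier (cyclic_pair p p)" "h = ?f v"
        using gh xy(3) by blast
      have "?f (u \<otimes>\<^bsub>cyclic_pair p p\<^esub> v) = ?f (v \<otimes>\<^bsub>cyclic_pair p p\<^esub> u)"
        using comm_monoid.m_comm[OF comm_group.axioms(1)[OF comm_group_cyclic_pair], OF u(1,3)] by simp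
      thus ?thesis using hom_mult[OF xy(1)] u by simp
    qed
    have exp: "g [^] p = \<one>" if "g \<in> P" for g
    proof -
      have "g \<in> ?f ` carrier (cyclic_pair p p)" using xy(3) that by simp
      then obtain i j where "g = x [^] (i::int) \<otimes> y [^] (j::int)" by auto
      hence "g [^] p = (x [^] i) [^] p \<otimes> (y [^] j) [^] p"
        using pow_mult_distrib[OF commute_int_pow2[OF xyc 2(5)]] xyc by simp
      also have "\<dots> = \<one>"
        using 2 xyc int_pow_eq_id[of x "i * int p"] int_pow_eq_id[of y "j * int p"]
        by (simp add: int_pow_pow flip: int_pow_int)
      finally show ?thesis .
    qed
    have ordp: "ord g = p" if "g \<in> P" "g \<noteq> \<one>" for g
    proof -
      have gc: "g \<in> carrier G" using subgroup.mem_carrier[OF P(1)] that by auto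
      have "ord g dvd p" using exp[OF that(1)] pow_eq_id[OF gc] by simp
      moreover have "ord g \<noteq> 1" using ord_eq_1[OF gc] that by simp
      ultimately show ?thesis using p by (metis prime_nat_iff)
    qed
    obtain d where d: "d \<in> P" "d \<noteq> \<one>" "d \<otimes> z = z \<otimes> d"
      using commuting_element_of_noncyclic[OF P p fin Q(3,2) q z exp] by auto
    have dc: "d \<in> carrier G" using subgroup.mem_carrier[OF P(1) d(1)] .
    have od: "ord d = p" using ordp d by blast
    let ?D = "range (\<lambda>i::int. d [^] i)"
    have "card ?D = p" using card_powers[OF dc od] pos by simp
    hence "?D \<noteq> P" using P pos by (auto simp: power2_eq_square)
    moreover have DP: "?D \<subseteq> P" using subgroup_int_pow_closed[OF P(1) d(1)] by auto
    ultimately obtain c where c: "c \<in> P" "c \<notin> ?D" by blast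
    have cc: "c \<in> carrier G" using subgroup.mem_carrier[OF P(1) c(1)] .
    have "c \<noteq> \<one>" using c(2) by (metis int_pow_0 rangeI)
    hence oc: "ord c = p" using ordp c by blast
    have ind: "z [^] j = \<one>" if "d [^] i = z [^] j" for i j :: int
      using that PQ DP Qz by (metis IntI rangeI singletonD subsetD)
    let ?\<phi> = "\<lambda>(i, j). d [^] (i::int) \<otimes> z [^] (j::int)"
    have emb: "?\<phi> \<in> hom (cyclic_pair p q) G" "inj_on ?\<phi> (carrier (cyclic_pair p q))"
      using pair_embedding[OF dc od zc z(2) pos(1,2) d(3)] ind by blast+
    have "c \<otimes> z \<otimes> inv c \<in> Q" using Q.inv_op_closed2[OF cc z(1)] .
    then obtain a :: int where a: "c \<otimes> z \<otimes> inv c = z [^] a" using Qz by auto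
    have cz: "c \<otimes> z [^] j \<otimes> inv c = z [^] (a * j mod int q)" for j :: int
    proof -
      have "c \<otimes> z [^] j \<otimes> inv c = (z [^] a) [^] j"
        using hom_int_pow[OF conj_hom[OF cc] zc, of j] a is_group by simp
      thus ?thesis using int_pow_mod_ord[OF zc, of "a * j"] z zc by (simp add: int_pow_pow)
    qed
    have conj: "c \<otimes> ?\<phi> (i, j) \<otimes> inv c = ?\<phi> (i, a * j mod int q)" for i j :: int
    proof -
      have "c \<otimes> d [^] i = d [^] i \<otimes> c" using Pcomm[OF c(1)] DP by blast
      hence "c \<otimes> (d [^] i \<otimes> z [^] j) \<otimes> inv c = d [^] i \<otimes> (c \<otimes> z [^] j \<otimes> inv c)"
        using cc dc zc by (simp flip: m_assoc)
      thus ?thesis using cz by simp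
    qed
    have img: "c \<otimes> ?\<phi> u \<otimes> inv c \<in> ?\<phi> ` carrier (cyclic_pair p q)" if "u \<in> carrier (cyclic_pair p q)" for u
    proof -
      obtain i j where [simp]: "u = (i, j)" by (metis surj_pair)
      have "(i, a * j mod int q) \<in> carrier (cyclic_pair p q)"
        using that pos by (auto simp: carrier_integer_mod_group)
      thus ?thesis using conj[of i j] by (metis \<open>u = (i, j)\<close> image_eqI)
    qed
    have compl: "c [^] i \<noteq> ?\<phi> u" if "u \<in> carrier (cyclic_pair p q)" "0 < i" "i < p" for u and i :: nat
    proof
      assume eq: "c [^] i = ?\<phi> u"
      obtain k j where [simp]: "u = (k, j)" by (metis surj_pair)
      have "z [^] j = inv (d [^] k) \<otimes> c [^] i" using eq cc dc zc by (simp add: inv_solve_left)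
      moreover have "inv (d [^] k) \<otimes> c [^] i \<in> P"
        using DP subgroup_int_pow_closed[OF P(1) c(1), of "int i"]
        by (intro subgroup.m_closed[OF P(1)] subgroup.m_inv_closed[OF P(1)]) (auto simp: int_pow_int)
      ultimately have "z [^] j = \<one>" using PQ Qz by (metis IntI rangeI singletonD)
      hence eq2: "d [^] k = c [^] int i" using eq dc by (simp add: int_pow_int)
      have "c [^] int i = \<one>"
        by (rule prime_ord_indep[OF dc cc oc p _ eq2]) (use c(2) in auto)
      thus False using int_pow_eq_id[OF cc, of "int i"] oc that by (auto dest: dvd_imp_le)
    qed
    have "c [^] p = \<one>" "order G = card (carrier (cyclic_pair p q)) * p"
      using exp[OF c(1)] ord pos by (auto simp: power2_eq_square)
    note cp = this
    obtain \<alpha> where \<alpha>: "cyclic_action (cyclic_pair p q) \<alpha> p"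
      "\<And>u. u \<in> carrier (cyclic_pair p q) \<Longrightarrow> c \<otimes> ?\<phi> u = ?\<phi> (\<alpha> u) \<otimes> c"
      "semidirect (cyclic_pair p q) \<alpha> p \<cong> G"
      by (rule semidirect_of_normalized_complement[OF group_cyclic_pair G fin emb img cc cp(1) pos(1) compl cp(2)])
        (assumption+, rule that, assumption, blast, assumption)
    have "\<alpha> (i, j) = (i, a * j mod int q)" if ij: "i \<in> {0..<int p}" "j \<in> {0..<int q}" for i j
    proof -
      have u: "(i, j) \<in> carrier (cyclic_pair p q)" "(i, a * j mod int q) \<in> carrier (cyclic_pair p q)"
        using ij pos by (auto simp: carrier_integer_mod_group)
      have \<phi>c: "?\<phi> v \<in> carrier G" for v using dc zc by (auto split: prod.split)
      have "?\<phi> (\<alpha> (i, j)) = c \<otimes> ?\<phi> (i, j) \<otimes> inv c"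
        using iffD2[OF conj_eq_iff[OF cc \<phi>c \<phi>c] \<alpha>(2)[OF u(1)]] by (rule sym)
      also have "\<dots> = ?\<phi> (i, a * j mod int q)" by (rule conj)
      finally show ?thesis
        using inj_onD[OF emb(2)] cyclic_action.closed[OF \<alpha>(1) u(1)] u(2) by blast
    qed
    thus ?thesis using \<alpha> by blast
  qed
qed

section \<open>Integer matrices of size two modulo a prime\<close>

text \<open>
  Matrices with integer entries, to be read modulo \<open>p\<close>. They form a ring without any reduction, so the
  ring laws and powers apply to them, and determinant and trace identities hold exactly.
\<close>

datatype mat2 = Mat2 (m11: int) (m12: int) (m21: int) (m22: int)

instantiation mat2 :: ring_1
begin

definition "0 = Mat2 0 0 0 0"
definition "1 = Mat2 1 0 0 1"
definition "A + B = Mat2 (m11 A + m11 B) (m12 A + m12 B) (m21 A + m21 B) (m22 A + m22 B)"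
definition "A - B = Mat2 (m11 A - m11 B) (m12 A - m12 B) (m21 A - m21 B) (m22 A - m22 B)"
definition "- A = Mat2 (- m11 A) (- m12 A) (- m21 A) (- m22 A)"
definition "A * B = Mat2 (m11 A * m11 B + m12 A * m21 B) (m11 A * m12 B + m12 A * m22 B)
  (m21 A * m11 B + m22 A * m21 B) (m21 A * m12 B + m22 A * m22 B)"

instance
  by standard
    (auto simp: zero_mat2_def one_mat2_def plus_mat2_def minus_mat2_def uminus_mat2_def times_mat2_def algebra_simps)

end

lemmas mat2_defs = zero_mat2_def one_mat2_def plus_mat2_def minus_mat2_def uminus_mat2_def times_mat2_def

definition det2 :: "mat2 \<Rightarrow> int" where "det2 A = m11 A * m22 A - m12 A * m21 A"
definition tr2 :: "mat2 \<Rightarrow> int" where "tr2 A = m11 A + m22 A"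
definition adj2 :: "mat2 \<Rightarrow> mat2" where "adj2 A = Mat2 (m22 A) (- m12 A) (- m21 A) (m11 A)"
definition scalar2 :: "int \<Rightarrow> mat2" where "scalar2 c = Mat2 c 0 0 c"
definition diag2 :: "int \<Rightarrow> int \<Rightarrow> mat2" where "diag2 a b = Mat2 a 0 0 b"
definition companion :: "int \<Rightarrow> mat2" where "companion t = Mat2 0 (- 1) 1 t"

definition mcong :: "int \<Rightarrow> mat2 \<Rightarrow> mat2 \<Rightarrow> bool" where
  "mcong p A B \<longleftrightarrow> [m11 A = m11 B] (mod p) \<and> [m12 A = m12 B] (mod p) \<and>
     [m21 A = m21 B] (mod p) \<and> [m22 A = m22 B] (mod p)"

lemma det2_mult: "det2 (A * B) = det2 A * det2 B"
  by (simp add: det2_def mat2_defs algebra_simps)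

lemma det2_power: "det2 (A ^ n) = det2 A ^ n"
  by (induction n) (auto simp: det2_mult, simp add: det2_def mat2_defs)

lemma mult_adj2: "A * adj2 A = scalar2 (det2 A)" "adj2 A * A = scalar2 (det2 A)"
  by (auto simp: adj2_def scalar2_def det2_def mat2_defs algebra_simps)

lemma add_adj2: "A + adj2 A = scalar2 (tr2 A)"
  by (simp add: adj2_def scalar2_def tr2_def mat2_defs)

lemma adj2_mult: "adj2 (A * B) = adj2 B * adj2 A"
  by (simp add: adj2_def mat2_defs algebra_simps)

lemma adj2_power: "adj2 (A ^ n) = adj2 A ^ n"
proof (induction n)
  case (Suc n)
  have "adj2 (A ^ Suc n) = adj2 (A ^ n) * adj2 A" by (simp add: adj2_mult power_Suc)
  thus ?case by (simp add: Suc power_commutes)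
qed (simp add: adj2_def mat2_defs)

lemma cayley_hamilton: "A * A = scalar2 (tr2 A) * A - scalar2 (det2 A)"
  by (simp add: scalar2_def tr2_def det2_def mat2_defs algebra_simps)

lemma scalar2_1 [simp]: "scalar2 1 = 1" by (simp add: scalar2_def mat2_defs)

lemma diag2_power: "diag2 a b ^ n = diag2 (a ^ n) (b ^ n)"
  by (induction n) (auto simp: diag2_def mat2_defs)

lemma companion_simps [simp]: "det2 (companion t) = 1" "tr2 (companion t) = t" "m21 (companion t) = 1"
  by (auto simp: companion_def det2_def tr2_def)

lemma mcong_refl [simp]: "mcong p A A" by (simp add: mcong_def)

lemma mcong_sym: "mcong p A B \<Longrightarrow> mcong p B A" by (auto simp: mcong_def cong_sym)

lemma mcong_trans [trans]: "mcong p A B \<Longrightarrow> mcong p B C \<Longrightarrow> mcong p A C"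
  by (auto simp: mcong_def intro: cong_trans)

lemma mcong_eq_trans [trans]: "mcong p A B \<Longrightarrow> B = C \<Longrightarrow> mcong p A C" "A = B \<Longrightarrow> mcong p B C \<Longrightarrow> mcong p A C"
  by simp_all

lemma mcong_add: "mcong p A A' \<Longrightarrow> mcong p B B' \<Longrightarrow> mcong p (A + B) (A' + B')"
  by (auto simp: mcong_def plus_mat2_def intro: cong_add)

lemma mcong_diff: "mcong p A A' \<Longrightarrow> mcong p B B' \<Longrightarrow> mcong p (A - B) (A' - B')"
  by (auto simp: mcong_def minus_mat2_def intro: cong_diff)

lemma mcong_mult: "mcong p A A' \<Longrightarrow> mcong p B B' \<Longrightarrow> mcong p (A * B) (A' * B')"
  by (auto simp: mcong_def times_mat2_def intro!: cong_add cong_mult)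

lemmas mcong_mult_left = mcong_mult[OF mcong_refl]
lemmas mcong_mult_right = mcong_mult[OF _ mcong_refl]

lemma mcong_power: "mcong p A B \<Longrightarrow> mcong p (A ^ n) (B ^ n)"
  by (induction n) (auto intro: mcong_mult)

lemma mcong_det2: "mcong p A B \<Longrightarrow> [det2 A = det2 B] (mod p)"
  by (auto simp: mcong_def det2_def intro!: cong_diff cong_mult)

lemma mcong_companion: "[s = t] (mod p) \<Longrightarrow> mcong p (companion s) (companion t)"
  by (auto simp: mcong_def companion_def)

lemma mcong_scalar2: "[s = t] (mod p) \<Longrightarrow> mcong p (scalar2 s) (scalar2 t)"
  by (auto simp: mcong_def scalar2_def)

lemma mcong_power_1: "mcong p A 1 \<Longrightarrow> mcong p (A ^ n) 1"
  using mcong_power[of p A 1 n] by simp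

lemma mcong_period: "mcong p (A ^ q) 1 \<Longrightarrow> mcong p (A ^ (q * n)) 1"
  unfolding power_mult by (rule mcong_power_1)

text \<open>
  \<open>T\<close> conjugates \<open>B\<close> to \<open>A\<close> modulo \<open>p\<close>, stated without the inverse of \<open>T\<close>.
\<close>

definition conjugates :: "int \<Rightarrow> mat2 \<Rightarrow> mat2 \<Rightarrow> mat2 \<Rightarrow> bool" where
  "conjugates p T A B \<longleftrightarrow> \<not> p dvd det2 T \<and> mcong p (A * T) (T * B)"

lemma mat2_inverse_mod:
  assumes "prime p" "\<not> p dvd det2 T"
  obtains T' where "mcong p (T * T') 1" "mcong p (T' * T) 1"
proof -
  have "coprime (det2 T) p" using assms by (metis coprime_commute prime_imp_coprime)
  then obtain e where e: "[det2 T * e = 1] (mod p)" using cong_solve_coprime_int by blast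
  have "T * (adj2 T * scalar2 e) = scalar2 (det2 T * e)" "(adj2 T * scalar2 e) * T = scalar2 (det2 T * e)"
    by (auto simp: mat2_defs scalar2_def adj2_def det2_def algebra_simps)
  thus ?thesis using that[of "adj2 T * scalar2 e"] mcong_scalar2[OF e] by simp
qed

lemma conjugates_power: "conjugates p T A B \<Longrightarrow> conjugates p T (A ^ n) (B ^ n)"
proof (induction n)
  case (Suc n)
  have 1: "mcong p (A ^ n * T) (T * B ^ n)" "mcong p (A * T) (T * B)" using Suc by (auto simp: conjugates_def)
  have "mcong p (A * (A ^ n * T)) (A * (T * B ^ n))" by (rule mcong_mult_left[OF 1(1)])
  also have "A * (T * B ^ n) = (A * T) * B ^ n" by (simp add: mult.assoc)
  also have "mcong p ((A * T) * B ^ n) ((T * B) * B ^ n)" by (rule mcong_mult_right[OF 1(2)])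
  finally show ?case using Suc.prems by (simp add: conjugates_def mult.assoc)
qed (auto simp: conjugates_def)

lemma conjugates_sym:
  assumes p: "prime p" and T: "conjugates p T A B"
  obtains T' where "conjugates p T' B A"
proof -
  obtain T' where T': "mcong p (T * T') 1" "mcong p (T' * T) 1"
    using mat2_inverse_mod[OF p] T by (auto simp: conjugates_def)
  have "[det2 T * det2 T' = 1] (mod p)" using mcong_det2[OF T'(1)] by (simp add: det2_mult, simp add: det2_def mat2_defs)
  hence "\<not> p dvd det2 T'" using p by (metis cong_0_iff cong_sym cong_trans dvd_mult not_prime_unit)
  moreover have "mcong p (B * T') (T' * A)"
  proof -
    have "mcong p (1 * (B * T')) ((T' * T) * (B * T'))" by (rule mcong_mult_right[OF mcong_sym[OF T'(2)]])
    also have "(T' * T) * (B * T') = T' * ((T * B) * T')" by (simp add: mult.assoc)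
    also have "mcong p (T' * ((T * B) * T')) (T' * ((A * T) * T'))"
      using T by (intro mcong_mult_left mcong_mult_right mcong_sym[of p "A * T"]) (simp add: conjugates_def)
    also have "T' * ((A * T) * T') = (T' * A) * (T * T')" by (simp add: mult.assoc)
    also have "mcong p ((T' * A) * (T * T')) ((T' * A) * 1)" by (rule mcong_mult_left[OF T'(1)])
    finally show ?thesis by simp
  qed
  ultimately show ?thesis using that by (simp add: conjugates_def)
qed

lemma conjugates_trans:
  assumes p: "prime p" and "conjugates p T A B" "conjugates p S B C"
  shows "conjugates p (T * S) A C"
proof -
  have "mcong p ((A * T) * S) ((T * B) * S)" using assms by (intro mcong_mult_right) (simp add: conjugates_def)
  also have "(T * B) * S = T * (B * S)" by (simp add: mult.assoc)
  also have "mcong p (T * (B * S)) (T * (S * C))" using assms by (intro mcong_mult_left) (simp add: conjugates_def)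
  finally show ?thesis using assms by (auto simp: conjugates_def det2_mult mult.assoc prime_dvd_mult_iff)
qed

lemma conjugates_mcong_right: "conjugates p T A B \<Longrightarrow> mcong p B C \<Longrightarrow> conjugates p T A C"
  unfolding conjugates_def using mcong_trans[OF _ mcong_mult_left] by blast

lemma conjugates_1D:
  assumes p: "prime p" and T: "conjugates p T 1 B"
  shows "mcong p B 1"
proof -
  obtain T' where T': "mcong p (T * T') 1" "mcong p (T' * T) 1"
    using mat2_inverse_mod[OF p] T by (auto simp: conjugates_def)
  have "mcong p (1 * B) ((T' * T) * B)" by (rule mcong_mult_right[OF mcong_sym[OF T'(2)]])
  also have "(T' * T) * B = T' * (T * B)" by (simp add: mult.assoc)
  also have "mcong p (T' * (T * B)) (T' * (1 * T))"
    using T by (intro mcong_mult_left mcong_sym[of p "1 * T"]) (simp add: conjugates_def)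
  also have "T' * (1 * T) = T' * T" by simp
  also note T'(2)
  finally show ?thesis by simp
qed

lemma conjugates_mcong_left: "conjugates p T A B \<Longrightarrow> mcong p A C \<Longrightarrow> conjugates p T C B"
  unfolding conjugates_def using mcong_trans[OF mcong_mult_right[OF mcong_sym]] by blast

subsection \<open>Simultaneous eigenvectors\<close>

context
  fixes p lam mu :: int and q :: nat
  assumes p: "prime p" and q: "q > 0" and pq: "\<not> p dvd int q"
    and lam: "[lam ^ q = 1] (mod p)" "\<And>i. 0 < i \<Longrightarrow> i < q \<Longrightarrow> \<not> [lam ^ i = 1] (mod p)"
begin

text \<open>
  Applied to the coordinates of \<open>A\<^sup>i v\<close>, this is the projection of \<open>v\<close> to the eigenspace of \<open>A\<close> for the eigenvalue \<open>lam\<^sup>j\<close>,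
  up to the factor \<open>q\<close>. The factor \<open>lam ^ (q - 1)\<close> stands for the inverse of \<open>lam\<close>.
\<close>

definition fourier :: "nat \<Rightarrow> (nat \<Rightarrow> int) \<Rightarrow> int" where
  "fourier j X = (\<Sum>i<q. (lam ^ (q - 1)) ^ (i * j) * X i)"

lemma lam_mu: "[lam * lam ^ (q - 1) = 1] (mod p)"
  using lam(1) q by (cases q) auto

text \<open>
  Replacing \<open>X i\<close> by \<open>X (i + 1)\<close> shifts the summation index, which by periodicity costs only the factor \<open>lam\<^sup>j\<close>: the
  eigenvector equation.
\<close>

lemma fourier_shift:
  assumes "[X q = X 0] (mod p)"
  shows "[fourier j (\<lambda>i. X (Suc i)) = lam ^ j * fourier j X] (mod p)"
proof -
  let ?mu = "lam ^ (q - 1)"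
  \<comment> \<open>The terms after multiplication by \<open>lam ^ j\<close>; the sum on the left is the sum of \<open>F (Suc i)\<close>.\<close>
  define F where "F i = lam ^ j * ?mu ^ (i * j) * X i" for i
  have "[?mu ^ q = 1] (mod p)" 
    using cong_pow[OF lam(1), of "q - 1"] by (simp add: power_mult[symmetric] mult.commute)
  hence "[?mu ^ (q * j) * X q = 1 * X 0] (mod p)"
    using assms cong_pow[of "?mu ^ q" 1 p j] by (intro cong_mult) (auto simp: power_mult)
  from cong_mult[OF cong_refl[of "lam ^ j"] this]
  have F: "[F q = F 0] (mod p)" by (simp add: F_def mult.assoc)
  have "[(\<Sum>i<q. ?mu ^ (i * j) * X (Suc i)) = (\<Sum>i<q. F (Suc i))] (mod p)"
  proof (rule cong_sum)
    fix i
    have "F (Suc i) = (lam * ?mu) ^ j * (?mu ^ (i * j) * X (Suc i))"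
      by (simp add: F_def power_add power_mult_distrib algebra_simps)
    moreover have "[(lam * ?mu) ^ j * (?mu ^ (i * j) * X (Suc i)) = 1 ^ j * (?mu ^ (i * j) * X (Suc i))] (mod p)"
      by (intro cong_mult cong_pow lam_mu cong_refl)
    ultimately show "[?mu ^ (i * j) * X (Suc i) = F (Suc i)] (mod p)" by (simp add: cong_sym)
  qed
  also have "(\<Sum>i<q. F (Suc i)) = (\<Sum>i<q. F i) + (F q - F 0)"
    using sum.lessThan_Suc_shift[of F q] by simp
  also have "[(\<Sum>i<q. F i) + (F q - F 0) = (\<Sum>i<q. F i) + 0] (mod p)"
    using F by (intro cong_add cong_refl) (simp add: cong_iff_dvd_diff)
  finally show ?thesis by (simp add: fourier_def F_def sum_distrib_left mult.assoc)
qed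

text \<open>
  The projections add up to \<open>q v\<close>, since the powers of a nontrivial \<open>q\<close>-th root of unity sum to \<open>0\<close>.
\<close>

lemma fourier_sum: "[(\<Sum>j<q. fourier j X) = int q * X 0] (mod p)"
proof -
  let ?mu = "lam ^ (q - 1)"
  have z: "[(\<Sum>j<q. ?mu ^ (i * j)) = 0] (mod p)" if i: "0 < i" "i < q" for i
  proof -
    have "(?mu ^ i - 1) * (\<Sum>j<q. (?mu ^ i) ^ j) = (?mu ^ i) ^ q - 1"
      by (metis power_diff_1_eq)
    also have "\<dots> = (lam ^ q) ^ ((q - 1) * i) - 1" by (simp add: power_mult[symmetric] ac_simps)
    also have "[\<dots> = 1 ^ ((q - 1) * i) - 1] (mod p)" by (intro cong_diff cong_pow lam(1) cong_refl)
    finally have "p dvd (?mu ^ i - 1) * (\<Sum>j<q. (?mu ^ i) ^ j)" by (simp add: cong_0_iff)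
    moreover have "\<not> p dvd ?mu ^ i - 1"
    proof
      assume "p dvd ?mu ^ i - 1"
      hence "[?mu ^ i = 1] (mod p)" by (simp add: cong_iff_dvd_diff)
      hence "[lam ^ i * ?mu ^ i = lam ^ i * 1] (mod p)" by (intro cong_mult cong_refl)
      moreover have "[lam ^ i * ?mu ^ i = 1 ^ i] (mod p)"
        unfolding power_mult_distrib[symmetric] by (intro cong_pow lam_mu)
      ultimately have "[lam ^ i = 1] (mod p)" by (metis cong_sym cong_trans mult.right_neutral power_one)
      thus False using lam(2) i by blast
    qed
    ultimately show ?thesis using p by (auto simp: prime_dvd_mult_iff cong_0_iff power_mult)
  qed
  have "(\<Sum>j<q. fourier j X) = (\<Sum>i<q. (\<Sum>j<q. ?mu ^ (i * j)) * X i)"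
    unfolding fourier_def sum_distrib_right by (rule sum.swap)
  also have "[\<dots> = (\<Sum>i<q. (if i = 0 then int q * X 0 else 0))] (mod p)"
  proof (rule cong_sum)
    fix i assume "i \<in> {..<q}"
    thus "[(\<Sum>j<q. ?mu ^ (i * j)) * X i = (if i = 0 then int q * X 0 else 0)] (mod p)"
      using z[of i] cong_mult[of "\<Sum>j<q. ?mu ^ (i * j)" 0 p "X i" "X i"] by auto
  qed
  also have "(\<Sum>i<q. (if i = 0 then int q * X 0 else 0)) = int q * X 0" using q by (simp add: sum.delta)
  finally show ?thesis .
qed

text \<open>
  As \<open>q\<close> is invertible, each vector is a combination of the eigenvectors obtained from it. So the first unit vector
  yields a nonzero eigenvector \<open>(a, b)\<close>, and if all eigenvectors were multiples of it, then all vectors would be.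
  Two independent eigenvectors are the columns of \<open>T\<close>.
\<close>

lemma diagonalizable:
  assumes A: "mcong p (A ^ q) 1"
  obtains T i j where "conjugates p T A (diag2 (lam ^ i) (lam ^ j))"
proof -
  define X where "X v i = m11 (A ^ i) * fst v + m12 (A ^ i) * snd v" for v i
  define Y where "Y v i = m21 (A ^ i) * fst v + m22 (A ^ i) * snd v" for v i
  have rec: "X v (Suc i) = m11 A * X v i + m12 A * Y v i" "Y v (Suc i) = m21 A * X v i + m22 A * Y v i" for v i
    by (auto simp: X_def Y_def times_mat2_def algebra_simps)
  have X0: "X v 0 = fst v" "Y v 0 = snd v" for v by (auto simp: X_def Y_def one_mat2_def)
  have XY: "[X v q = X v 0] (mod p)" "[Y v q = Y v 0] (mod p)" for v
    using A unfolding X_def Y_def by (auto simp: mcong_def intro!: cong_add cong_mult)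
  define x where "x j v = fourier j (X v)" for j v
  define y where "y j v = fourier j (Y v)" for j v
  have lin: "fourier j (\<lambda>i. a * F i + b * G i) = a * fourier j F + b * fourier j G" for j a b F G
    by (simp add: fourier_def sum.distrib sum_distrib_left algebra_simps)
  have eig: "[m11 A * x j v + m12 A * y j v = lam ^ j * x j v] (mod p)"
    "[m21 A * x j v + m22 A * y j v = lam ^ j * y j v] (mod p)" for j v
    using fourier_shift[OF XY(1)[of v], of j] fourier_shift[OF XY(2)[of v], of j]
    by (simp_all add: rec lin x_def y_def)
  have sums: "[(\<Sum>j<q. x j v) = int q * fst v] (mod p)" "[(\<Sum>j<q. y j v) = int q * snd v] (mod p)" for v
    unfolding x_def y_def using fourier_sum[of "X v"] fourier_sum[of "Y v"] by (auto simp: X0)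
  have "\<exists>j. \<not> (p dvd x j (1, 0))"
  proof (rule ccontr)
    assume "\<not> ?thesis"
    hence "p dvd (\<Sum>j<q. x j (1, 0))" by (intro dvd_sum) auto
    thus False using sums(1)[of "(1, 0)"] pq by (simp add: cong_dvd_iff)
  qed
  then obtain i where i: "\<not> p dvd x i (1, 0)" by blast
  define a b where "a = x i (1, 0)" and "b = y i (1, 0)"
  have "\<exists>j v. \<not> p dvd a * y j v - b * x j v"
  proof (rule ccontr)
    assume "\<not> ?thesis"
    hence "p dvd (\<Sum>j<q. a * y j (0, 1) - b * x j (0, 1))" by (intro dvd_sum) auto
    moreover have "(\<Sum>j<q. a * y j (0, 1) - b * x j (0, 1)) = a * (\<Sum>j<q. y j (0, 1)) - b * (\<Sum>j<q. x j (0, 1))"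
      by (simp add: sum_subtractf sum_distrib_left)
    moreover have "[a * (\<Sum>j<q. y j (0, 1)) - b * (\<Sum>j<q. x j (0, 1)) = a * int q - b * 0] (mod p)"
      using sums[of "(0, 1)"] by (intro cong_diff cong_mult) auto
    ultimately have "p dvd a * int q" by (simp add: cong_dvd_iff)
    thus False using i pq p by (simp add: prime_dvd_mult_iff a_def)
  qed
  then obtain j v where jv: "\<not> p dvd a * y j v - b * x j v" by blast
  have "conjugates p (Mat2 a (x j v) b (y j v)) A (diag2 (lam ^ i) (lam ^ j))"
    using jv eig[of i "(1, 0)"] eig[of j v]
    by (simp add: conjugates_def det2_def mcong_def times_mat2_def diag2_def a_def b_def mult.commute)
  thus ?thesis using that by blast
qed

end

subsection \<open>Matrices of prime order without eigenvectors\<close>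

text \<open>
  By Cayley and Hamilton \<open>N = B - 1\<close> has square \<open>0\<close>, so \<open>B\<^sup>q = 1 + q N\<close>, and \<open>q\<close> is invertible.
\<close>

lemma unipotent_order:
  assumes p: "prime p" "\<not> p dvd int q"
    and B: "mcong p (B ^ q) 1" "[det2 B = 1] (mod p)" "[tr2 B = 2] (mod p)"
  shows "mcong p B 1"
proof -
  define N where "N = B - 1"
  have "N * N = B * B - B - B + 1" by (simp add: N_def algebra_simps)
  also have "\<dots> = scalar2 (tr2 B) * B - scalar2 (det2 B) - B - B + 1" by (simp add: cayley_hamilton[of B])
  also have "mcong p \<dots> (scalar2 2 * B - scalar2 1 - B - B + 1)"
    using B by (intro mcong_add mcong_diff mcong_mult_right mcong_scalar2 mcong_refl) auto
  also have "scalar2 2 * B - scalar2 1 - B - B + 1 = 0"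
    by (simp add: scalar2_def mat2_defs)
  finally have N: "mcong p (N * N) 0" .
  have "mcong p (B ^ n) (1 + scalar2 (int n) * N)" for n
  proof (induction n)
    case (Suc n)
    have "mcong p (B * B ^ n) (B * (1 + scalar2 (int n) * N))" by (rule mcong_mult_left[OF Suc])
    also have "B * (1 + scalar2 (int n) * N) = (1 + scalar2 (int (Suc n)) * N) + scalar2 (int n) * (N * N)"
      by (simp add: N_def scalar2_def mat2_defs algebra_simps)
    also have "mcong p \<dots> ((1 + scalar2 (int (Suc n)) * N) + scalar2 (int n) * 0)"
      by (intro mcong_add mcong_mult_left N mcong_refl)
    finally show ?case by simp
  qed (simp add: scalar2_def mat2_defs)
  from mcong_trans[OF mcong_sym[OF this[of q]] B(1)]
  have "mcong p (1 + scalar2 (int q) * N) 1" .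
  from mcong_diff[OF this mcong_refl[of p 1]] have "mcong p (scalar2 (int q) * N) 0" by simp
  hence "mcong p N 0"
    using p by (auto simp: mcong_def scalar2_def mat2_defs cong_0_iff prime_dvd_mult_iff)
  from mcong_add[OF this mcong_refl[of p 1]] show ?thesis by (simp add: N_def)
qed

text \<open>
  The trace of the \<open>i\<close>-th power of a matrix with determinant \<open>1\<close>, as a polynomial in the trace of the matrix.
\<close>

fun trace_poly :: "nat \<Rightarrow> int poly" where
  "trace_poly 0 = [:2:]"
| "trace_poly (Suc 0) = [:0, 1:]"
| "trace_poly (Suc (Suc i)) = [:0, 1:] * trace_poly (Suc i) - trace_poly i"

lemma degree_trace_poly:
  "i > 0 \<Longrightarrow> degree (trace_poly i) = i \<and> coeff (trace_poly i) i = 1"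
proof (induction i rule: trace_poly.induct)
  case (3 i)
  have 1: "degree (trace_poly (Suc i)) = Suc i" "coeff (trace_poly (Suc i)) (Suc i) = 1" using 3 by auto
  have 2: "degree (trace_poly i) \<le> i" using 3 by (cases "i = 0") auto
  have nz: "trace_poly (Suc i) \<noteq> 0" using 1(2) by force
  have d1: "degree ([:0, 1:] * trace_poly (Suc i)) = Suc (Suc i)"
    using 1 nz by (simp add: degree_pCons_eq_if)
  have "degree (trace_poly (Suc (Suc i))) = Suc (Suc i)"
    using 2 d1 degree_add_eq_left[of "- trace_poly i" "[:0, 1:] * trace_poly (Suc i)"] by simp
  moreover have "coeff (trace_poly i) (Suc (Suc i)) = 0" using 2 by (intro coeff_eq_0) simp
  ultimately show ?case using 1 by simp
qed auto

lemma tr2_companion_power: "tr2 (companion t ^ i) = poly (trace_poly i) t"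
proof (induction i rule: trace_poly.induct)
  case 1
  show ?case by (simp add: tr2_def one_mat2_def)
next
  case (3 i)
  have "companion t ^ Suc (Suc i) = (companion t * companion t) * companion t ^ i" by (simp add: mult.assoc)
  also have "\<dots> = scalar2 t * companion t ^ Suc i - companion t ^ i"
    by (simp add: cayley_hamilton[of "companion t"] algebra_simps)
  finally have "tr2 (companion t ^ Suc (Suc i)) = t * tr2 (companion t ^ Suc i) - tr2 (companion t ^ i)"
    by (simp add: tr2_def scalar2_def mat2_defs algebra_simps)
  thus ?case using 3 by simp
qed simp

text \<open>
  For determinant \<open>1\<close> the matrix \<open>B\<^sup>i + inverse(B)\<^sup>i\<close> is the scalar \<open>tr(B\<^sup>i)\<close>, so at \<open>t = tr(B)\<close> this polynomial is the
  sum of \<open>B\<^sup>i\<close> for \<open>-m \<le> i \<le> m\<close>.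
\<close>

definition order_poly :: "nat \<Rightarrow> int poly" where
  "order_poly m = 1 + (\<Sum>i=1..m. trace_poly i)"

lemma order_poly_monic: "degree (order_poly m) = m \<and> coeff (order_poly m) m = 1"
proof (induction m)
  case (Suc m)
  have eq: "order_poly (Suc m) = trace_poly (Suc m) + order_poly m"
    by (simp add: order_poly_def)
  have "degree (order_poly (Suc m)) = Suc m"
    unfolding eq using degree_trace_poly[of "Suc m"] Suc by (subst degree_add_eq_left) auto
  moreover have "coeff (order_poly m) (Suc m) = 0" using Suc by (intro coeff_eq_0) auto
  ultimately show ?case unfolding eq using degree_trace_poly[of "Suc m"] by simp
qed (simp add: order_poly_def)

text \<open>
  Multiplying the geometric sum by \<open>C - 1\<close> telescopes to \<open>C\<^sup>m\<^sup>+\<^sup>1 - inverse(C)\<^sup>m\<close>, which vanishes for \<open>C\<^sup>2\<^sup>m\<^sup>+\<^sup>1 = 1\<close>. Here \<open>C - 1\<close> has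
  the entry \<open>1\<close>, so the scalar factor is \<open>0\<close>.
\<close>

lemma order_poly_root:
  assumes C: "mcong p (companion t ^ (2 * m + 1)) 1"
  shows "p dvd poly (order_poly m) t"
proof -
  let ?C = "companion t" and ?D = "adj2 (companion t)"
  have CD: "?C * ?D = 1" "?D * ?C = 1" by (simp_all add: mult_adj2)
  have geo: "(?C - 1) * scalar2 (poly (order_poly n) t) = ?C ^ Suc n - ?D ^ n" for n
  proof (induction n)
    case (Suc n)
    have "scalar2 (poly (order_poly (Suc n)) t) = scalar2 (poly (order_poly n) t) + (?C ^ Suc n + ?D ^ Suc n)"
    proof -
      have "?C ^ Suc n + ?D ^ Suc n = scalar2 (poly (trace_poly (Suc n)) t)"
        by (simp only: add_adj2 flip: adj2_power tr2_companion_power)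
      thus ?thesis by (simp add: order_poly_def scalar2_def mat2_defs)
    qed
    hence "(?C - 1) * scalar2 (poly (order_poly (Suc n)) t) =
        (?C ^ Suc n - ?D ^ n) + (?C - 1) * (?C ^ Suc n + ?D ^ Suc n)"
      by (simp only: distrib_left Suc)
    also have "(?C - 1) * (?C ^ Suc n + ?D ^ Suc n) = ?C ^ Suc (Suc n) - ?C ^ Suc n + (?C * ?D) * ?D ^ n - ?D ^ Suc n"
      by (simp only: power_Suc distrib_left left_diff_distrib mult_1_left mult.assoc) (simp add: algebra_simps)
    finally show ?case by (simp add: CD)
  qed (simp add: order_poly_def)
  have "?C ^ Suc m = ?C ^ (2 * m + 1) * ?D ^ m"
  proof -
    have "?C ^ n * ?D ^ n = 1" for n
    proof (induction n)
      case (Suc n)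
      have "?C ^ Suc n * ?D ^ Suc n = ?C * (?C ^ n * ?D ^ n) * ?D"
        by (simp add: mult.assoc power_commutes)
      thus ?case using Suc CD by simp
    qed simp
    moreover have "?C ^ (2 * m + 1) = ?C ^ Suc m * ?C ^ m"
      by (simp add: mult_2 del: power_Suc flip: power_add)
    ultimately show ?thesis by (simp only: mult.assoc mult_1_right)
  qed
  also have "mcong p \<dots> (1 * ?D ^ m)" by (rule mcong_mult_right[OF C])
  finally have "mcong p (?C ^ Suc m - ?D ^ m) (1 * ?D ^ m - ?D ^ m)" by (intro mcong_diff mcong_refl)
  hence "mcong p ((?C - 1) * scalar2 (poly (order_poly m) t)) 0" by (simp add: geo)
  hence "[m21 ((?C - 1) * scalar2 (poly (order_poly m) t)) = 0] (mod p)" by (simp add: mcong_def zero_mat2_def)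
  thus ?thesis by (simp add: companion_def scalar2_def mat2_defs cong_0_iff)
qed

lemma monic_poly_roots_mod_prime:
  fixes f :: "int poly"
  assumes p: "prime p"
  shows "degree f = d \<Longrightarrow> coeff f d = 1 \<Longrightarrow> card {x\<in>{0..<p}. p dvd poly f x} \<le> d"
proof (induction d arbitrary: f)
  case 0
  then obtain c where "f = [:c:]" by (auto elim: degree_eq_zeroE)
  hence "f = [:1:]" using 0 by simp
  thus ?case using p not_prime_unit by auto
next
  case (Suc d)
  let ?R = "\<lambda>f. {x\<in>{0..<p}. p dvd poly f x}"
  have fin: "finite (?R f)" for f by (rule finite_subset[of _ "{0..<p}"]) auto
  show ?case
  proof (cases "?R f = {}")
    case False
    then obtain a where a: "a \<in> {0..<p}" "p dvd poly f a" by blast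
    define g where "g = synthetic_div f a"
    have fg: "f = [:poly f a:] + [:- a, 1:] * g"
      using synthetic_div_correct'[of a f] by (simp add: g_def algebra_simps)
    have dg: "degree g = d" using Suc.prems by (simp add: g_def degree_synthetic_div)
    have "coeff f (Suc d) = coeff g d"
      by (subst fg) (use dg in \<open>simp add: coeff_eq_0\<close>)
    hence IH: "card (?R g) \<le> d" using Suc dg by auto
    have "?R f \<subseteq> insert a (?R g)"
    proof
      fix b assume b: "b \<in> ?R f"
      have "poly f b = poly f a + (b - a) * poly g b" by (subst fg) (simp add: algebra_simps)
      hence "p dvd (b - a) * poly g b" using a b by (metis (no_types, lifting) dvd_add_right_iff mem_Collect_eq)
      moreover have "b = a" if "p dvd b - a"
      proof -
        have "b mod p = a mod p" using that by (simp add: mod_eq_dvd_iff)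
        thus "b = a" using a b by simp
      qed
      ultimately show "b \<in> insert a (?R g)" using b p by (auto simp: prime_dvd_mult_iff)
    qed
    hence "card (?R f) \<le> card (insert a (?R g))" by (intro card_mono finite.insertI fin)
    also have "\<dots> \<le> Suc d" using IH card_insert_le_m1[of "Suc d" "?R g" a] by simp
    finally show ?thesis .
  next
    case True
    show ?thesis unfolding True by simp
  qed
qed

context
  fixes p :: int and q :: nat
  assumes p: "prime p" and q: "prime q" and pq: "\<not> p dvd int q"
    and root1: "\<And>x. [x ^ q = 1] (mod p) \<Longrightarrow> [x = 1] (mod p)"
begin

text \<open>
  A basis of the form \<open>e, B e\<close> turns \<open>B\<close> into a companion matrix, and \<open>det B = 1\<close> as \<open>1\<close> is the only \<open>q\<close>-th root of unity. If the
  first unit vector \<open>e\<close> were an eigenvector, its eigenvalue would be \<open>1\<close> and \<open>B\<close> would be unipotent, hence trivial.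
\<close>

lemma conjugate_companion:
  assumes B: "mcong p (B ^ q) 1" "\<not> mcong p B 1"
  obtains T where "conjugates p T B (companion (tr2 B))"
proof -
  have "[det2 B ^ q = 1] (mod p)" using mcong_det2[OF B(1)] by (simp add: det2_power, simp add: det2_def one_mat2_def)
  hence det: "[det2 B = 1] (mod p)" by (rule root1)
  have c: "\<not> p dvd m21 B"
  proof
    assume c: "p dvd m21 B"
    have "[m11 (B ^ i) = m11 B ^ i] (mod p) \<and> p dvd m21 (B ^ i)" for i
    proof (induction i)
      case (Suc i)
      have "[m11 B * m11 (B ^ i) + m12 B * m21 (B ^ i) = m11 B * m11 B ^ i + m12 B * 0] (mod p)"
        using Suc by (intro cong_add cong_mult cong_refl) (auto simp: cong_0_iff)
      thus ?case using Suc c by (simp add: times_mat2_def)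
    qed (simp add: one_mat2_def)
    from this[of q] have "[m11 B ^ q = 1] (mod p)"
      using B(1) by (auto simp: mcong_def one_mat2_def intro: cong_trans cong_sym)
    hence a: "[m11 B = 1] (mod p)" by (rule root1)
    have "[det2 B = 1 * m22 B - m12 B * 0] (mod p)"
      unfolding det2_def using a c by (intro cong_diff cong_mult cong_refl) (auto simp: cong_0_iff)
    hence "[m22 B = 1] (mod p)" using det by (metis cong_sym cong_trans diff_zero mult.left_neutral mult_zero_right)
    hence "[tr2 B = 1 + 1] (mod p)" unfolding tr2_def using a by (intro cong_add)
    hence "[tr2 B = 2] (mod p)" by simp
    from unipotent_order[OF p pq B(1) det this] B(2) show False by blast
  qed
  have "conjugates p (Mat2 1 (m11 B) 0 (m21 B)) B (companion (tr2 B))"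
  proof -
    have "[m11 B * m11 B + m12 B * m21 B = m11 B * tr2 B - det2 B] (mod p)"
      by (simp add: tr2_def det2_def algebra_simps)
    also have "[m11 B * tr2 B - det2 B = m11 B * tr2 B - 1] (mod p)"
      using det by (intro cong_diff cong_refl)
    finally show ?thesis using c
      by (simp add: conjugates_def mcong_def times_mat2_def companion_def det2_def)
        (simp add: tr2_def algebra_simps)
  qed
  thus ?thesis using that by blast
qed

lemma companion_of_order:
  assumes B: "mcong p (B ^ q) 1" "\<not> mcong p B 1"
  obtains T where "conjugates p T B (companion (tr2 B))" "mcong p (companion (tr2 B) ^ q) 1"
proof -
  obtain T where T: "conjugates p T B (companion (tr2 B))" using conjugate_companion[OF B] .
  have "conjugates p T 1 (companion (tr2 B) ^ q)"
    using conjugates_mcong_left[OF conjugates_power[OF T] B(1)] .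
  from conjugates_1D[OF p this] show ?thesis using that T by blast
qed

lemma not_mcong_companion_1: "\<not> mcong p (companion t) 1"
  using p not_prime_unit[of p] by (auto simp: mcong_def companion_def one_mat2_def cong_def mod_eq_0_iff_dvd)

lemma power_companion_not_1:
  assumes C: "mcong p (companion t ^ q) 1" and n: "\<not> q dvd n"
  shows "\<not> mcong p (companion t ^ n) 1"
proof
  assume *: "mcong p (companion t ^ n) 1"
  have "coprime n q" using q n by (metis coprime_commute prime_imp_coprime_nat)
  then obtain k where k: "[n * k = 1] (mod q)" using cong_solve_coprime_nat[of n q] by auto
  have nk: "n * k \<noteq> 0" using k q by (metis cong_0_1_nat cong_def not_prime_1)
  obtain l where l: "n * k = 1 + q * l"
    using k nk cong_to_1_nat by (metis Suc_pred bot_nat_0.not_eq_extremum dvdE plus_1_eq_Suc diff_Suc_1)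
  have "mcong p (companion t ^ (n * k)) 1" using mcong_period[OF *] .
  hence "mcong p (companion t * companion t ^ (q * l)) 1" by (simp add: l)
  from mcong_trans[OF mcong_sym[OF mcong_mult_left[OF mcong_period[OF C]]] this]
  have "mcong p (companion t) 1" by simp
  thus False using not_mcong_companion_1 by blast
qed

lemma trace_power_companion_not_2:
  assumes C: "mcong p (companion t ^ q) 1" and n: "\<not> q dvd n"
  shows "\<not> [tr2 (companion t ^ n) = 2] (mod p)"
proof
  assume *: "[tr2 (companion t ^ n) = 2] (mod p)"
  have "mcong p ((companion t ^ n) ^ q) 1"
    using mcong_period[OF C, of n] by (simp add: power_mult[symmetric] mult.commute)
  from unipotent_order[OF p pq this _ *] have "mcong p (companion t ^ n) 1" by (simp add: det2_power)
  thus False using power_companion_not_1[OF C n] by blast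
qed

text \<open>
  Equality of the traces means \<open>(C\<^sup>l - C\<^sup>k) (1 - inverse(C)\<^sup>l\<^sup>+\<^sup>k) = 0\<close>. The determinants of both factors have the
  form \<open>2 - tr(C\<^sup>n)\<close>, and neither is \<open>0\<close>.
\<close>

lemma trace_power_companion_inj:
  assumes C: "mcong p (companion t ^ q) 1" and kl: "k < l" "\<not> q dvd l - k" "\<not> q dvd l + k"
  shows "\<not> [tr2 (companion t ^ k) = tr2 (companion t ^ l)] (mod p)"
proof
  let ?C = "companion t" and ?D = "adj2 (companion t)"
  assume *: "[tr2 (?C ^ k) = tr2 (?C ^ l)] (mod p)"
  have CD: "?C ^ n * ?D ^ n = 1" for n
    by (simp add: adj2_power[symmetric] mult_adj2 det2_power)
  have det1: "det2 (1 - B) = 2 - tr2 B" if "det2 B = 1" for B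
    using that by (simp add: det2_def tr2_def mat2_defs algebra_simps)
  have "(?C ^ l - ?C ^ k) * (1 - ?D ^ (l + k)) =
      ?C ^ l - ?C ^ k - (?C ^ l * ?D ^ l) * ?D ^ k + (?C ^ k * ?D ^ k) * ?D ^ l"
  proof -
    have "?C ^ l * ?D ^ (l + k) = (?C ^ l * ?D ^ l) * ?D ^ k" by (simp add: power_add mult.assoc)
    moreover have "?C ^ k * ?D ^ (l + k) = (?C ^ k * ?D ^ k) * ?D ^ l"
      by (simp add: add.commute[of l k] power_add mult.assoc)
    ultimately show ?thesis by (simp only: left_diff_distrib right_diff_distrib mult_1_right) simp
  qed
  also have "\<dots> = (?C ^ l + adj2 (?C ^ l)) - (?C ^ k + adj2 (?C ^ k))"
    unfolding CD by (simp add: adj2_power)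
  also have "\<dots> = scalar2 (tr2 (?C ^ l)) - scalar2 (tr2 (?C ^ k))" by (simp only: add_adj2)
  also have "mcong p \<dots> (scalar2 (tr2 (?C ^ l)) - scalar2 (tr2 (?C ^ l)))"
    by (intro mcong_diff mcong_refl mcong_scalar2 *)
  finally have "mcong p ((?C ^ l - ?C ^ k) * (1 - ?D ^ (l + k))) 0" by simp
  from mcong_det2[OF this] have "p dvd det2 ((?C ^ l - ?C ^ k) * (1 - ?D ^ (l + k)))"
    by (simp add: det2_def zero_mat2_def cong_0_iff)
  moreover have "?C ^ l - ?C ^ k = - (?C ^ k * (1 - ?C ^ (l - k)))"
    using kl by (simp add: algebra_simps power_add[symmetric])
  moreover have "det2 (- B) = det2 B" for B by (simp add: det2_def uminus_mat2_def)
  moreover have "1 - ?D ^ (l + k) = adj2 (1 - ?C ^ (l + k))"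
    by (simp add: adj2_power[symmetric]) (simp add: adj2_def mat2_defs)
  moreover have "det2 (adj2 B) = det2 B" for B by (simp add: det2_def adj2_def)
  ultimately have "p dvd (2 - tr2 (?C ^ (l - k))) * (2 - tr2 (?C ^ (l + k)))"
    by (simp add: det2_mult det2_power det1)
  hence "p dvd 2 - tr2 (?C ^ (l - k)) \<or> p dvd 2 - tr2 (?C ^ (l + k))" using p by (simp add: prime_dvd_mult_iff)
  thus False using trace_power_companion_not_2[OF C kl(2)] trace_power_companion_not_2[OF C kl(3)]
    by (auto simp: cong_iff_dvd_diff dvd_diff_commute)
qed

text \<open>
  The traces of \<open>C, C\<^sup>2, ..., C\<^sup>m\<close> for \<open>q = 2 m + 1\<close> are \<open>m\<close> different roots of a monic polynomial of degree \<open>m\<close>,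
  so they are all roots, and \<open>s\<close> is one of them.
\<close>

lemma companion_conjugate_power:
  assumes odd: "odd q" and C: "mcong p (companion t ^ q) 1" and C': "mcong p (companion s ^ q) 1"
  obtains T k where "coprime k q" "conjugates p T (companion s) (companion t ^ k)"
proof -
  obtain m where m: "q = 2 * m + 1" using odd oddE by blast
  have p0: "p > 0" using p prime_gt_0_int by blast
  let ?tr = "\<lambda>k. tr2 (companion t ^ k)"
  let ?R = "{x\<in>{0..<p}. p dvd poly (order_poly m) x}"
  have root: "x mod p \<in> ?R" if "mcong p (companion x ^ q) 1" for x
  proof -
    have "mcong p (companion (x mod p) ^ q) (companion x ^ q)"
      by (intro mcong_power mcong_companion) simp
    hence "mcong p (companion (x mod p) ^ (2 * m + 1)) 1" using that mcong_trans m by blast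
    thus ?thesis using order_poly_root p0 by simp
  qed
  have nd: "\<not> q dvd k" if "k \<in> {1..m}" for k using that m by (auto dest: dvd_imp_le)
  have Ck: "mcong p ((companion t ^ k) ^ q) 1" for k
    using mcong_period[OF C, of k] by (simp add: power_mult[symmetric] mult.commute)
  have trk: "mcong p (companion (?tr k) ^ q) 1" if k: "k \<in> {1..m}" for k
    using companion_of_order[OF Ck[of k] power_companion_not_1[OF C nd[OF k]]] by blast
  have inj: "inj_on (\<lambda>k. ?tr k mod p) {1..m}"
  proof (rule inj_onI, rule ccontr)
    fix k l assume kl: "k \<in> {1..m}" "l \<in> {1..m}" "?tr k mod p = ?tr l mod p" "k \<noteq> l"
    have no: False if "k < l" "k \<in> {1..m}" "l \<in> {1..m}" "?tr k mod p = ?tr l mod p" for k l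
    proof -
      have "\<not> q dvd l - k" "\<not> q dvd l + k" using that m by (auto dest!: dvd_imp_le)
      thus False using trace_power_companion_inj[OF C that(1)] that(4) by (auto simp: cong_def)
    qed
    show False using no[of k l] no[of l k] kl by (cases "k < l") auto
  qed
  have "(\<lambda>k. ?tr k mod p) ` {1..m} = ?R"
  proof (rule card_seteq)
    show "(\<lambda>k. ?tr k mod p) ` {1..m} \<subseteq> ?R" using root trk by blast
    show "card ?R \<le> card ((\<lambda>k. ?tr k mod p) ` {1..m})"
      using monic_poly_roots_mod_prime[OF p, of "order_poly m" m] order_poly_monic[of m] card_image[OF inj] by simp
    show "finite ?R" by (rule finite_subset[of _ "{0..<p}"]) auto
  qed
  moreover have "s mod p \<in> ?R" by (rule root[OF C'])
  ultimately obtain k where k: "k \<in> {1..m}" "s mod p = ?tr k mod p" by (metis (no_types, lifting) imageE)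
  obtain T where "conjugates p T (companion t ^ k) (companion (?tr k))"
    using conjugate_companion[OF Ck power_companion_not_1[OF C nd[OF k(1)]]] .
  moreover have "mcong p (companion (?tr k)) (companion s)"
    using k by (intro mcong_companion) (simp add: cong_def)
  ultimately have "conjugates p T (companion t ^ k) (companion s)" by (rule conjugates_mcong_right)
  then obtain S where "conjugates p S (companion s) (companion t ^ k)" using conjugates_sym[OF p] by blast
  moreover have "coprime k q" using nd[OF k(1)] q by (metis coprime_commute prime_imp_coprime_nat)
  ultimately show ?thesis using that by blast
qed

end

section \<open>Elements of given order modulo a cyclic modulus\<close>

lemma ord_exists_primroot:
  fixes m g d :: nat
  assumes g: "residue_primroot m g" and d: "d dvd totient m"
  obtains a where "ord m a = d"
proof -
  have g': "coprime m g" "ord m g = totient m" "m > 0" using g by (auto simp: residue_primroot_def)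
  hence t: "totient m > 0" by simp
  obtain e where e: "totient m = d * e" using d by blast
  have "ord m (g ^ e) = d" using ord_power[OF g'(1), of e] g' e t by simp
  thus ?thesis using that by blast
qed

text \<open>
  Write \<open>a\<close> and \<open>b\<close> as powers of a primitive root. The exponents of the solutions of \<open>x\<^sup>d = 1\<close> are the multiples of \<open>\<phi>(m) / d\<close>,
  and the exponent of \<open>a\<close> generates all of them modulo \<open>\<phi>(m)\<close>.
\<close>

lemma power_of_equal_order:
  fixes m g d a b :: nat
  assumes g: "residue_primroot m g" and m: "m > 1" and a: "ord m a = d" and b: "[b ^ d = 1] (mod m)" and d: "d > 0"
  obtains k where "[b = a ^ k] (mod m)"
proof -
  have g': "coprime m g" "ord m g = totient m" using g by (auto simp: residue_primroot_def)
  have t: "totient m > 0" using m by simp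
  have bij: "bij_betw (\<lambda>i. g ^ i mod m) {..<totient m} (totatives m)"
    using residue_primroot_is_generator[OF m g] .
  have ex: "\<exists>i. [x = g ^ i] (mod m)" if "coprime m x" for x
  proof -
    have "x mod m \<in> totatives m" using that m
      by (auto simp: totatives_def coprime_commute intro!: Nat.gr0I dest: mod_eq_0_iff_dvd[THEN iffD1])
    then obtain i where "x mod m = g ^ i mod m" using bij by (auto simp: bij_betw_def)
    thus ?thesis by (auto simp: cong_def)
  qed
  have "coprime m a" using a d by (metis ord_eq_0 less_irrefl)
  moreover have "coprime m b"
  proof -
    have "ord m b dvd d" using b ord_divides by blast
    hence "ord m b \<noteq> 0" using d by (metis dvd_0_left_iff less_irrefl)
    thus ?thesis by (simp add: ord_eq_0)
  qed
  ultimately obtain i j where ij: "[a = g ^ i] (mod m)" "[b = g ^ j] (mod m)" using ex by blast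
  have "ord m (g ^ i) = d" using ij(1) a ord_cong by metis
  hence di: "d = totient m div gcd i (totient m)" using ord_power[OF g'(1), of i] g' by simp
  define e where "e = gcd i (totient m)"
  have e: "totient m = d * e" using di by (simp add: e_def)
  have "[g ^ (j * d) = 1] (mod m)"
    using b cong_pow[OF ij(2), of d] by (metis cong_sym cong_trans power_mult)
  hence "ord m g dvd j * d" by (rule iffD1[OF ord_divides])
  hence "d * e dvd j * d" using g' e by simp
  hence "e dvd j" using d by (simp add: mult.commute)
  then obtain f where f: "j = e * f" by blast
  have "i \<noteq> 0 \<or> totient m \<noteq> 0" using t by simp
  obtain u where u: "[i * u = e] (mod totient m)"
    using cong_solve_nat[of i "totient m"] t unfolding e_def by (cases "i = 0") (auto intro: that[of 1] simp: cong_def)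
  have "[i * u * f = e * f] (mod totient m)" using u by (intro cong_mult cong_refl)
  hence "[g ^ (i * (u * f)) = g ^ j] (mod m)"
    using order_divides_expdiff[OF g'(1)] g' f by (simp add: mult.assoc)
  moreover have "[a ^ (u * f) = (g ^ i) ^ (u * f)] (mod m)" by (intro cong_pow ij)
  ultimately have "[b = a ^ (u * f)] (mod m)" using ij(2) by (metis cong_sym cong_trans power_mult)
  thus ?thesis using that by blast
qed

lemma coprime_power_of_equal_order:
  fixes m g d a b :: nat
  assumes g: "residue_primroot m g" and m: "m > 1" and a: "ord m a = d" and b: "ord m b = d" and d: "d > 0"
  obtains k where "[b = a ^ k] (mod m)" "coprime k d"
proof -
  have "[b ^ d = 1] (mod m)" using b ord by blast
  then obtain k where k: "[b = a ^ k] (mod m)" using power_of_equal_order[OF g m a _ d] by blast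
  have "coprime m a" using a d by (metis ord_eq_0 less_irrefl)
  hence "d = d div gcd k d" using ord_power[of m a k] a b ord_cong[OF k] by simp
  hence "gcd k d = 1" using d by (metis div_eq_dividend_iff gcd_pos_nat less_irrefl)
  thus ?thesis using that k by (simp add: coprime_iff_gcd_eq_1)
qed

section \<open>The quadratic extension of a prime field\<close>

text \<open>
  The pair \<open>(a, b)\<close> stands for \<open>a + b X\<close> in the ring of polynomials modulo \<open>X\<^sup>2 - s X - r\<close>. Its matrix describes the
  multiplication by this element.
\<close>

definition quad_mat :: "int \<Rightarrow> int \<Rightarrow> int \<times> int \<Rightarrow> mat2" where
  "quad_mat s r = (\<lambda>(a, b). Mat2 a (r * b) b (a + s * b))"

definition quad_units :: "nat \<Rightarrow> int \<Rightarrow> int \<Rightarrow> (int \<times> int) monoid" where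
  "quad_units p s r =
     \<lparr>carrier = {0..<int p} \<times> {0..<int p} - {(0, 0)},
      monoid.mult = (\<lambda>(a, b) (c, d). ((a * c + r * b * d) mod int p, (a * d + b * c + s * b * d) mod int p)),
      one = (1, 0)\<rparr>"

locale irreducible_quadratic =
  fixes p :: nat and s r :: int
  assumes p: "prime p" and irred: "\<And>x. \<not> int p dvd x * x - s * x - r"
begin

abbreviation "K \<equiv> quad_units p s r"
abbreviation "P \<equiv> int p"

lemma prime_P: "prime P" using p by simp

lemma P_gt_1: "P > 1" using p prime_gt_1_nat by force

lemma quad_mat_mod: "mcong P (quad_mat s r (a mod P, b mod P)) (quad_mat s r (a, b))"
  unfolding quad_mat_def mcong_def
  by (auto intro!: cong_add cong_mult)

lemma quad_mat_mult: "mcong P (quad_mat s r (u \<otimes>\<^bsub>K\<^esub> v)) (quad_mat s r u * quad_mat s r v)"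
proof -
  obtain a b c d where [simp]: "u = (a, b)" "v = (c, d)" by (metis surj_pair)
  have "quad_mat s r (a * c + r * b * d, a * d + b * c + s * b * d) = quad_mat s r u * quad_mat s r v"
    by (simp add: quad_mat_def times_mat2_def algebra_simps)
  thus ?thesis using quad_mat_mod[of "a * c + r * b * d" "a * d + b * c + s * b * d"]
    by (simp add: quad_units_def)
qed

lemma quad_mat_one: "quad_mat s r \<one>\<^bsub>K\<^esub> = 1"
  by (simp add: quad_mat_def quad_units_def one_mat2_def)

lemma quad_mat_inj: "u \<in> carrier K \<Longrightarrow> v \<in> carrier K \<Longrightarrow> mcong P (quad_mat s r u) (quad_mat s r v) \<Longrightarrow> u = v"
  by (cases u; cases v) (auto simp: quad_mat_def quad_units_def mcong_def cong_def)

lemma quad_mat_inj': "u \<in> {0..<P} \<times> {0..<P} \<Longrightarrow> v \<in> {0..<P} \<times> {0..<P} \<Longrightarrow> mcong P (quad_mat s r u) (quad_mat s r v) \<Longrightarrow> u = v"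
  by (cases u; cases v) (auto simp: quad_mat_def mcong_def cong_def)

text \<open>
  The determinant is the norm form \<open>a\<^sup>2 + s a b - r b\<^sup>2\<close>. A nontrivial zero would give the root \<open>- a / b\<close> of the
  irreducible polynomial.
\<close>

lemma det2_quad_mat:
  assumes "P dvd det2 (quad_mat s r (a, b))"
  shows "P dvd a \<and> P dvd b"
proof -
  have d: "det2 (quad_mat s r (a, b)) = a * a + s * a * b - r * b * b"
    by (simp add: quad_mat_def det2_def algebra_simps)
  have b: "P dvd b"
  proof (rule ccontr)
    assume "\<not> P dvd b"
    hence "coprime b P" using prime_P by (metis coprime_commute prime_imp_coprime)
    then obtain e where e: "[b * e = 1] (mod P)" using cong_solve_coprime_int by blast
    \<comment> \<open>With \<open>e\<close> inverse to \<open>b\<close>, this is the root \<open>- a / b\<close>.\<close>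
    let ?x = "- (a * e)"
    have "[e * e * (a * a + s * a * b - r * b * b) = ?x * ?x - s * ?x * (b * e) * (-1) * (-1) - r * (b * e) * (b * e)] (mod P)"
      by (simp add: algebra_simps)
    also have "[?x * ?x - s * ?x * (b * e) * (-1) * (-1) - r * (b * e) * (b * e) = ?x * ?x - s * ?x * 1 * (-1) * (-1) - r * 1 * 1] (mod P)"
      by (intro cong_diff cong_mult cong_refl e)
    finally have "[e * e * (a * a + s * a * b - r * b * b) = ?x * ?x - s * ?x - r] (mod P)" by simp
    moreover have "P dvd e * e * (a * a + s * a * b - r * b * b)" using assms d by simp
    ultimately have "P dvd ?x * ?x - s * ?x - r" using cong_dvd_iff by blast
    thus False using irred by blast
  qed
  hence "P dvd s * a * b - r * b * b" by simp
  moreover have "P dvd a * a + (s * a * b - r * b * b)" using assms d by (simp add: algebra_simps)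
  ultimately have "P dvd a * a" using dvd_add_left_iff by blast
  thus ?thesis using b prime_P by (simp add: prime_dvd_mult_iff)
qed

lemma det2_carrier: "u \<in> carrier K \<Longrightarrow> \<not> P dvd det2 (quad_mat s r u)"
proof
  assume u: "u \<in> carrier K" "P dvd det2 (quad_mat s r u)"
  obtain a b where [simp]: "u = (a, b)" by (metis surj_pair)
  have "P dvd a" "P dvd b" using det2_quad_mat[of a b] u(2) by simp_all
  moreover have "0 \<le> a" "a < P" "0 \<le> b" "b < P" "a \<noteq> 0 \<or> b \<noteq> 0" using u by (auto simp: quad_units_def)
  ultimately show False using zdvd_not_zless[of a P] zdvd_not_zless[of b P] by linarith
qed

lemma range_mult: "u \<otimes>\<^bsub>K\<^esub> v \<in> {0..<P} \<times> {0..<P}"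
  using P_gt_1 by (cases u; cases v) (simp add: quad_units_def)

lemma carrierI: "u \<in> {0..<P} \<times> {0..<P} \<Longrightarrow> \<not> P dvd det2 (quad_mat s r u) \<Longrightarrow> u \<in> carrier K"
  by (auto simp: quad_units_def quad_mat_def det2_def)

text \<open>
  All laws are inherited from matrices, as an element is determined by its matrix. The adjugate provides inverses.
\<close>

lemma group_K: "group K"
proof (rule groupI)
  fix u v assume uv: "u \<in> carrier K" "v \<in> carrier K"
  have "[det2 (quad_mat s r (u \<otimes>\<^bsub>K\<^esub> v)) = det2 (quad_mat s r u) * det2 (quad_mat s r v)] (mod P)"
    using mcong_det2[OF quad_mat_mult[of u v]] by (simp add: det2_mult)
  hence "\<not> P dvd det2 (quad_mat s r (u \<otimes>\<^bsub>K\<^esub> v))"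
    using det2_carrier[OF uv(1)] det2_carrier[OF uv(2)] prime_P by (simp add: cong_dvd_iff prime_dvd_mult_iff)
  thus "u \<otimes>\<^bsub>K\<^esub> v \<in> carrier K" using range_mult by (intro carrierI)
next
  fix u v w assume "u \<in> carrier K" "v \<in> carrier K" "w \<in> carrier K"
  have 1: "mcong P (quad_mat s r (u \<otimes>\<^bsub>K\<^esub> v \<otimes>\<^bsub>K\<^esub> w)) (quad_mat s r u * quad_mat s r v * quad_mat s r w)"
    by (rule mcong_trans[OF quad_mat_mult mcong_mult_right[OF quad_mat_mult]])
  have 2: "mcong P (quad_mat s r (u \<otimes>\<^bsub>K\<^esub> (v \<otimes>\<^bsub>K\<^esub> w))) (quad_mat s r u * (quad_mat s r v * quad_mat s r w))"
    by (rule mcong_trans[OF quad_mat_mult mcong_mult_left[OF quad_mat_mult]])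
  show "u \<otimes>\<^bsub>K\<^esub> v \<otimes>\<^bsub>K\<^esub> w = u \<otimes>\<^bsub>K\<^esub> (v \<otimes>\<^bsub>K\<^esub> w)"
    by (rule quad_mat_inj'[OF range_mult range_mult mcong_trans[OF 1 mcong_sym[OF 2[folded mult.assoc]]]])
next
  fix u assume u: "u \<in> carrier K"
  obtain a b where [simp]: "u = (a, b)" by (metis surj_pair)
  have "coprime (det2 (quad_mat s r u)) P" using det2_carrier[OF u] prime_P by (metis coprime_commute prime_imp_coprime)
  then obtain e where e: "[det2 (quad_mat s r u) * e = 1] (mod P)" using cong_solve_coprime_int by blast
  let ?v = "(e * (a + s * b) mod P, - (e * b) mod P)"
  have "mcong P (quad_mat s r ?v) (scalar2 e * adj2 (quad_mat s r u))"
  proof -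
    have "quad_mat s r (e * (a + s * b), - (e * b)) = scalar2 e * adj2 (quad_mat s r u)"
      by (simp add: quad_mat_def times_mat2_def scalar2_def adj2_def algebra_simps)
    thus ?thesis using quad_mat_mod[of "e * (a + s * b)" "- (e * b)"] by simp
  qed
  hence "mcong P (quad_mat s r ?v * quad_mat s r u) (scalar2 e * adj2 (quad_mat s r u) * quad_mat s r u)"
    by (rule mcong_mult_right)
  also have "scalar2 e * adj2 (quad_mat s r u) * quad_mat s r u = scalar2 (det2 (quad_mat s r u) * e)"
    by (simp add: mult.assoc mult_adj2) (simp add: scalar2_def times_mat2_def)
  also have "mcong P \<dots> (scalar2 1)" by (rule mcong_scalar2[OF e])
  finally have vu: "mcong P (quad_mat s r ?v * quad_mat s r u) 1" by simp
  from mcong_det2[OF this] have "[det2 (quad_mat s r ?v) * det2 (quad_mat s r u) = 1] (mod P)"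
    by (simp add: det2_mult, simp add: det2_def one_mat2_def)
  hence "\<not> P dvd det2 (quad_mat s r ?v)"
    using prime_P by (metis cong_dvd_iff dvd_mult2 not_prime_unit)
  hence v: "?v \<in> carrier K" using P_gt_1 by (intro carrierI) auto
  have "\<one>\<^bsub>K\<^esub> \<in> {0..<P} \<times> {0..<P}" using P_gt_1 by (simp add: quad_units_def)
  hence "?v \<otimes>\<^bsub>K\<^esub> u = \<one>\<^bsub>K\<^esub>"
    using mcong_trans[OF quad_mat_mult vu] quad_mat_one by (intro quad_mat_inj' range_mult) auto
  thus "\<exists>y\<in>carrier K. y \<otimes>\<^bsub>K\<^esub> u = \<one>\<^bsub>K\<^esub>" using v by blast
next
  fix u assume u: "u \<in> carrier K"
  thus "\<one>\<^bsub>K\<^esub> \<otimes>\<^bsub>K\<^esub> u = u" by (cases u) (auto simp: quad_units_def)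
qed (use P_gt_1 in \<open>simp add: quad_units_def\<close>)

lemma order_K: "order K = (p - 1) * (p + 1)" and finite_K: "finite (carrier K)"
proof -
  have "card ({0..<P} \<times> {0..<P} - {(0, 0)}) = p * p - 1"
    using P_gt_1 by (subst card_Diff_singleton) (auto simp: card_cartesian_product)
  thus "order K = (p - 1) * (p + 1)" by (simp add: order_def quad_units_def algebra_simps diff_mult_distrib)
  show "finite (carrier K)" by (simp add: quad_units_def)
qed

lemma quad_mat_pow: "mcong P (quad_mat s r (u [^]\<^bsub>K\<^esub> (n::nat))) (quad_mat s r u ^ n)"
proof (induction n)
  case (Suc n)
  have "mcong P (quad_mat s r (u [^]\<^bsub>K\<^esub> n) * quad_mat s r u) (quad_mat s r u ^ n * quad_mat s r u)"
    by (rule mcong_mult_right[OF Suc])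
  from mcong_trans[OF quad_mat_mult this] show ?case by (simp add: power_commutes)
qed (simp add: quad_mat_one)

end

text \<open>
  The map \<open>x \<mapsto> x\<^sup>2 - x\<close> takes the value \<open>0\<close> twice, so it is not surjective modulo \<open>p\<close>; any \<open>r\<close> that is not a value works.
  This treats \<open>p = 2\<close> together with the odd primes.
\<close>

lemma irreducible_quadratic_exists:
  assumes p: "prime p"
  obtains r where "irreducible_quadratic p 1 r"
proof -
  let ?P = "int p"
  let ?f = "\<lambda>x::int. (x * x - x) mod ?P"
  have P: "?P > 1" using p prime_gt_1_nat by force
  have "\<not> inj_on ?f {0..<?P}"
  proof
    assume "inj_on ?f {0..<?P}"
    from inj_onD[OF this, of 0 1] show False using P by simp
  qed
  hence "card (?f ` {0..<?P}) \<noteq> card {0..<?P}" using inj_on_iff_eq_card[of "{0..<?P}" ?f] by simp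
  moreover have "?f ` {0..<?P} \<subseteq> {0..<?P}" using P by auto
  ultimately have "\<not> {0..<?P} \<subseteq> ?f ` {0..<?P}" using subset_antisym[of "?f ` {0..<?P}" "{0..<?P}"] by auto
  then obtain r where r: "r \<in> {0..<?P}" "r \<notin> ?f ` {0..<?P}" by (meson subsetI)
  have "\<not> ?P dvd x * x - 1 * x - r" for x
  proof
    assume "?P dvd x * x - 1 * x - r"
    hence "(x * x - x) mod ?P = r mod ?P" by (simp add: mod_eq_dvd_iff)
    moreover have "[(x mod ?P) * (x mod ?P) - x mod ?P = x * x - x] (mod ?P)"
      by (intro cong_diff cong_mult) auto
    hence "((x mod ?P) * (x mod ?P) - x mod ?P) mod ?P = (x * x - x) mod ?P" unfolding cong_def .
    ultimately have "r = ?f (x mod ?P)" using r by simp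
    moreover have "x mod ?P \<in> {0..<?P}" using P by simp
    ultimately show False using r(2) by blast
  qed
  thus ?thesis using that[of r] p by (simp add: irreducible_quadratic_def)
qed

text \<open>
  The unit group of the field with \<open>p\<^sup>2\<close> elements has order divisible by \<open>q\<close>, and by Sylow it has an element of order \<open>q\<close>.
\<close>

lemma matrix_of_order_exists:
  assumes p: "prime p" and q: "prime q" "q dvd p + 1"
  obtains A where "mcong (int p) (A ^ q) 1" "\<not> mcong (int p) A 1"
proof -
  obtain r where "irreducible_quadratic p 1 r" using irreducible_quadratic_exists[OF p] .
  then interpret irreducible_quadratic p 1 r .
  interpret K: group K by (rule group_K)
  obtain k where "order K = q ^ 1 * k" using q(2) order_K by (metis dvd_def dvd_mult power_one_right)
  then obtain Q where Q: "subgroup Q K" "card Q = q ^ 1" using sylow_thm[OF q(1) group_K _ finite_K] by blast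
  have "finite Q" using finite_subset[OF subgroup.subset[OF Q(1)] finite_K] .
  then obtain c where c: "c \<in> Q" "K.ord c = q" using K.subgroup_prime_generator[OF Q(1) _ q(1)] Q(2) by auto
  have cK: "c \<in> carrier K" using subgroup.mem_carrier[OF Q(1) c(1)] .
  have "c [^]\<^bsub>K\<^esub> q = \<one>\<^bsub>K\<^esub>" using K.pow_ord_eq_1[OF cK] c by simp
  hence "mcong (int p) 1 (quad_mat 1 r c ^ q)" using quad_mat_pow[of c q] quad_mat_one by simp
  moreover have "\<not> mcong (int p) (quad_mat 1 r c) 1"
  proof
    assume "mcong (int p) (quad_mat 1 r c) 1"
    hence "c = \<one>\<^bsub>K\<^esub>" using quad_mat_inj[OF cK K.one_closed] quad_mat_one by simp
    thus False using c q(1) K.ord_eq_1[OF cK] by auto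
  qed
  ultimately show ?thesis using that mcong_sym by blast
qed

text \<open>
  An eigenvalue \<open>x\<close> of the companion matrix \<open>C\<close> would be a \<open>q\<close>-th root of unity, hence \<open>1\<close>, and \<open>C\<close> would be unipotent. So
  \<open>X\<^sup>2 - t X + 1\<close> is irreducible, and \<open>C\<close> is an element of order \<open>q\<close> in a unit group of order \<open>(p - 1) (p + 1)\<close>.
\<close>

lemma companion_order_dvd:
  assumes p: "prime p" and q: "prime q" "q \<noteq> p" "\<not> q dvd p - 1"
    and root1: "\<And>x. [x ^ q = 1] (mod int p) \<Longrightarrow> [x = 1] (mod int p)"
    and C: "mcong (int p) (companion t ^ q) 1"
  shows "q dvd p + 1"
proof -
  have P: "prime (int p)" using p by simp
  have pq: "\<not> int p dvd int q" using p q by (metis int_dvd_int_iff primes_dvd_imp_eq)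
  have irr: "\<not> int p dvd x * x - t * x - (- 1)" for x
  proof
    assume x: "int p dvd x * x - t * x - (- 1)"
    have xx: "[1 - t * x = - (x * x)] (mod int p)"
      using x by (simp add: cong_iff_dvd_diff algebra_simps)
    \<comment> \<open>The first column of \<open>V\<close> is an eigenvector of the companion matrix for the eigenvalue \<open>x\<close>.\<close>
    let ?V = "Mat2 1 0 (- x) 0"
    have CV: "mcong (int p) (companion t * ?V) (?V * scalar2 x)"
      using xx by (simp add: mcong_def companion_def scalar2_def times_mat2_def algebra_simps)
    have pw: "mcong (int p) (companion t ^ n * ?V) (?V * scalar2 x ^ n)" for n
    proof (induction n)
      case (Suc n)
      have "mcong (int p) (companion t * (companion t ^ n * ?V)) (companion t * (?V * scalar2 x ^ n))"
        by (rule mcong_mult_left[OF Suc])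
      also have "companion t * (?V * scalar2 x ^ n) = (companion t * ?V) * scalar2 x ^ n" by (simp add: mult.assoc)
      also have "mcong (int p) \<dots> ((?V * scalar2 x) * scalar2 x ^ n)" by (rule mcong_mult_right[OF CV])
      finally show ?case by (simp add: mult.assoc)
    qed simp
    have "scalar2 x ^ q = scalar2 (x ^ q)" using diag2_power[of x x q] by (simp add: diag2_def scalar2_def)
    hence "mcong (int p) (1 * ?V) (?V * scalar2 (x ^ q))"
      using mcong_trans[OF mcong_mult_right[OF mcong_sym[OF C]] pw[of q]] by simp
    hence "[x ^ q = 1] (mod int p)"
      by (auto simp: mcong_def scalar2_def times_mat2_def one_mat2_def cong_sym)
    hence x1: "[x = 1] (mod int p)" by (rule root1)
    have "[x * x - t * x - (- 1) = 1 * 1 - t * 1 - (- 1)] (mod int p)"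
      by (intro cong_diff cong_mult x1 cong_refl)
    hence "int p dvd 2 - t" using x by (simp add: cong_dvd_iff)
    hence "[tr2 (companion t) = 2] (mod int p)" by (simp add: cong_iff_dvd_diff dvd_diff_commute)
    from unipotent_order[OF P pq C _ this] have "mcong (int p) (companion t) 1" by simp
    thus False using not_mcong_companion_1[OF P q(1) pq root1] by blast
  qed
  interpret irreducible_quadratic p t "- 1"
    using irr p by (simp add: irreducible_quadratic_def)
  interpret K: group K by (rule group_K)
  have X: "(0, 1) \<in> carrier K" using P_gt_1 by (simp add: quad_units_def)
  have mX: "quad_mat t (- 1) (0, 1) = companion t" by (simp add: quad_mat_def companion_def)
  have "mcong (int p) (quad_mat t (- 1) ((0, 1) [^]\<^bsub>K\<^esub> q)) (quad_mat t (- 1) \<one>\<^bsub>K\<^esub>)"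
    unfolding quad_mat_one using mcong_trans[OF quad_mat_pow] C mX by metis
  hence "(0, 1) [^]\<^bsub>K\<^esub> q = \<one>\<^bsub>K\<^esub>" using quad_mat_inj K.nat_pow_closed[OF X] K.one_closed by blast
  hence "K.ord (0, 1) dvd q" using K.pow_eq_id[OF X] by simp
  moreover have "K.ord (0, 1) \<noteq> 1" using K.ord_eq_1[OF X] by (simp add: quad_units_def)
  ultimately have "K.ord (0, 1) = q" using q(1) by (metis prime_nat_iff)
  hence "q dvd (p - 1) * (p + 1)" using K.ord_dvd_group_order[OF X] order_K by simp
  hence "q dvd p - 1 \<or> q dvd p + 1" using prime_dvd_mult_iff q(1) by blast
  thus ?thesis using q by blast
qed

lemma square_bounds:
  assumes "p > (1::nat)" shows "p\<^sup>2 > 1" "p\<^sup>2 > 0" "p < p\<^sup>2"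
  using assms one_less_power[of p 2] power_strict_increasing[of 1 2 p] by auto

section \<open>The actions that occur\<close>

definition scalar_map :: "nat \<Rightarrow> nat \<Rightarrow> int \<Rightarrow> int" where
  "scalar_map m a x = int a * x mod int m"

definition matrix_map :: "int \<Rightarrow> mat2 \<Rightarrow> int \<times> int \<Rightarrow> int \<times> int" where
  "matrix_map p A = (\<lambda>(x, y). ((m11 A * x + m12 A * y) mod p, (m21 A * x + m22 A * y) mod p))"

definition second_map :: "nat \<Rightarrow> nat \<Rightarrow> int \<times> int \<Rightarrow> int \<times> int" where
  "second_map q a = (\<lambda>(x, y). (x, int a * y mod int q))"

subsection \<open>Scalar actions on a cyclic group\<close>

lemma funpow_scalar:
  assumes \<alpha>: "\<And>x. x \<in> {0..<int m} \<Longrightarrow> \<alpha> x = int a * x mod int m" and m: "m > 0" and x: "x \<in> {0..<int m}"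
  shows "(\<alpha> ^^ i) x = int (a ^ i) * x mod int m"
proof (induction i)
  case (Suc i)
  have "(\<alpha> ^^ Suc i) x = int a * (int (a ^ i) * x mod int m) mod int m" using m by (simp add: Suc \<alpha> del: of_nat_power)
  thus ?case by (simp add: mod_simps mult.assoc)
qed (use x in auto)

lemma cyclic_action_scalar:
  assumes m: "m > 0" and n: "n > 0" and a: "[a ^ n = 1] (mod m)"
  shows "cyclic_action (integer_mod_group m) (scalar_map m a) n"
proof -
  have "(scalar_map m a ^^ n) x = x" if "x \<in> carrier (integer_mod_group m)" for x
  proof -
    have x: "x \<in> {0..<int m}" using that m by (simp add: carrier_integer_mod_group)
    have "(scalar_map m a ^^ n) x = int (a ^ n) * x mod int m"
      by (rule funpow_scalar[OF _ m x]) (simp add: scalar_map_def)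
    also have "[int (a ^ n) * x = int 1 * x] (mod int m)"
      using a by (intro cong_mult cong_refl) (simp only: cong_int_iff)
    hence "int (a ^ n) * x mod int m = x mod int m" by (simp add: cong_def)
    finally show ?thesis using x by simp
  qed
  moreover have "scalar_map m a \<in> hom (integer_mod_group m) (integer_mod_group m)"
    using m by (intro homI) (auto simp: scalar_map_def carrier_integer_mod_group mod_simps algebra_simps)
  ultimately show ?thesis using n by (simp add: cyclic_action_def cyclic_action_axioms_def)
qed

lemma action_is_scalar:
  assumes act: "cyclic_action (integer_mod_group m) \<alpha> n" and m: "m > 1"
  obtains a where "[a ^ n = 1] (mod m)" "\<And>x. x \<in> carrier (integer_mod_group m) \<Longrightarrow> \<alpha> x = scalar_map m a x"
proof -
  interpret cyclic_action "integer_mod_group m" \<alpha> n by fact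
  interpret h: group_hom "integer_mod_group m" "integer_mod_group m" \<alpha> by unfold_locales (rule hom)
  have one: "1 \<in> carrier (integer_mod_group m)" using m by simp
  have r: "\<alpha> 1 \<in> {0..<int m}" using closed[OF one] m by (simp add: carrier_integer_mod_group)
  define a where "a = nat (\<alpha> 1)"
  have a: "\<alpha> 1 = int a" using r by (simp add: a_def)
  have eq: "\<alpha> x = int a * x mod int m" if "x \<in> {0..<int m}" for x
  proof -
    have "x = 1 [^]\<^bsub>integer_mod_group m\<^esub> nat x" using that by simp
    hence "\<alpha> x = \<alpha> 1 [^]\<^bsub>integer_mod_group m\<^esub> nat x" using h.hom_nat_pow[OF one, of "nat x"] by simp
    thus ?thesis using that a by (simp add: mult.commute)
  qed
  have "(\<alpha> ^^ n) 1 = int (a ^ n) * 1 mod int m" using m by (intro funpow_scalar eq) auto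
  hence "int (a ^ n) mod int m = 1" using period[OF one] by simp
  hence "[int (a ^ n) = int 1] (mod int m)" using m by (simp add: cong_def)
  hence "[a ^ n = 1] (mod m)" by (simp only: cong_int_iff)
  moreover have "\<alpha> x = scalar_map m a x" if "x \<in> carrier (integer_mod_group m)" for x
    using eq[of x] that m by (simp add: scalar_map_def carrier_integer_mod_group)
  ultimately show ?thesis using that by blast
qed

definition split_cyclic :: "nat \<Rightarrow> nat \<Rightarrow> nat \<Rightarrow> (int \<times> nat) monoid" where
  "split_cyclic m a n = semidirect (integer_mod_group m) (scalar_map m a) n"

text \<open>
  Only the values of the action on the carrier matter.
\<close>

lemma semidirect_cong_iso:
  assumes act: "cyclic_action N \<alpha> n" "cyclic_action N \<beta> n" and fin: "finite (carrier N)"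
    and eq: "\<And>x. x \<in> carrier N \<Longrightarrow> \<alpha> x = \<beta> x"
  shows "semidirect N \<beta> n \<cong> semidirect N \<alpha> n"
  by (rule semidirect_isoI[OF act(2,1) fin iso_set_refl, of 1]) (simp_all add: eq)

lemma split_cyclic_iso:
  assumes m: "m > 0" and n: "n > 0" and a: "[a ^ n = 1] (mod m)" and b: "[b = a ^ k] (mod m)" "coprime k n"
  shows "split_cyclic m b n \<cong> split_cyclic m a n"
proof -
  have bn: "[b ^ n = 1] (mod m)"
  proof -
    have "[b ^ n = (a ^ k) ^ n] (mod m)" by (intro cong_pow b)
    also have "(a ^ k) ^ n = (a ^ n) ^ k" by (simp add: power_mult[symmetric] mult.commute)
    also have "[\<dots> = 1 ^ k] (mod m)" by (intro cong_pow a)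
    finally show ?thesis by simp
  qed
  show ?thesis unfolding split_cyclic_def
  proof (rule semidirect_isoI[OF cyclic_action_scalar[OF m n bn] cyclic_action_scalar[OF m n a] _ iso_set_refl b(2)])
    fix x assume "x \<in> carrier (integer_mod_group m)"
    hence x: "x \<in> {0..<int m}" using m by (simp add: carrier_integer_mod_group)
    have "(scalar_map m a ^^ k) x = int (a ^ k) * x mod int m"
      by (rule funpow_scalar[OF _ m x]) (simp add: scalar_map_def)
    moreover have "[int b * x = int (a ^ k) * x] (mod int m)"
      using b by (intro cong_mult cong_refl) (simp only: cong_int_iff)
    ultimately show "scalar_map m b x = (scalar_map m a ^^ k) x" by (simp add: scalar_map_def cong_def)
  qed (use m in auto)
qed

lemma split_cyclic_group:
  assumes m: "m > 0" and n: "n > 0" and a: "[a ^ n = 1] (mod m)"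
  shows "group (split_cyclic m a n)" "finite (carrier (split_cyclic m a n))"
    "order (split_cyclic m a n) = m * n"
proof -
  interpret cyclic_action "integer_mod_group m" "scalar_map m a" n by (rule cyclic_action_scalar[OF assms])
  show "group (split_cyclic m a n)" "finite (carrier (split_cyclic m a n))"
    "order (split_cyclic m a n) = m * n"
    unfolding split_cyclic_def using group_semidirect finite_semidirect order_semidirect m by simp_all
qed

lemma scalar_map_eq_id:
  assumes "m > 1"
  shows "(\<forall>x\<in>carrier (integer_mod_group m). scalar_map m a x = x) \<longleftrightarrow> [a = 1] (mod m)"
proof
  assume *: "\<forall>x\<in>carrier (integer_mod_group m). scalar_map m a x = x"
  have "1 \<in> carrier (integer_mod_group m)" using assms by simp
  with * have "scalar_map m a 1 = 1" by blast
  hence "int a mod int m = 1" by (simp add: scalar_map_def)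
  hence "[int a = int 1] (mod int m)" using assms by (simp add: cong_def)
  thus "[a = 1] (mod m)" by (simp only: cong_int_iff)
next
  assume a: "[a = 1] (mod m)"
  show "\<forall>x\<in>carrier (integer_mod_group m). scalar_map m a x = x"
  proof
    fix x assume x: "x \<in> carrier (integer_mod_group m)"
    have "[int a * x = int 1 * x] (mod int m)"
      using a by (intro cong_mult cong_refl) (simp only: cong_int_iff)
    thus "scalar_map m a x = x" using x assms by (simp add: scalar_map_def cong_def carrier_integer_mod_group)
  qed
qed

lemma comm_split_cyclic:
  assumes m: "m > 1" and n: "n > 1" and a: "[a ^ n = 1] (mod m)"
  shows "comm_group (split_cyclic m a n) \<longleftrightarrow> [a = 1] (mod m)"
proof -
  interpret cyclic_action "integer_mod_group m" "scalar_map m a" n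
    using m n by (intro cyclic_action_scalar a) auto
  show ?thesis unfolding split_cyclic_def scalar_map_eq_id[OF m, symmetric]
    using comm_groupD[OF _ n] comm_groupI[OF abelian_integer_mod_group] by blast
qed

lemma torsion_closed_split_cyclic:
  assumes m: "m > 0" and n: "n > 0" and a: "[a ^ n = 1] (mod m)" and "coprime m n"
  shows "torsion_closed m (split_cyclic m a n)"
proof -
  interpret cyclic_action "integer_mod_group m" "scalar_map m a" n by (rule cyclic_action_scalar[OF m n a])
  show ?thesis unfolding split_cyclic_def using torsion_closed_card assms by simp
qed

lemma torsion_closed_split_cyclicD:
  assumes m: "m > 1" and n: "n > 1" and a: "[a ^ n = 1] (mod m)" and cop: "coprime m n"
    and tc: "torsion_closed n (split_cyclic m a n)"
  shows "[a = 1] (mod m)"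
proof -
  interpret cyclic_action "integer_mod_group m" "scalar_map m a" n
    using m n by (intro cyclic_action_scalar a) auto
  have one: "1 \<in> carrier (integer_mod_group m)" using m by simp
  have r: "scalar_map m a 1 \<in> carrier (integer_mod_group m)" using closed[OF one] .
  have "int n * ((1 + (- scalar_map m a 1) mod int m) mod int m) mod int m = 0"
    using torsion_closedD[OF tc[unfolded split_cyclic_def] dvd_refl n one] r by simp
  moreover have "[int n * ((1 + (- scalar_map m a 1) mod int m) mod int m) = int n * (1 - int a)] (mod int m)"
    by (simp add: cong_def scalar_map_def mod_simps)
  ultimately have "int m dvd int n * (1 - int a)" by (simp add: cong_def mod_eq_0_iff_dvd)
  hence "int m dvd 1 - int a" using cop by (simp add: coprime_dvd_mult_right_iff)
  hence "[int 1 = int a] (mod int m)" by (simp add: cong_iff_dvd_diff)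
  thus ?thesis by (simp only: cong_int_iff cong_sym)
qed

lemma split_cyclic_elem_left:
  assumes n: "n > 0" and p: "p > 1" and a: "[a ^ n = 1] (mod p\<^sup>2)"
  shows "has_elem_order_square p (split_cyclic (p\<^sup>2) a n)"
proof -
  have m: "p\<^sup>2 > 1" "p\<^sup>2 > 0" "p < p\<^sup>2" using square_bounds[OF p] by auto
  interpret cyclic_action "integer_mod_group (p\<^sup>2)" "scalar_map (p\<^sup>2) a" n by (rule cyclic_action_scalar[OF m(2) n a])
  have one: "1 \<in> carrier (integer_mod_group (p\<^sup>2))" using m p by simp
  show ?thesis unfolding split_cyclic_def has_elem_order_square_def
  proof (intro bexI[of _ "(1, 0)"] conjI)
    show "(1, 0) [^]\<^bsub>semidirect (integer_mod_group (p\<^sup>2)) (scalar_map (p\<^sup>2) a) n\<^esub> p\<^sup>2 =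
        \<one>\<^bsub>semidirect (integer_mod_group (p\<^sup>2)) (scalar_map (p\<^sup>2) a) n\<^esub>"
      using pow_fst[OF one, of "p\<^sup>2"] by (simp add: one_semidirect)
    have "int p mod int (p\<^sup>2) = int p" using m by (intro mod_pos_pos_trivial) (auto simp del: of_nat_power)
    thus "(1, 0) [^]\<^bsub>semidirect (integer_mod_group (p\<^sup>2)) (scalar_map (p\<^sup>2) a) n\<^esub> p \<noteq>
        \<one>\<^bsub>semidirect (integer_mod_group (p\<^sup>2)) (scalar_map (p\<^sup>2) a) n\<^esub>"
      using pow_fst[OF one, of p] p by (simp add: one_semidirect)
  qed (use one n in \<open>simp add: carrier_semidirect\<close>)
qed

lemma split_cyclic_elem_right:
  assumes m: "m > 0" and p: "p > 1" and a: "[a ^ p\<^sup>2 = 1] (mod m)"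
  shows "has_elem_order_square p (split_cyclic m a (p\<^sup>2))"
proof -
  have n: "p\<^sup>2 > 1" "p\<^sup>2 > 0" "p < p\<^sup>2" using square_bounds[OF p] by auto
  interpret cyclic_action "integer_mod_group m" "scalar_map m a" "p\<^sup>2" by (rule cyclic_action_scalar[OF m n(2) a])
  show ?thesis unfolding split_cyclic_def has_elem_order_square_def
    using pow_complement[of 1 "p\<^sup>2"] pow_complement[of 1 p] n m p
    by (intro bexI[of _ "(0, 1)"]) (auto simp: carrier_semidirect one_semidirect)
qed

lemma split_cyclic_nontrivial_centre:
  assumes m: "m > 1" and p: "p > 1" and a: "[a ^ p = 1] (mod m)"
  shows "nontrivial_centre (split_cyclic m a (p\<^sup>2))"
proof -
  have n: "p\<^sup>2 > 1" "p\<^sup>2 > 0" "p < p\<^sup>2" using square_bounds[OF p] by auto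
  have a2: "[a ^ p\<^sup>2 = 1] (mod m)" using cong_pow[OF a, of p] by (simp add: power2_eq_square power_mult)
  have m0: "m > 0" using m by simp
  interpret cyclic_action "integer_mod_group m" "scalar_map m a" "p\<^sup>2"
    by (rule cyclic_action_scalar[OF m0 n(2) a2])
  interpret P: cyclic_action "integer_mod_group m" "scalar_map m a" p
    using p by (intro cyclic_action_scalar[OF m0 _ a]) simp
  have "(0, p) \<otimes>\<^bsub>semidirect (integer_mod_group m) (scalar_map m a) (p\<^sup>2)\<^esub> (x, i) =
      (x, i) \<otimes>\<^bsub>semidirect (integer_mod_group m) (scalar_map m a) (p\<^sup>2)\<^esub> (0, p)"
    if "x \<in> carrier (integer_mod_group m)" for x i
    using that P.period[OF that] funpow_one[of i] m0
    by (simp add: mult_semidirect carrier_integer_mod_group add.commute)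
  thus ?thesis unfolding split_cyclic_def nontrivial_centre_def
    using n p m by (intro bexI[of _ "(0, p)"]) (auto simp: carrier_semidirect one_semidirect)
qed

text \<open>
  A central element \<open>(x, i)\<close> commutes with the normal subgroup, so \<open>a\<^sup>i = 1\<close> and \<open>i = 0\<close> as the action is faithful. Then \<open>x\<close> is
  fixed by the multiplication with \<open>a \<noteq> 1\<close>, so \<open>x = 0\<close>.
\<close>

lemma split_cyclic_centre_trivial:
  assumes m: "prime m" and p: "prime p" and a: "[a ^ p\<^sup>2 = 1] (mod m)" and np: "\<not> [a ^ p = 1] (mod m)"
  shows "\<not> nontrivial_centre (split_cyclic m a (p\<^sup>2))"
proof
  have pm: "p > 1" "m > 1" "m > 0" using p m prime_gt_1_nat prime_gt_0_nat by auto
  have n: "p\<^sup>2 > 1" "p\<^sup>2 > 0" using square_bounds[OF pm(1)] by auto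
  interpret cyclic_action "integer_mod_group m" "scalar_map m a" "p\<^sup>2"
    by (rule cyclic_action_scalar[OF pm(3) n(2) a])
  let ?G = "semidirect (integer_mod_group m) (scalar_map m a) (p\<^sup>2)"
  assume "nontrivial_centre (split_cyclic m a (p\<^sup>2))"
  then obtain z where z: "z \<in> carrier ?G" "z \<noteq> \<one>\<^bsub>?G\<^esub>" "\<And>x. x \<in> carrier ?G \<Longrightarrow> z \<otimes>\<^bsub>?G\<^esub> x = x \<otimes>\<^bsub>?G\<^esub> z"
    unfolding split_cyclic_def nontrivial_centre_def by blast
  obtain x i where [simp]: "z = (x, i)" by (metis surj_pair)
  have xi: "x \<in> {0..<int m}" "i < p\<^sup>2" using z pm by (auto simp: carrier_semidirect carrier_integer_mod_group)
  have "(1, 0) \<in> carrier ?G" "(0, 1) \<in> carrier ?G" using pm n by (auto simp: carrier_semidirect)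
  note c = z(3)[OF this(1)] z(3)[OF this(2)]
  have fp: "(scalar_map m a ^^ i) 1 = int (a ^ i) * 1 mod int m"
    by (rule funpow_scalar) (use pm in \<open>auto simp: scalar_map_def\<close>)
  have "(x + int (a ^ i)) mod int m = (1 + x) mod int m"
    using c(1) fp by (simp add: mult_semidirect mod_simps)
  hence "[int (a ^ i) + x = int 1 + x] (mod int m)" by (simp add: cong_def add.commute)
  hence "[int (a ^ i) = int 1] (mod int m)" using cong_add_rcancel by blast
  hence "[a ^ i = 1] (mod m)" by (simp only: cong_int_iff)
  hence di: "ord m a dvd i" by (rule iffD1[OF ord_divides])
  have "ord m a dvd p\<^sup>2" using a by (rule iffD1[OF ord_divides])
  then obtain j where j: "j \<le> 2" "ord m a = p ^ j" using divides_primepow_nat[OF p] by auto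
  have "j = 2"
  proof (rule ccontr)
    assume "j \<noteq> 2"
    hence "p ^ j dvd p ^ 1" using j by (intro le_imp_power_dvd) auto
    hence "[a ^ p = 1] (mod m)" using j by (intro iffD2[OF ord_divides]) simp
    thus False using np by simp
  qed
  hence i: "i = 0" using di j xi by (auto dest: dvd_imp_le)
  have "x mod int m = (scalar_map m a x) mod int m"
    using c(2) i by (simp add: mult_semidirect)
  hence "[1 * x = int a * x] (mod int m)" by (simp add: scalar_map_def cong_def)
  hence "int m dvd (1 - int a) * x" by (simp add: cong_iff_dvd_diff left_diff_distrib)
  hence "int m dvd 1 - int a \<or> int m dvd x" using m by (simp add: prime_dvd_mult_iff)
  thus False
  proof
    assume "int m dvd 1 - int a"
    hence "[int 1 = int a] (mod int m)" by (simp add: cong_iff_dvd_diff)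
    hence "[a = 1] (mod m)" by (simp only: cong_int_iff cong_sym)
    hence "[a ^ p = 1] (mod m)" using cong_pow[of a 1 m p] by simp
    thus False using np by simp
  next
    assume "int m dvd x"
    hence "x = 0" using xi zdvd_not_zless[of x "int m"] by fastforce
    thus False using z(2) i by (simp add: one_semidirect)
  qed
qed

subsection \<open>Matrix actions on a product of two cyclic groups of prime order\<close>

lemma linear_mod: "(a * (s mod p) + b * (t mod p)) mod p = (a * s + b * t) mod (p::int)"
  by (rule mod_add_cong) (simp_all add: mod_mult_right_eq)

lemma matrix_map_mult: "matrix_map p A (matrix_map p B u) = matrix_map p (A * B) u"
proof -
  obtain x y where [simp]: "u = (x, y)" by (metis surj_pair)
  show ?thesis by (simp add: matrix_map_def times_mat2_def linear_mod) (simp add: algebra_simps)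
qed

lemma matrix_map_mcong: "mcong p A B \<Longrightarrow> matrix_map p A u = matrix_map p B u"
  by (cases u) (auto simp: matrix_map_def mcong_def simp flip: cong_def intro!: cong_add cong_mult)

lemma matrix_map_1: "u \<in> {0..<p} \<times> {0..<p} \<Longrightarrow> matrix_map p 1 u = u"
  by (auto simp: matrix_map_def one_mat2_def)

lemma matrix_map_1_carrier: "p > 0 \<Longrightarrow> u \<in> carrier (cyclic_pair p p) \<Longrightarrow> matrix_map (int p) 1 u = u"
  by (intro matrix_map_1) (simp add: carrier_integer_mod_group)

lemma matrix_map_eqD:
  assumes "matrix_map p A (1, 0) = matrix_map p B (1, 0)" "matrix_map p A (0, 1) = matrix_map p B (0, 1)"
  shows "mcong p A B"
  using assms by (simp add: matrix_map_def mcong_def cong_def)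

lemma matrix_map_hom: "p > 0 \<Longrightarrow> matrix_map (int p) A \<in> hom (cyclic_pair p p) (cyclic_pair p p)"
proof (rule homI)
  fix u v assume p: "p > 0"
  obtain x y x' y' :: int where [simp]: "u = (x, y)" "v = (x', y')" by (metis surj_pair)
  have *: "(a * ((x + x') mod P) + b * ((y + y') mod P)) mod P = ((a * x + b * y) mod P + (a * x' + b * y') mod P) mod P"
    for a b P by (simp only: linear_mod mod_add_eq) (simp add: algebra_simps)
  show "matrix_map (int p) A (u \<otimes>\<^bsub>cyclic_pair p p\<^esub> v) = matrix_map (int p) A u \<otimes>\<^bsub>cyclic_pair p p\<^esub> matrix_map (int p) A v"
    by (simp add: matrix_map_def *)
qed (auto simp: matrix_map_def carrier_integer_mod_group)

lemma funpow_matrix: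
  assumes \<alpha>: "\<And>u. u \<in> carrier (cyclic_pair p p) \<Longrightarrow> \<alpha> u = matrix_map (int p) A u" and p: "p > 0"
    and u: "u \<in> carrier (cyclic_pair p p)"
  shows "(\<alpha> ^^ i) u = matrix_map (int p) (A ^ i) u"
proof (induction i)
  case 0
  show ?case using u p matrix_map_1_carrier by simp
next
  case (Suc i)
  have "matrix_map (int p) (A ^ i) u \<in> carrier (cyclic_pair p p)"
    using matrix_map_hom[OF p] u by (auto simp: hom_def)
  thus ?case using Suc \<alpha> by (simp add: matrix_map_mult)
qed

lemma funpow_matrix_map:
  "p > 0 \<Longrightarrow> u \<in> carrier (cyclic_pair p p) \<Longrightarrow>
     (matrix_map (int p) A ^^ i) u = matrix_map (int p) (A ^ i) u"
  using funpow_matrix[of p "matrix_map (int p) A" A u i] by simp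

lemma hom_is_matrix:
  assumes \<theta>: "\<theta> \<in> hom (cyclic_pair p p) (cyclic_pair p p)" and p: "p > 1"
  shows "\<exists>A. \<forall>u\<in>carrier (cyclic_pair p p). \<theta> u = matrix_map (int p) A u"
proof -
  interpret h: group_hom "cyclic_pair p p" "cyclic_pair p p" \<theta>
    by (simp add: group_hom_def group_hom_axioms_def \<theta>)
  obtain a c where ac: "\<theta> (1, 0) = (a, c)" by (metis surj_pair)
  obtain b d where bd: "\<theta> (0, 1) = (b, d)" by (metis surj_pair)
  have e: "(1, 0) \<in> carrier (cyclic_pair p p)" "(0, 1) \<in> carrier (cyclic_pair p p)" using p by auto
  have pw: "(s, t) [^]\<^bsub>cyclic_pair p p\<^esub> (k::nat) = (int k * s mod int p, int k * t mod int p)" for s t k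
    by (induction k) (auto simp: mod_simps algebra_simps)
  have "\<theta> u = matrix_map (int p) (Mat2 a b c d) u" if u: "u \<in> carrier (cyclic_pair p p)" for u
  proof -
    obtain x y where [simp]: "u = (x, y)" by (metis surj_pair)
    have xy: "x \<in> {0..<int p}" "y \<in> {0..<int p}" using u p by (auto simp: carrier_integer_mod_group)
    have "u = (1, 0) [^]\<^bsub>cyclic_pair p p\<^esub> nat x \<otimes>\<^bsub>cyclic_pair p p\<^esub> (0, 1) [^]\<^bsub>cyclic_pair p p\<^esub> nat y"
      using xy by (simp add: pw)
    also have "\<theta> \<dots> = \<theta> (1, 0) [^]\<^bsub>cyclic_pair p p\<^esub> nat x \<otimes>\<^bsub>cyclic_pair p p\<^esub> \<theta> (0, 1) [^]\<^bsub>cyclic_pair p p\<^esub> nat y"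
      using e by (simp only: h.hom_mult h.hom_nat_pow h.G.nat_pow_closed)
    also have "\<dots> = matrix_map (int p) (Mat2 a b c d) u"
      using xy unfolding ac bd pw by (simp add: matrix_map_def mod_simps mult.commute)
    finally show ?thesis .
  qed
  thus ?thesis by blast
qed

lemma matrix_map_iso:
  assumes p: "prime p" and T: "\<not> int p dvd det2 T"
  shows "matrix_map (int p) T \<in> iso (cyclic_pair p p) (cyclic_pair p p)"
proof -
  have p0: "p > 0" and P: "prime (int p)" using p prime_gt_0_nat by auto
  obtain T' where T': "mcong (int p) (T * T') 1" "mcong (int p) (T' * T) 1" using mat2_inverse_mod[OF P T] .
  have cl: "matrix_map (int p) A u \<in> carrier (cyclic_pair p p)" if "u \<in> carrier (cyclic_pair p p)" for A u
    using matrix_map_hom[OF p0] that by (auto simp: hom_def)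
  have id: "matrix_map (int p) A u = u" if "mcong (int p) A 1" "u \<in> carrier (cyclic_pair p p)" for A u
    using matrix_map_mcong[OF that(1), of u] matrix_map_1_carrier[OF p0 that(2)] by simp
  have "bij_betw (matrix_map (int p) T) (carrier (cyclic_pair p p)) (carrier (cyclic_pair p p))"
    by (rule bij_betw_byWitness[where f' = "matrix_map (int p) T'"])
      (use cl id[OF T'(1)] id[OF T'(2)] in \<open>auto simp only: matrix_map_mult image_subset_iff\<close>)
  thus ?thesis using matrix_map_hom[OF p0] by (auto simp: iso_def)
qed

lemma iso_is_matrix:
  assumes p: "prime p" and \<theta>: "\<theta> \<in> iso (cyclic_pair p p) (cyclic_pair p p)"
  shows "\<exists>T. \<not> int p dvd det2 T \<and> (\<forall>u\<in>carrier (cyclic_pair p p). \<theta> u = matrix_map (int p) T u)"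
proof -
  have p1: "p > 1" and P: "prime (int p)" using p prime_gt_1_nat by auto
  have \<theta>': "inv_into (carrier (cyclic_pair p p)) \<theta> \<in> iso (cyclic_pair p p) (cyclic_pair p p)"
    using group.iso_set_sym[OF group_cyclic_pair \<theta>] .
  obtain T where T: "\<And>u. u \<in> carrier (cyclic_pair p p) \<Longrightarrow> \<theta> u = matrix_map (int p) T u"
    using hom_is_matrix[OF _ p1, of \<theta>] \<theta> by (auto simp: iso_def)
  obtain S where S: "\<And>u. u \<in> carrier (cyclic_pair p p) \<Longrightarrow> inv_into (carrier (cyclic_pair p p)) \<theta> u = matrix_map (int p) S u"
    using hom_is_matrix[OF _ p1, of "inv_into (carrier (cyclic_pair p p)) \<theta>"] \<theta>' unfolding iso_def by blast
  have e: "(1, 0) \<in> carrier (cyclic_pair p p)" "(0, 1) \<in> carrier (cyclic_pair p p)" using p1 by auto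
  have "matrix_map (int p) (S * T) u = u" if u: "u \<in> carrier (cyclic_pair p p)" for u
  proof -
    have bij: "bij_betw \<theta> (carrier (cyclic_pair p p)) (carrier (cyclic_pair p p))" using \<theta> by (auto simp: iso_def)
    have "\<theta> u \<in> carrier (cyclic_pair p p)" using bij u by (auto simp: bij_betw_def)
    hence "matrix_map (int p) S (\<theta> u) = u"
      using S[of "\<theta> u"] bij_betw_inv_into_left[OF bij u] by simp
    thus ?thesis using T[OF u] by (simp add: matrix_map_mult)
  qed
  hence "matrix_map (int p) (S * T) u = matrix_map (int p) 1 u" if "u \<in> carrier (cyclic_pair p p)" for u
    using matrix_map_1_carrier[of p u] that p1 by simp
  hence "mcong (int p) (S * T) 1" using e by (intro matrix_map_eqD) blast+
  from mcong_det2[OF this] have "[det2 S * det2 T = 1] (mod int p)" by (simp add: det2_mult, simp add: det2_def one_mat2_def)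
  hence "\<not> int p dvd det2 T" using P by (metis cong_dvd_iff dvd_mult not_prime_unit)
  thus ?thesis using T by blast
qed

definition split_matrix :: "nat \<Rightarrow> mat2 \<Rightarrow> nat \<Rightarrow> ((int \<times> int) \<times> nat) monoid" where
  "split_matrix p A n = semidirect (cyclic_pair p p) (matrix_map (int p) A) n"

lemma cyclic_action_matrix:
  assumes p: "p > 0" and n: "n > 0" and A: "mcong (int p) (A ^ n) 1"
  shows "cyclic_action (cyclic_pair p p) (matrix_map (int p) A) n"
proof -
  have "(matrix_map (int p) A ^^ n) u = u" if "u \<in> carrier (cyclic_pair p p)" for u
    using funpow_matrix_map[OF p that, of n A] matrix_map_mcong[OF A, of u] matrix_map_1_carrier[OF p that] by simp
  thus ?thesis using n matrix_map_hom[OF p] by (simp add: cyclic_action_def cyclic_action_axioms_def)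
qed

lemma action_is_matrix:
  assumes act: "cyclic_action (cyclic_pair p p) \<alpha> n" and p: "p > 1"
  shows "\<exists>A. mcong (int p) (A ^ n) 1 \<and> (\<forall>u\<in>carrier (cyclic_pair p p). \<alpha> u = matrix_map (int p) A u)"
proof -
  interpret cyclic_action "cyclic_pair p p" \<alpha> n by fact
  obtain A where A: "\<And>u. u \<in> carrier (cyclic_pair p p) \<Longrightarrow> \<alpha> u = matrix_map (int p) A u"
    using hom_is_matrix[OF hom p] by blast
  have p0: "p > 0" using p by simp
  have "matrix_map (int p) (A ^ n) u = matrix_map (int p) 1 u" if u: "u \<in> carrier (cyclic_pair p p)" for u
  proof -
    have "matrix_map (int p) (A ^ n) u = u" using funpow_matrix[of p \<alpha> A u n, OF A p0 u] period[OF u] by simp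
    also have "\<dots> = matrix_map (int p) 1 u" using matrix_map_1_carrier[OF p0 u] by simp
    finally show ?thesis .
  qed
  moreover have "(1, 0) \<in> carrier (cyclic_pair p p)" "(0, 1) \<in> carrier (cyclic_pair p p)" using p by auto
  ultimately have "mcong (int p) (A ^ n) 1" by (intro matrix_map_eqD) blast+
  thus ?thesis using A by blast
qed

lemma split_matrix_iso:
  assumes p: "prime p" and n: "n > 0" and A: "mcong (int p) (A ^ n) 1" and B: "mcong (int p) (B ^ n) 1"
    and T: "conjugates (int p) T (B ^ k) A" and k: "coprime k n"
  shows "split_matrix p A n \<cong> split_matrix p B n"
proof -
  have p0: "p > 0" using p prime_gt_0_nat by blast
  have iso: "matrix_map (int p) T \<in> iso (cyclic_pair p p) (cyclic_pair p p)"
    using T by (intro matrix_map_iso[OF p]) (simp add: conjugates_def)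
  show ?thesis unfolding split_matrix_def
  proof (rule semidirect_isoI[OF cyclic_action_matrix[OF p0 n A] cyclic_action_matrix[OF p0 n B] _ iso k])
    fix u assume u: "u \<in> carrier (cyclic_pair p p)"
    have Tu: "matrix_map (int p) T u \<in> carrier (cyclic_pair p p)"
      using matrix_map_hom[OF p0] u by (auto simp: hom_def)
    have "matrix_map (int p) T (matrix_map (int p) A u) = matrix_map (int p) (T * A) u" by (rule matrix_map_mult)
    also have "\<dots> = matrix_map (int p) (B ^ k * T) u"
      using T by (intro matrix_map_mcong mcong_sym[of _ "B ^ k * T"]) (simp add: conjugates_def)
    also have "\<dots> = (matrix_map (int p) B ^^ k) (matrix_map (int p) T u)"
      using funpow_matrix_map[OF p0 Tu] by (simp add: matrix_map_mult)
    finally show "matrix_map (int p) T (matrix_map (int p) A u) = (matrix_map (int p) B ^^ k) (matrix_map (int p) T u)" .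
  qed (use p0 in simp)
qed

text \<open>
  An isomorphism induces an automorphism of the normal subgroup, and automorphisms of \<open>C(p) \<times> C(p)\<close> are matrices.
\<close>

lemma split_matrix_isoD:
  assumes p: "prime p" and n: "n > 1" and cop: "coprime p n" and A: "mcong (int p) (A ^ n) 1" and B: "mcong (int p) (B ^ n) 1"
    and iso: "split_matrix p A n \<cong> split_matrix p B n"
  obtains T s where "conjugates (int p) T (B ^ s) A"
proof -
  have p0: "p > 0" and n0: "n > 0" using p prime_gt_0_nat n by auto
  obtain \<theta> s where \<theta>: "\<theta> \<in> iso (cyclic_pair p p) (cyclic_pair p p)"
    "\<And>u. u \<in> carrier (cyclic_pair p p) \<Longrightarrow> \<theta> (matrix_map (int p) A u) = (matrix_map (int p) B ^^ s) (\<theta> u)"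
  proof (rule semidirect_isoD[OF cyclic_action_matrix[OF p0 n0 A] cyclic_action_matrix[OF p0 n0 B]])
    show "semidirect (cyclic_pair p p) (matrix_map (int p) A) n \<cong> semidirect (cyclic_pair p p) (matrix_map (int p) B) n"
      using iso by (simp add: split_matrix_def)
    show "coprime (card (carrier (cyclic_pair p p))) n" using cop p0 by simp
  qed (use p0 n in auto)
  obtain T where T: "\<not> int p dvd det2 T" "\<And>u. u \<in> carrier (cyclic_pair p p) \<Longrightarrow> \<theta> u = matrix_map (int p) T u"
    using iso_is_matrix[OF p \<theta>(1)] by blast
  have cl: "matrix_map (int p) A u \<in> carrier (cyclic_pair p p)" if "u \<in> carrier (cyclic_pair p p)" for A u
    using matrix_map_hom[OF p0] that by (auto simp: hom_def)
  have "matrix_map (int p) (B ^ s * T) u = matrix_map (int p) (T * A) u" if u: "u \<in> carrier (cyclic_pair p p)" for u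
    using \<theta>(2)[OF u] T(2)[OF u] T(2)[OF cl[OF u]] funpow_matrix_map[OF p0 cl[OF u], of s B T]
    by (simp add: matrix_map_mult)
  moreover have "(1, 0) \<in> carrier (cyclic_pair p p)" "(0, 1) \<in> carrier (cyclic_pair p p)"
    using p prime_gt_1_nat by auto
  ultimately have "mcong (int p) (B ^ s * T) (T * A)" by (intro matrix_map_eqD) blast+
  thus ?thesis using that T(1) by (auto simp: conjugates_def)
qed

lemma split_matrix_group:
  assumes p: "p > 0" and n: "n > 0" and A: "mcong (int p) (A ^ n) 1"
  shows "group (split_matrix p A n)" "finite (carrier (split_matrix p A n))"
    "order (split_matrix p A n) = p\<^sup>2 * n"
proof -
  interpret cyclic_action "cyclic_pair p p" "matrix_map (int p) A" n by (rule cyclic_action_matrix[OF assms])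
  show "group (split_matrix p A n)" "finite (carrier (split_matrix p A n))"
    "order (split_matrix p A n) = p\<^sup>2 * n"
    unfolding split_matrix_def using group_semidirect finite_semidirect order_semidirect p
    by (simp_all add: power2_eq_square)
qed

lemma comm_split_matrix:
  assumes p: "p > 1" and n: "n > 1" and A: "mcong (int p) (A ^ n) 1"
  shows "comm_group (split_matrix p A n) \<longleftrightarrow> mcong (int p) A 1"
proof -
  interpret cyclic_action "cyclic_pair p p" "matrix_map (int p) A" n
    using p n by (intro cyclic_action_matrix A) auto
  have e: "(1, 0) \<in> carrier (cyclic_pair p p)" "(0, 1) \<in> carrier (cyclic_pair p p)" using p by auto
  have id: "matrix_map (int p) 1 u = u" if "u \<in> carrier (cyclic_pair p p)" for u
    using matrix_map_1_carrier[of p u] that p by simp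
  show ?thesis unfolding split_matrix_def
  proof
    assume "comm_group (semidirect (cyclic_pair p p) (matrix_map (int p) A) n)"
    from comm_groupD[OF this n e(1)] comm_groupD[OF this n e(2)]
    show "mcong (int p) A 1" using id[OF e(1)] id[OF e(2)] by (intro matrix_map_eqD) simp_all
  next
    assume "mcong (int p) A 1"
    thus "comm_group (semidirect (cyclic_pair p p) (matrix_map (int p) A) n)"
      using id matrix_map_mcong by (intro comm_groupI comm_group_cyclic_pair) metis
  qed
qed

lemma torsion_closed_split_matrix:
  assumes p: "p > 0" and n: "n > 0" and A: "mcong (int p) (A ^ n) 1" and cop: "coprime p n"
  shows "torsion_closed (p\<^sup>2) (split_matrix p A n)"
proof -
  interpret cyclic_action "cyclic_pair p p" "matrix_map (int p) A" n by (rule cyclic_action_matrix[OF p n A])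
  show ?thesis unfolding split_matrix_def
    using torsion_closed_card p cop by (simp add: power2_eq_square)
qed

lemma cyclic_pair_pow:
  "(s, t) [^]\<^bsub>cyclic_pair m k\<^esub> (i::nat) = (int i * s mod int m, int i * t mod int k)"
  by (induction i) (auto simp: mod_simps algebra_simps)

lemma split_matrix_no_elem:
  assumes p: "p > 0" and n: "n > 0" and A: "mcong (int p) (A ^ n) 1" and cop: "coprime p n"
  shows "\<not> has_elem_order_square p (split_matrix p A n)"
proof
  interpret cyclic_action "cyclic_pair p p" "matrix_map (int p) A" n by (rule cyclic_action_matrix[OF p n A])
  let ?G = "semidirect (cyclic_pair p p) (matrix_map (int p) A) n"
  assume "has_elem_order_square p (split_matrix p A n)"
  then obtain g where g: "g \<in> carrier ?G" "g [^]\<^bsub>?G\<^esub> (p\<^sup>2) = \<one>\<^bsub>?G\<^esub>" "g [^]\<^bsub>?G\<^esub> p \<noteq> \<one>\<^bsub>?G\<^esub>"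
    unfolding split_matrix_def has_elem_order_square_def by blast
  have "snd g = 0" using fst_torsion[OF _ _ g(1)] g(2) p cop by (simp add: power2_eq_square)
  then obtain s t where st: "g = ((s, t), 0)" by (metis prod.collapse)
  have "(s, t) \<in> carrier (cyclic_pair p p)" using g(1) st by (simp add: carrier_semidirect)
  hence "g [^]\<^bsub>?G\<^esub> p = \<one>\<^bsub>?G\<^esub>" using st pow_fst[of "(s, t)" p] by (simp add: cyclic_pair_pow one_semidirect)
  thus False using g(3) by simp
qed

subsection \<open>The action on a product of cyclic groups that fixes the first factor\<close>

definition split_pair :: "nat \<Rightarrow> nat \<Rightarrow> nat \<Rightarrow> ((int \<times> int) \<times> nat) monoid" where
  "split_pair p q a = semidirect (cyclic_pair p q) (second_map q a) p"

lemma funpow_second: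
  assumes q: "q > 0" and y: "y \<in> {0..<int q}"
  shows "(second_map q a ^^ i) (x, y) = (x, int (a ^ i) * y mod int q)"
proof (induction i)
  case (Suc i)
  have "(second_map q a ^^ Suc i) (x, y) = (x, int a * (int (a ^ i) * y mod int q) mod int q)"
    by (simp add: Suc del: of_nat_power) (simp add: second_map_def)
  thus ?case by (simp add: mod_simps mult.assoc)
qed (use y in auto)

lemma cyclic_action_second:
  assumes p: "p > 0" and q: "q > 0" and a: "[a ^ p = 1] (mod q)"
  shows "cyclic_action (cyclic_pair p q) (second_map q a) p"
proof -
  have "(second_map q a ^^ p) u = u" if "u \<in> carrier (cyclic_pair p q)" for u
  proof -
    obtain x y where [simp]: "u = (x, y)" by (metis surj_pair)
    have y: "y \<in> {0..<int q}" using that p q by (auto simp: carrier_integer_mod_group)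
    have "[int (a ^ p) * y = int 1 * y] (mod int q)"
      using a by (intro cong_mult cong_refl) (simp only: cong_int_iff)
    hence "int (a ^ p) * y mod int q = y" using y by (simp add: cong_def)
    thus ?thesis using funpow_second[OF q y] by (simp del: of_nat_power)
  qed
  moreover have "second_map q a \<in> hom (cyclic_pair p q) (cyclic_pair p q)"
    using p q by (intro homI) (auto simp: second_map_def carrier_integer_mod_group mod_simps algebra_simps)
  ultimately show ?thesis using p by (simp add: cyclic_action_def cyclic_action_axioms_def)
qed

lemma split_pair_iso:
  assumes p: "p > 0" and q: "q > 0" and a: "[a ^ p = 1] (mod q)" and b: "[b = a ^ k] (mod q)" "coprime k p"
  shows "split_pair p q b \<cong> split_pair p q a"
proof -
  have bn: "[b ^ p = 1] (mod q)"
  proof -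
    have "[b ^ p = (a ^ k) ^ p] (mod q)" by (intro cong_pow b)
    also have "(a ^ k) ^ p = (a ^ p) ^ k" by (simp add: power_mult[symmetric] mult.commute)
    also have "[\<dots> = 1 ^ k] (mod q)" by (intro cong_pow a)
    finally show ?thesis by simp
  qed
  show ?thesis unfolding split_pair_def
  proof (rule semidirect_isoI[OF cyclic_action_second[OF p q bn] cyclic_action_second[OF p q a] _ iso_set_refl b(2)])
    fix u assume u: "u \<in> carrier (cyclic_pair p q)"
    obtain x y where [simp]: "u = (x, y)" by (metis surj_pair)
    have y: "y \<in> {0..<int q}" using u p q by (auto simp: carrier_integer_mod_group)
    have "[int b * y = int (a ^ k) * y] (mod int q)"
      using b by (intro cong_mult cong_refl) (simp only: cong_int_iff)
    thus "second_map q b u = (second_map q a ^^ k) u"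
      using funpow_second[OF q y, of k a x] by (simp add: cong_def second_map_def[of q b] del: of_nat_power)
  qed (use p q in auto)
qed

lemma split_pair_group:
  assumes p: "p > 0" and q: "q > 0" and a: "[a ^ p = 1] (mod q)"
  shows "group (split_pair p q a)" "finite (carrier (split_pair p q a))"
    "order (split_pair p q a) = p\<^sup>2 * q"
proof -
  interpret cyclic_action "cyclic_pair p q" "second_map q a" p by (rule cyclic_action_second[OF assms])
  show "group (split_pair p q a)" "finite (carrier (split_pair p q a))"
    "order (split_pair p q a) = p\<^sup>2 * q"
    unfolding split_pair_def using group_semidirect finite_semidirect order_semidirect p q
    by (simp_all add: power2_eq_square)
qed

lemma second_map_eq_id:
  assumes p: "p > 0" and q: "q > 1" and a: "[a = 1] (mod q)" and u: "u \<in> carrier (cyclic_pair p q)"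
  shows "second_map q a u = u"
proof -
  obtain x y where [simp]: "u = (x, y)" by (metis surj_pair)
  have y: "y \<in> {0..<int q}" using u p q by (auto simp: carrier_integer_mod_group)
  have "[int a * y = int 1 * y] (mod int q)"
    using a by (intro cong_mult cong_refl) (simp only: cong_int_iff)
  thus ?thesis using y by (simp add: second_map_def cong_def)
qed

lemma comm_split_pair:
  assumes p: "p > 1" and q: "q > 1" and a: "[a ^ p = 1] (mod q)"
  shows "comm_group (split_pair p q a) \<longleftrightarrow> [a = 1] (mod q)"
proof -
  interpret cyclic_action "cyclic_pair p q" "second_map q a" p
    using p q by (intro cyclic_action_second a) auto
  show ?thesis unfolding split_pair_def
  proof
    assume "comm_group (semidirect (cyclic_pair p q) (second_map q a) p)"
    from comm_groupD[OF this p, of "(0, 1)"] have "int a mod int q = 1" using q by (simp add: second_map_def)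
    hence "[int a = int 1] (mod int q)" using q by (simp add: cong_def)
    thus "[a = 1] (mod q)" by (simp only: cong_int_iff)
  next
    assume "[a = 1] (mod q)"
    thus "comm_group (semidirect (cyclic_pair p q) (second_map q a) p)"
      using p q by (intro comm_groupI comm_group_cyclic_pair second_map_eq_id) auto
  qed
qed

lemma torsion_closed_split_pairD:
  assumes p: "p > 1" and q: "q > 1" and a: "[a ^ p = 1] (mod q)" and cop: "coprime p q"
    and tc: "torsion_closed (p\<^sup>2) (split_pair p q a)"
  shows "[a = 1] (mod q)"
proof -
  have p0: "p > 0" and q0: "q > 0" using p q by auto
  interpret cyclic_action "cyclic_pair p q" "second_map q a" p by (rule cyclic_action_second[OF p0 q0 a])
  let ?N = "cyclic_pair p q"
  have e: "(0, 1) \<in> carrier ?N" using q by simp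
  have r: "second_map q a (0, 1) = (0, int a mod int q)" by (simp add: second_map_def)
  have ac: "int a mod int q \<in> carrier (integer_mod_group q)" using q by (simp add: carrier_integer_mod_group)
  have inv: "inv\<^bsub>?N\<^esub> (0, int a mod int q) = (0, (- (int a mod int q)) mod int q)"
    using inv_DirProd[OF group_integer_mod_group group_integer_mod_group integer_mod_group_0 ac, of p] ac by simp
  have "((0, 1) \<otimes>\<^bsub>?N\<^esub> inv\<^bsub>?N\<^esub> (second_map q a (0, 1))) [^]\<^bsub>?N\<^esub> (p\<^sup>2) = \<one>\<^bsub>?N\<^esub>"
    by (rule torsion_closedD[OF tc[unfolded split_pair_def] _ p e]) (simp add: power2_eq_square)
  hence "int (p\<^sup>2) * ((1 + (- (int a mod int q)) mod int q) mod int q) mod int q = 0"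
    unfolding r inv by (simp add: cyclic_pair_pow)
  moreover have "[int (p\<^sup>2) * ((1 + (- (int a mod int q)) mod int q) mod int q) = int (p\<^sup>2) * (1 - int a)] (mod int q)"
    by (simp add: cong_def mod_simps)
  ultimately have "int q dvd int (p\<^sup>2) * (1 - int a)" by (simp add: cong_def mod_eq_0_iff_dvd)
  moreover have "coprime (int q) (int (p\<^sup>2))" using cop by (simp add: coprime_commute)
  ultimately have "int q dvd 1 - int a" by (simp only: coprime_dvd_mult_right_iff)
  hence "[int 1 = int a] (mod int q)" by (simp add: cong_iff_dvd_diff)
  thus ?thesis by (simp only: cong_int_iff cong_sym)
qed

text \<open>
  The first coordinate of \<open>g\<^sup>p\<close> vanishes because the action fixes it, and so does the exponent of the acting generator. Thus \<open>g\<^sup>p\<close> lies in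
  \<open>C(q)\<close> and has order dividing \<open>p\<close>, so it is \<open>1\<close>.
\<close>

lemma split_pair_no_elem:
  assumes p: "p > 1" and q: "q > 1" and a: "[a ^ p = 1] (mod q)" and cop: "coprime p q"
  shows "\<not> has_elem_order_square p (split_pair p q a)"
proof
  have p0: "p > 0" and q0: "q > 0" using p q by auto
  interpret cyclic_action "cyclic_pair p q" "second_map q a" p by (rule cyclic_action_second[OF p0 q0 a])
  let ?G = "semidirect (cyclic_pair p q) (second_map q a) p"
  assume "has_elem_order_square p (split_pair p q a)"
  then obtain g where g: "g \<in> carrier ?G" "g [^]\<^bsub>?G\<^esub> (p\<^sup>2) = \<one>\<^bsub>?G\<^esub>" "g [^]\<^bsub>?G\<^esub> p \<noteq> \<one>\<^bsub>?G\<^esub>"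
    unfolding split_pair_def has_elem_order_square_def by blast
  obtain x y i where gxy: "g = ((x, y), i)" by (metis surj_pair)
  have xy: "x \<in> {0..<int p}" "y \<in> {0..<int q}" using g(1) gxy p0 q0 by (auto simp: carrier_semidirect carrier_integer_mod_group)
  have "\<exists>y'. y' \<in> {0..<int q} \<and> g [^]\<^bsub>?G\<^esub> k = ((int k * x mod int p, y'), k * i mod p)" for k :: nat
  proof (induction k)
    case 0
    show ?case using q0 p0 by (auto simp: one_semidirect)
  next
    case (Suc k)
    then obtain y' where y': "y' \<in> {0..<int q}" "g [^]\<^bsub>?G\<^esub> k = ((int k * x mod int p, y'), k * i mod p)" by blast
    define y'' where "y'' = (y' + int (a ^ (k * i mod p)) * y mod int q) mod int q"
    have "g [^]\<^bsub>?G\<^esub> Suc k = (((int k * x mod int p + x) mod int p, y''), (k * i mod p + i) mod p)"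
      using y'(2) funpow_second[OF q0 xy(2), of "k * i mod p" a x]
      by (simp add: mult_semidirect y''_def gxy del: of_nat_power)
    also have "(int k * x mod int p + x) mod int p = int (Suc k) * x mod int p" by (simp add: mod_simps algebra_simps)
    also have "(k * i mod p + i) mod p = Suc k * i mod p" by (simp add: mod_simps algebra_simps)
    finally show ?case using q0 by (intro exI[of _ y'']) (simp add: y''_def)
  qed
  from this[of p] obtain y' where y': "y' \<in> {0..<int q}" "g [^]\<^bsub>?G\<^esub> p = ((0, y'), 0)" by auto
  have c: "(0, y') \<in> carrier (cyclic_pair p q)" using y' p0 q0 by (simp add: carrier_integer_mod_group)
  have "g [^]\<^bsub>?G\<^esub> (p\<^sup>2) = (g [^]\<^bsub>?G\<^esub> p) [^]\<^bsub>?G\<^esub> p"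
    using SD.nat_pow_pow[OF g(1)] by (simp add: power2_eq_square)
  also have "\<dots> = ((0, int p * y' mod int q), 0)"
    unfolding y'(2) using pow_fst[OF c, of p] by (simp add: cyclic_pair_pow)
  finally have "int p * y' mod int q = 0" using g(2) by (simp add: one_semidirect)
  hence "int q dvd int p * y'" by (simp add: mod_eq_0_iff_dvd)
  hence "int q dvd y'" using cop by (simp add: coprime_dvd_mult_right_iff coprime_commute)
  hence "y' = 0" using y'(1) zdvd_not_zless[of y' "int q"] by fastforce
  thus False using g(3) y'(2) by (simp add: one_semidirect)
qed

section \<open>The classification\<close>

locale distinct_primes =
  fixes p q :: nat
  assumes p: "prime p" and q: "prime q" and pq: "p \<noteq> q"
begin

lemma bounds: "p > 1" "p > 0" "q > 1" "q > 0" "p\<^sup>2 > 1" "p\<^sup>2 > 0" "p < p\<^sup>2"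
  using p q prime_gt_1_nat prime_gt_0_nat square_bounds[of p] by auto

lemma coprimes: "coprime p q" "coprime q p" "coprime (p\<^sup>2) q" "coprime q (p\<^sup>2)"
  using p q pq by (auto simp: primes_coprime)

text \<open>
  In the last two cases the action is nontrivial: otherwise the group would be commutative, its Sylow
  \<open>p\<close>-subgroup normal, and one of the first two cases would apply. This keeps the four kinds disjoint.
\<close>

lemma classification:
  fixes G (structure)
  assumes G: "group G" and fin: "finite (carrier G)" and ord: "order G = p\<^sup>2 * q"
  shows "(\<exists>a. [a ^ q = 1] (mod p\<^sup>2) \<and> split_cyclic (p\<^sup>2) a q \<cong> G) \<or>
    (\<exists>A. mcong (int p) (A ^ q) 1 \<and> split_matrix p A q \<cong> G) \<or>
    (\<exists>a. [a ^ p\<^sup>2 = 1] (mod q) \<and> \<not> [a = 1] (mod q) \<and> split_cyclic q a (p\<^sup>2) \<cong> G) \<or>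
    (\<exists>a. [a ^ p = 1] (mod q) \<and> \<not> [a = 1] (mod q) \<and> split_pair p q a \<cong> G)"
proof -
  interpret group G by fact
  obtain P where P: "subgroup P G" "card P = p\<^sup>2" using sylow_thm[OF p G ord fin] by blast
  obtain Q where Q: "subgroup Q G" "card Q = q"
    using sylow_thm[OF q G, of 1 "p\<^sup>2"] ord fin by (auto simp: mult.commute)
  have PQ: "P \<lhd> G \<or> Q \<lhd> G"
    using normal_sylow_of_larger_prime_square[OF fin ord p _ P]
      normal_sylow_of_larger_prime[OF fin ord p q _ P Q] pq by (cases "p < q") auto
  show ?thesis
  proof (cases "P \<lhd> G")
    case True
    from split_cases_normal_square[OF G fin ord p q pq P True] show ?thesis
    proof
      assume "\<exists>\<alpha>. cyclic_action (integer_mod_group (p\<^sup>2)) \<alpha> q \<and> semidirect (integer_mod_group (p\<^sup>2)) \<alpha> q \<cong> G"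
      then obtain \<alpha> where \<alpha>: "cyclic_action (integer_mod_group (p\<^sup>2)) \<alpha> q" "semidirect (integer_mod_group (p\<^sup>2)) \<alpha> q \<cong> G" by blast
      obtain a where a: "[a ^ q = 1] (mod p\<^sup>2)" "\<And>x. x \<in> carrier (integer_mod_group (p\<^sup>2)) \<Longrightarrow> \<alpha> x = scalar_map (p\<^sup>2) a x"
        using action_is_scalar[OF \<alpha>(1) bounds(5)] by metis
      have "split_cyclic (p\<^sup>2) a q \<cong> semidirect (integer_mod_group (p\<^sup>2)) \<alpha> q"
        unfolding split_cyclic_def
        by (rule semidirect_cong_iso[OF \<alpha>(1) cyclic_action_scalar[OF bounds(6,4) a(1)] _ a(2)]) (use bounds in auto)
      thus ?thesis using a(1) iso_trans[OF _ \<alpha>(2)] by blast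
    next
      assume "\<exists>\<alpha>. cyclic_action (cyclic_pair p p) \<alpha> q \<and> semidirect (cyclic_pair p p) \<alpha> q \<cong> G"
      then obtain \<alpha> where \<alpha>: "cyclic_action (cyclic_pair p p) \<alpha> q" "semidirect (cyclic_pair p p) \<alpha> q \<cong> G" by blast
      obtain A where A: "mcong (int p) (A ^ q) 1" "\<And>u. u \<in> carrier (cyclic_pair p p) \<Longrightarrow> \<alpha> u = matrix_map (int p) A u"
        using action_is_matrix[OF \<alpha>(1) bounds(1)] by blast
      have "split_matrix p A q \<cong> semidirect (cyclic_pair p p) \<alpha> q"
        unfolding split_matrix_def
        by (rule semidirect_cong_iso[OF \<alpha>(1) cyclic_action_matrix[OF bounds(2,4) A(1)] _ A(2)]) (use bounds in auto)
      thus ?thesis using A(1) iso_trans[OF _ \<alpha>(2)] by blast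
    qed
  next
    case False
    hence Qn: "Q \<lhd> G" using PQ by blast
    have nc: "\<not> comm_group G" using False P(1) comm_group.normal_iff_subgroup by blast
    from split_cases_normal_prime[OF G fin ord p q pq Q Qn] show ?thesis
    proof
      assume "\<exists>\<alpha>. cyclic_action (integer_mod_group q) \<alpha> (p\<^sup>2) \<and> semidirect (integer_mod_group q) \<alpha> (p\<^sup>2) \<cong> G"
      then obtain \<alpha> where \<alpha>: "cyclic_action (integer_mod_group q) \<alpha> (p\<^sup>2)" "semidirect (integer_mod_group q) \<alpha> (p\<^sup>2) \<cong> G" by blast
      obtain a where a: "[a ^ p\<^sup>2 = 1] (mod q)" "\<And>x. x \<in> carrier (integer_mod_group q) \<Longrightarrow> \<alpha> x = scalar_map q a x"
        using action_is_scalar[OF \<alpha>(1) bounds(3)] by metis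
      have "split_cyclic q a (p\<^sup>2) \<cong> semidirect (integer_mod_group q) \<alpha> (p\<^sup>2)"
        unfolding split_cyclic_def
        by (rule semidirect_cong_iso[OF \<alpha>(1) cyclic_action_scalar[OF bounds(4,6) a(1)] _ a(2)]) (use bounds in auto)
      hence iso: "split_cyclic q a (p\<^sup>2) \<cong> G" using iso_trans[OF _ \<alpha>(2)] by blast
      have "\<not> [a = 1] (mod q)"
        using nc iso_invariants(1)[OF split_cyclic_group(1)[OF bounds(4,6) a(1)] G iso]
          comm_split_cyclic[OF bounds(3,5) a(1)] by blast
      thus ?thesis using a(1) iso by blast
    next
      assume "\<exists>\<alpha> a. cyclic_action (cyclic_pair p q) \<alpha> p \<and> semidirect (cyclic_pair p q) \<alpha> p \<cong> G \<and>
         (\<forall>i\<in>{0..<int p}. \<forall>j\<in>{0..<int q}. \<alpha> (i, j) = (i, a * j mod int q))"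
      then obtain \<alpha> b where \<alpha>: "cyclic_action (cyclic_pair p q) \<alpha> p" "semidirect (cyclic_pair p q) \<alpha> p \<cong> G"
        "\<And>i j. i \<in> {0..<int p} \<Longrightarrow> j \<in> {0..<int q} \<Longrightarrow> \<alpha> (i, j) = (i, b * j mod int q)" by blast
      define a where "a = nat (b mod int q)"
      have a: "int a = b mod int q" using bounds by (simp add: a_def)
      have \<alpha>a: "\<alpha> u = second_map q a u" if u: "u \<in> carrier (cyclic_pair p q)" for u
      proof -
        obtain i j where [simp]: "u = (i, j)" by (metis surj_pair)
        have "i \<in> {0..<int p}" "j \<in> {0..<int q}" using u bounds by (auto simp: carrier_integer_mod_group)
        from \<alpha>(3)[OF this] show ?thesis by (simp add: second_map_def a mod_mult_left_eq)
      qed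
      interpret A: cyclic_action "cyclic_pair p q" \<alpha> p by (rule \<alpha>(1))
      have pow: "(\<alpha> ^^ i) u = (second_map q a ^^ i) u" if "u \<in> carrier (cyclic_pair p q)" for i u
      proof (induction i)
        case (Suc i)
        thus ?case using \<alpha>a[OF A.funpow_closed[OF that, of i]] by simp
      qed simp
      have e: "(0, 1) \<in> carrier (cyclic_pair p q)" using bounds by simp
      have "(0, int (a ^ p) * 1 mod int q) = (0, 1)"
        using pow[OF e, of p] A.period[OF e] funpow_second[of q 1 p a 0] bounds by simp
      hence "int (a ^ p) mod int q = 1" by simp
      hence "[int (a ^ p) = int 1] (mod int q)" using bounds by (simp add: cong_def)
      hence ap: "[a ^ p = 1] (mod q)" by (simp only: cong_int_iff)
      have "split_pair p q a \<cong> semidirect (cyclic_pair p q) \<alpha> p"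
        unfolding split_pair_def
        by (rule semidirect_cong_iso[OF \<alpha>(1) cyclic_action_second[OF bounds(2,4) ap] _ \<alpha>a]) (use bounds in auto)
      hence iso: "split_pair p q a \<cong> G" using iso_trans[OF _ \<alpha>(2)] by blast
      have "\<not> [a = 1] (mod q)"
        using nc iso_invariants(1)[OF split_pair_group(1)[OF bounds(2,4) ap] G iso]
          comm_split_pair[OF bounds(1,3) ap] by blast
      thus ?thesis using ap iso by blast
    qed
  qed
qed

text \<open>
  The invariants \<open>nsq\<close> (normal Sylow \<open>p\<close>-subgroup) and \<open>cyc\<close> (an element of order \<open>p\<^sup>2\<close>, hence a cyclic Sylow
  \<open>p\<close>-subgroup) determine which of the four kinds a group of order \<open>p\<^sup>2 q\<close> belongs to.
\<close>

abbreviation "groups_p2q \<equiv> groups_of_order (p\<^sup>2 * q)"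
abbreviation "nsq \<equiv> torsion_closed (p\<^sup>2)"
abbreviation "cyc \<equiv> has_elem_order_square p"

lemma groups_p2qD: "G \<in> groups_p2q \<Longrightarrow> group G" "G \<in> groups_p2q \<Longrightarrow> finite (carrier G)" "G \<in> groups_p2q \<Longrightarrow> order G = p\<^sup>2 * q"
  by (auto simp: groups_of_order_def)

lemma invariants_normal_cyclic_square:
  assumes a: "[a ^ q = 1] (mod p\<^sup>2)" and G: "G \<in> groups_p2q" and iso: "split_cyclic (p\<^sup>2) a q \<cong> G"
  shows "comm_group G \<longleftrightarrow> [a = 1] (mod p\<^sup>2)" "nsq G" "cyc G"
  using iso_invariants[OF split_cyclic_group(1)[OF bounds(6,4) a] groups_p2qD(1)[OF G] iso]
    comm_split_cyclic[OF bounds(5,3) a] torsion_closed_split_cyclic[OF bounds(6,4) a coprimes(3)]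
    split_cyclic_elem_left[OF bounds(4,1) a] by blast+

lemma invariants_normal_elementary_square:
  assumes A: "mcong (int p) (A ^ q) 1" and G: "G \<in> groups_p2q" and iso: "split_matrix p A q \<cong> G"
  shows "comm_group G \<longleftrightarrow> mcong (int p) A 1" "nsq G" "\<not> cyc G"
  using iso_invariants[OF split_matrix_group(1)[OF bounds(2,4) A] groups_p2qD(1)[OF G] iso]
    comm_split_matrix[OF bounds(1,3) A] torsion_closed_split_matrix[OF bounds(2,4) A coprimes(1)]
    split_matrix_no_elem[OF bounds(2,4) A coprimes(1)] by blast+

lemma invariants_normal_prime_cyclic:
  assumes a: "[a ^ p\<^sup>2 = 1] (mod q)" "\<not> [a = 1] (mod q)" and G: "G \<in> groups_p2q" and iso: "split_cyclic q a (p\<^sup>2) \<cong> G"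
  shows "\<not> comm_group G" "\<not> nsq G" "cyc G"
    "nontrivial_centre G \<longleftrightarrow> [a ^ p = 1] (mod q)"
proof -
  note inv = iso_invariants[OF split_cyclic_group(1)[OF bounds(4,6) a(1)] groups_p2qD(1)[OF G] iso]
  show "\<not> comm_group G" using inv(1) comm_split_cyclic[OF bounds(3,5) a(1)] a(2) by blast
  show "\<not> nsq G"
    using inv(2) torsion_closed_split_cyclicD[OF bounds(3,5) a(1) coprimes(4)] a(2) by blast
  show "cyc G" using inv(3) split_cyclic_elem_right[OF bounds(4,1) a(1)] by blast
  show "nontrivial_centre G \<longleftrightarrow> [a ^ p = 1] (mod q)"
    using inv(4) split_cyclic_nontrivial_centre[OF bounds(3,1)] split_cyclic_centre_trivial[OF q p a(1)] by blast
qed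

lemma invariants_normal_prime_elementary:
  assumes a: "[a ^ p = 1] (mod q)" "\<not> [a = 1] (mod q)" and G: "G \<in> groups_p2q" and iso: "split_pair p q a \<cong> G"
  shows "\<not> comm_group G" "\<not> nsq G" "\<not> cyc G"
proof -
  note inv = iso_invariants[OF split_pair_group(1)[OF bounds(2,4) a(1)] groups_p2qD(1)[OF G] iso]
  show "\<not> comm_group G" using inv(1) comm_split_pair[OF bounds(1,3) a(1)] a(2) by blast
  show "\<not> nsq G"
    using inv(2) torsion_closed_split_pairD[OF bounds(1,3) a(1) coprimes(1)] a(2) by blast
  show "\<not> cyc G" using inv(3) split_pair_no_elem[OF bounds(1,3) a(1) coprimes(1)] by blast
qed

lemma classification_invariants:
  assumes G: "G \<in> groups_p2q"
  obtains (square_cyclic) a where "[a ^ q = 1] (mod p\<^sup>2)" "split_cyclic (p\<^sup>2) a q \<cong> G"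
      "comm_group G \<longleftrightarrow> [a = 1] (mod p\<^sup>2)" "nsq G" "cyc G"
  | (square_elementary) A where "mcong (int p) (A ^ q) 1" "split_matrix p A q \<cong> G"
      "comm_group G \<longleftrightarrow> mcong (int p) A 1" "nsq G" "\<not> cyc G"
  | (prime_cyclic) a where "[a ^ p\<^sup>2 = 1] (mod q)" "\<not> [a = 1] (mod q)" "split_cyclic q a (p\<^sup>2) \<cong> G"
      "\<not> comm_group G" "\<not> nsq G" "cyc G"
      "nontrivial_centre G \<longleftrightarrow> [a ^ p = 1] (mod q)"
  | (prime_elementary) a where "[a ^ p = 1] (mod q)" "\<not> [a = 1] (mod q)" "split_pair p q a \<cong> G"
      "\<not> comm_group G" "\<not> nsq G" "\<not> cyc G"
proof -
  from classification[OF groups_p2qD[OF G]]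
  consider (1) a where "[a ^ q = 1] (mod p\<^sup>2)" "split_cyclic (p\<^sup>2) a q \<cong> G"
    | (2) A where "mcong (int p) (A ^ q) 1" "split_matrix p A q \<cong> G"
    | (3) a where "[a ^ p\<^sup>2 = 1] (mod q)" "\<not> [a = 1] (mod q)" "split_cyclic q a (p\<^sup>2) \<cong> G"
    | (4) a where "[a ^ p = 1] (mod q)" "\<not> [a = 1] (mod q)" "split_pair p q a \<cong> G"
    by blast
  thus ?thesis
  proof cases
    case (1 a)
    show ?thesis by (rule square_cyclic[OF 1 invariants_normal_cyclic_square[OF 1(1) G 1(2)]])
  next
    case (2 A)
    show ?thesis by (rule square_elementary[OF 2 invariants_normal_elementary_square[OF 2(1) G 2(2)]])
  next
    case (3 a)
    show ?thesis by (rule prime_cyclic[OF 3 invariants_normal_prime_cyclic[OF 3(1,2) G 3(3)]])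
  next
    case (4 a)
    show ?thesis by (rule prime_elementary[OF 4 invariants_normal_prime_elementary[OF 4(1,2) G 4(3)]])
  qed
qed

end

section \<open>Counting each kind of group\<close>

lemma prime_power_order:
  fixes a :: nat
  assumes "prime q" "[a ^ q = 1] (mod m)" "\<not> [a = 1] (mod m)"
  shows "ord m a = q"
proof -
  have "ord m a dvd q" using assms(2) by (rule iffD1[OF ord_divides])
  moreover have "ord m a \<noteq> 1" using assms(3) by (simp add: ord_eq_Suc_0_iff)
  ultimately show ?thesis using assms(1) by (metis prime_nat_iff)
qed

lemma order_dvd_totient_of_pos:
  assumes "ord m (a::nat) > 0" shows "ord m a dvd totient m"
  using assms by (intro order_divides_totient) simp

context distinct_primes
begin

lemma primroot_square: 
  assumes "odd p" obtains g where "residue_primroot (p\<^sup>2) g"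
  using residue_primroot_odd_prime_power_exists[OF p assms] by (metis zero_less_numeral)

lemma primroot_q: obtains g where "residue_primroot q g"
  using prime_primitive_root_exists[of q] q bounds by auto

lemma totients: "totient (p\<^sup>2) = p * (p - 1)" "totient q = q - 1" "totient p = p - 1"
  using totient_prime_power[OF p, of 2] totient_prime[OF q] totient_prime[OF p] by simp_all

lemma dvd_totient_square: "q dvd totient (p\<^sup>2) \<longleftrightarrow> q dvd p - 1"
  using coprimes by (simp add: totients coprime_dvd_mult_right_iff)

lemma odd_if_dvd: "q dvd p - 1 \<Longrightarrow> odd p"
  using p q pq by (metis One_nat_def diff_Suc_1 even_numeral nat_dvd_1_iff_1 not_prime_1 numeral_2_eq_2 primes_dvd_imp_eq two_is_prime_nat)

text \<open>
  The order of \<open>x\<close> divides both \<open>q\<close> and \<open>p - 1\<close>.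
\<close>

lemma root_of_unity_trivial:
  assumes qp: "\<not> q dvd p - 1" and x: "[x ^ q = 1] (mod int p)"
  shows "[x = 1] (mod int p)"
proof -
  define y where "y = nat (x mod int p)"
  have y: "int y = x mod int p" using bounds by (simp add: y_def)
  have xy: "[int y = x] (mod int p)" by (simp add: y cong_def)
  have "[int (y ^ q) = int 1] (mod int p)" using cong_trans[OF cong_pow[OF xy, of q] x] by simp
  hence "[y ^ q = 1] (mod p)" by (simp only: cong_int_iff)
  hence o: "ord p y dvd q" by (rule iffD1[OF ord_divides])
  hence "ord p y > 0" using bounds by (metis dvd_0_left_iff not_gr_zero)
  hence "ord p y dvd p - 1" using order_dvd_totient_of_pos[of p y] totients by simp
  hence "ord p y \<noteq> q" using qp by metis
  hence "ord p y = 1" using o q by (metis prime_nat_iff)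
  hence "[y = 1] (mod p)" by (simp add: ord_eq_Suc_0_iff)
  hence "[int y = int 1] (mod int p)" by (simp only: cong_int_iff)
  thus ?thesis using xy by (metis cong_sym cong_trans of_nat_1)
qed

lemma not_dvd_int: "\<not> int p dvd int q"
  using p q pq by (metis int_dvd_int_iff primes_dvd_imp_eq)


lemma count_square_cyclic:
  fixes c :: bool
  defines "A \<equiv> {a. [a ^ q = 1] (mod p\<^sup>2) \<and> ([a = 1] (mod p\<^sup>2) \<longleftrightarrow> c)}"
  assumes iso: "\<And>a b. a \<in> A \<Longrightarrow> b \<in> A \<Longrightarrow> split_cyclic (p\<^sup>2) a q \<cong> split_cyclic (p\<^sup>2) b q"
  shows "num_types (p\<^sup>2 * q) (\<lambda>G. nsq G \<and> cyc G \<and> comm_group G = c) = (if A = {} then 0 else 1)"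
proof (rule num_types_one_model[where M = "\<lambda>a. split_cyclic (p\<^sup>2) a q"])
  fix a assume "a \<in> A"
  thus "group (split_cyclic (p\<^sup>2) a q) \<and> finite (carrier (split_cyclic (p\<^sup>2) a q)) \<and>
      order (split_cyclic (p\<^sup>2) a q) = p\<^sup>2 * q"
    using split_cyclic_group[OF bounds(6,4)] by (simp add: A_def)
next
  fix G assume G: "G \<in> groups_p2q"
  show "nsq G \<and> cyc G \<and> comm_group G = c \<longleftrightarrow> (\<exists>a\<in>A. split_cyclic (p\<^sup>2) a q \<cong> G)"
  proof
    assume *: "nsq G \<and> cyc G \<and> comm_group G = c"
    from G show "\<exists>a\<in>A. split_cyclic (p\<^sup>2) a q \<cong> G"
      by (cases rule: classification_invariants) (use * in \<open>auto simp: A_def\<close>)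
  next
    assume "\<exists>a\<in>A. split_cyclic (p\<^sup>2) a q \<cong> G"
    then obtain a where a: "a \<in> A" "split_cyclic (p\<^sup>2) a q \<cong> G" by blast
    hence "[a ^ q = 1] (mod p\<^sup>2)" by (simp add: A_def)
    from invariants_normal_cyclic_square[OF this G a(2)] a(1)
    show "nsq G \<and> cyc G \<and> comm_group G = c" by (auto simp: A_def)
  qed
qed (rule iso)

lemma count_square_elementary_iff:
  assumes G: "G \<in> groups_p2q"
  shows "nsq G \<and> \<not> cyc G \<and> comm_group G = c \<longleftrightarrow>
    (\<exists>A. mcong (int p) (A ^ q) 1 \<and> (mcong (int p) A 1 \<longleftrightarrow> c) \<and> split_matrix p A q \<cong> G)"
proof
  assume *: "nsq G \<and> \<not> cyc G \<and> comm_group G = c"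
  from G show "\<exists>A. mcong (int p) (A ^ q) 1 \<and> (mcong (int p) A 1 \<longleftrightarrow> c) \<and> split_matrix p A q \<cong> G"
    by (cases rule: classification_invariants) (use * in auto)
next
  assume "\<exists>A. mcong (int p) (A ^ q) 1 \<and> (mcong (int p) A 1 \<longleftrightarrow> c) \<and> split_matrix p A q \<cong> G"
  thus "nsq G \<and> \<not> cyc G \<and> comm_group G = c" using invariants_normal_elementary_square[OF _ G] by blast
qed

lemma count_square_elementary:
  fixes c :: bool
  defines "S \<equiv> {A. mcong (int p) (A ^ q) 1 \<and> (mcong (int p) A 1 \<longleftrightarrow> c)}"
  assumes iso: "\<And>A B. A \<in> S \<Longrightarrow> B \<in> S \<Longrightarrow> split_matrix p A q \<cong> split_matrix p B q"
  shows "num_types (p\<^sup>2 * q) (\<lambda>G. nsq G \<and> \<not> cyc G \<and> comm_group G = c) = (if S = {} then 0 else 1)"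
proof (rule num_types_one_model[where M = "\<lambda>A. split_matrix p A q"])
  fix A assume "A \<in> S"
  thus "group (split_matrix p A q) \<and> finite (carrier (split_matrix p A q)) \<and>
      order (split_matrix p A q) = p\<^sup>2 * q"
    using split_matrix_group[OF bounds(2,4)] by (simp add: S_def)
next
  fix G assume "G \<in> groups_p2q"
  thus "nsq G \<and> \<not> cyc G \<and> comm_group G = c \<longleftrightarrow> (\<exists>A\<in>S. split_matrix p A q \<cong> G)"
    using count_square_elementary_iff[of G c] by (auto simp: S_def)
qed (rule iso)

lemma count_cyclic: "num_types (p\<^sup>2 * q) (\<lambda>G. nsq G \<and> cyc G \<and> comm_group G = True) = 1"
proof -
  let ?A = "{a. [a ^ q = 1] (mod p\<^sup>2) \<and> ([a = 1] (mod p\<^sup>2) \<longleftrightarrow> True)}"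
  have "split_cyclic (p\<^sup>2) a q \<cong> split_cyclic (p\<^sup>2) b q" if "a \<in> ?A" "b \<in> ?A" for a b
  proof (rule split_cyclic_iso[OF bounds(6,4)])
    show "[a = b ^ 1] (mod p\<^sup>2)" using that by (auto intro: cong_trans cong_sym)
  qed (use that in auto)
  note iso = this
  have "1 \<in> ?A" by simp
  hence "?A \<noteq> {}" by blast
  thus ?thesis by (intro trans[OF count_square_cyclic[of True, OF iso] if_not_P])
qed

lemma count_elementary_abelian: "num_types (p\<^sup>2 * q) (\<lambda>G. nsq G \<and> \<not> cyc G \<and> comm_group G = True) = 1"
proof -
  let ?S = "{A. mcong (int p) (A ^ q) 1 \<and> (mcong (int p) A 1 \<longleftrightarrow> True)}"
  have "split_matrix p A q \<cong> split_matrix p B q" if AB: "A \<in> ?S" "B \<in> ?S" for A B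
  proof (rule split_matrix_iso[OF p bounds(4)])
    have "\<not> int p dvd 1" using p by (metis not_prime_unit prime_nat_int_transfer)
    moreover have "mcong (int p) B A" using AB mcong_trans[OF _ mcong_sym] by blast
    ultimately show "conjugates (int p) 1 (B ^ 1) A"
      by (simp add: conjugates_def, simp add: det2_def one_mat2_def)
  qed (use AB in auto)
  note iso = this
  have "1 \<in> ?S" by simp
  hence "?S \<noteq> {}" by blast
  thus ?thesis by (intro trans[OF count_square_elementary[of True, OF iso] if_not_P])
qed

lemma count_cyclic_square_nonabelian:
  "num_types (p\<^sup>2 * q) (\<lambda>G. nsq G \<and> cyc G \<and> comm_group G = False) = (if q dvd p - 1 then 1 else 0)"
proof -
  let ?A = "{a. [a ^ q = 1] (mod p\<^sup>2) \<and> ([a = 1] (mod p\<^sup>2) \<longleftrightarrow> False)}"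
  have A: "a \<in> ?A \<longleftrightarrow> ord (p\<^sup>2) a = q" for a
    using prime_power_order[OF q, of a "p\<^sup>2"] ord_divides[of a q "p\<^sup>2"] ord_eq_Suc_0_iff[of "p\<^sup>2" a] bounds(3) by auto
  have dvd: "q dvd p - 1" if "ord (p\<^sup>2) a = q" for a
    using order_dvd_totient_of_pos[of "p\<^sup>2" a] that bounds dvd_totient_square by simp
  have "split_cyclic (p\<^sup>2) a q \<cong> split_cyclic (p\<^sup>2) b q" if "a \<in> ?A" "b \<in> ?A" for a b
  proof -
    have ab: "ord (p\<^sup>2) a = q" "ord (p\<^sup>2) b = q" using that A by blast+
    obtain g where g: "residue_primroot (p\<^sup>2) g" using primroot_square odd_if_dvd dvd ab(1) by blast
    obtain k where k: "[a = b ^ k] (mod p\<^sup>2)" "coprime k q"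
      using coprime_power_of_equal_order[OF g bounds(5) ab(2,1) bounds(4)] .
    show ?thesis by (rule split_cyclic_iso[OF bounds(6,4) _ k]) (use that in simp)
  qed
  moreover have "?A \<noteq> {} \<longleftrightarrow> q dvd p - 1"
  proof
    assume qp: "q dvd p - 1"
    obtain g where "residue_primroot (p\<^sup>2) g" using primroot_square odd_if_dvd qp by blast
    then obtain a where "ord (p\<^sup>2) a = q" using ord_exists_primroot qp dvd_totient_square by blast
    thus "?A \<noteq> {}" using A by blast
  qed (use A dvd in blast)
  ultimately show ?thesis by (subst count_square_cyclic) auto
qed

text \<open>
  The two possible orders \<open>d\<close> of a nontrivial action of \<open>C(p\<^sup>2)\<close> on \<open>C(q)\<close> are treated at once; the centre tells them apart.
\<close>

lemma count_prime_cyclic: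
  assumes d: "d = p \<and> Z = True \<or> d = p\<^sup>2 \<and> Z = False"
  shows "num_types (p\<^sup>2 * q) (\<lambda>G. \<not> nsq G \<and> cyc G \<and> nontrivial_centre G = Z) = (if d dvd q - 1 then 1 else 0)"
proof -
  have d0: "d > 0" "d \<noteq> 1" "d dvd p\<^sup>2" "\<And>k. coprime k d \<Longrightarrow> coprime k (p\<^sup>2)"
    using d bounds(1,5,6) by (auto dest: less_imp_neq)
  define A where "A = {a. ord q a = d}"
  have A: "a \<in> A \<longleftrightarrow> [a ^ p\<^sup>2 = 1] (mod q) \<and> \<not> [a = 1] (mod q) \<and> ([a ^ p = 1] (mod q) \<longleftrightarrow> Z)" for a
  proof -
    have dd: "[a ^ i = 1] (mod q) \<longleftrightarrow> ord q a dvd i" "[a = 1] (mod q) \<longleftrightarrow> ord q a = 1" for i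
      using ord_divides[of a i q] ord_eq_Suc_0_iff[of q a] by auto
    have "ord q a = d \<longleftrightarrow> ord q a dvd p\<^sup>2 \<and> ord q a \<noteq> 1 \<and> (ord q a dvd p \<longleftrightarrow> Z)"
    proof
      have "\<not> p\<^sup>2 dvd p" using bounds by (auto dest: dvd_imp_le)
      moreover assume "ord q a = d"
      ultimately show "ord q a dvd p\<^sup>2 \<and> ord q a \<noteq> 1 \<and> (ord q a dvd p \<longleftrightarrow> Z)" using d d0 by auto
    next
      assume *: "ord q a dvd p\<^sup>2 \<and> ord q a \<noteq> 1 \<and> (ord q a dvd p \<longleftrightarrow> Z)"
      then obtain j where j: "j \<le> 2" "ord q a = p ^ j" using divides_primepow_nat[OF p] by auto
      have "j \<noteq> 0" using * j by auto
      hence "j = 1 \<or> j = 2" using j by auto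
      moreover have "\<not> p\<^sup>2 dvd p" using bounds by (auto dest: dvd_imp_le)
      ultimately show "ord q a = d" using * j d by auto
    qed
    thus ?thesis unfolding A_def dd by blast
  qed
  obtain g where g: "residue_primroot q g" using primroot_q .
  have "num_types (p\<^sup>2 * q) (\<lambda>G. \<not> nsq G \<and> cyc G \<and> nontrivial_centre G = Z) = (if A = {} then 0 else 1)"
  proof (rule num_types_one_model[where M = "\<lambda>a. split_cyclic q a (p\<^sup>2)"])
    fix a assume "a \<in> A"
    thus "group (split_cyclic q a (p\<^sup>2)) \<and> finite (carrier (split_cyclic q a (p\<^sup>2))) \<and>
        order (split_cyclic q a (p\<^sup>2)) = p\<^sup>2 * q"
      using A split_cyclic_group[OF bounds(4,6)] by (simp add: mult.commute)
  next
    fix a b assume ab: "a \<in> A" "b \<in> A"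
    hence o: "ord q a = d" "ord q b = d" by (auto simp: A_def)
    obtain k where k: "[a = b ^ k] (mod q)" "coprime k d"
      using coprime_power_of_equal_order[OF g bounds(3) o(2,1) d0(1)] .
    show "split_cyclic q a (p\<^sup>2) \<cong> split_cyclic q b (p\<^sup>2)"
      by (rule split_cyclic_iso[OF bounds(4,6) _ k(1) d0(4)[OF k(2)]]) (use A ab in blast)
  next
    fix G assume G: "G \<in> groups_p2q"
    show "\<not> nsq G \<and> cyc G \<and> nontrivial_centre G = Z \<longleftrightarrow> (\<exists>a\<in>A. split_cyclic q a (p\<^sup>2) \<cong> G)"
    proof
      assume *: "\<not> nsq G \<and> cyc G \<and> nontrivial_centre G = Z"
      from G show "\<exists>a\<in>A. split_cyclic q a (p\<^sup>2) \<cong> G"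
        by (cases rule: classification_invariants) (use * A in blast)+
    next
      assume "\<exists>a\<in>A. split_cyclic q a (p\<^sup>2) \<cong> G"
      thus "\<not> nsq G \<and> cyc G \<and> nontrivial_centre G = Z"
        using A invariants_normal_prime_cyclic[OF _ _ G] by blast
    qed
  qed
  moreover have "A \<noteq> {} \<longleftrightarrow> d dvd q - 1"
  proof
    assume "d dvd q - 1"
    then obtain a where "ord q a = d" using ord_exists_primroot[OF g] totients by metis
    thus "A \<noteq> {}" by (auto simp: A_def)
  next
    assume "A \<noteq> {}"
    then obtain a where "ord q a = d" by (auto simp: A_def)
    thus "d dvd q - 1" using order_dvd_totient_of_pos[of q a] d0 totients by simp
  qed
  ultimately show ?thesis by auto
qed

lemma count_prime_elementary:
  "num_types (p\<^sup>2 * q) (\<lambda>G. \<not> nsq G \<and> \<not> cyc G) = (if p dvd q - 1 then 1 else 0)"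
proof -
  define A where "A = {a. ord q a = p}"
  have A: "a \<in> A \<longleftrightarrow> [a ^ p = 1] (mod q) \<and> \<not> [a = 1] (mod q)" for a
    using prime_power_order[OF p, of a q] ord_divides[of a p q] ord_eq_Suc_0_iff[of q a] bounds(1)
    by (auto simp: A_def)
  obtain g where g: "residue_primroot q g" using primroot_q .
  have "num_types (p\<^sup>2 * q) (\<lambda>G. \<not> nsq G \<and> \<not> cyc G) = (if A = {} then 0 else 1)"
  proof (rule num_types_one_model[where M = "split_pair p q"])
    fix a assume "a \<in> A"
    thus "group (split_pair p q a) \<and> finite (carrier (split_pair p q a)) \<and>
        order (split_pair p q a) = p\<^sup>2 * q"
      using A split_pair_group[OF bounds(2,4)] by simp
  next
    fix a b assume ab: "a \<in> A" "b \<in> A"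
    hence o: "ord q a = p" "ord q b = p" by (auto simp: A_def)
    obtain k where k: "[a = b ^ k] (mod q)" "coprime k p"
      using coprime_power_of_equal_order[OF g bounds(3) o(2,1) bounds(2)] .
    show "split_pair p q a \<cong> split_pair p q b"
      by (rule split_pair_iso[OF bounds(2,4) _ k]) (use A ab in blast)
  next
    fix G assume G: "G \<in> groups_p2q"
    show "\<not> nsq G \<and> \<not> cyc G \<longleftrightarrow> (\<exists>a\<in>A. split_pair p q a \<cong> G)"
    proof
      assume *: "\<not> nsq G \<and> \<not> cyc G"
      from G show "\<exists>a\<in>A. split_pair p q a \<cong> G"
        by (cases rule: classification_invariants) (use * A in blast)+
    next
      assume "\<exists>a\<in>A. split_pair p q a \<cong> G"
      thus "\<not> nsq G \<and> \<not> cyc G" using A invariants_normal_prime_elementary[OF _ _ G] by blast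
    qed
  qed
  moreover have "A \<noteq> {} \<longleftrightarrow> p dvd q - 1"
  proof
    assume "p dvd q - 1"
    then obtain a where "ord q a = p" using ord_exists_primroot[OF g] totients by metis
    thus "A \<noteq> {}" by (auto simp: A_def)
  next
    assume "A \<noteq> {}"
    then obtain a where "ord q a = p" by (auto simp: A_def)
    thus "p dvd q - 1" using order_dvd_totient_of_pos[of q a] bounds totients by simp
  qed
  ultimately show ?thesis by auto
qed

lemma count_elementary_square_irreducible:
  assumes qp: "\<not> q dvd p - 1"
  shows "num_types (p\<^sup>2 * q) (\<lambda>G. nsq G \<and> \<not> cyc G \<and> comm_group G = False) = (if q dvd p + 1 then 1 else 0)"
proof -
  let ?S = "{A. mcong (int p) (A ^ q) 1 \<and> (mcong (int p) A 1 \<longleftrightarrow> False)}"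
  have P: "prime (int p)" using p by simp
  note root1 = root_of_unity_trivial[OF qp]
  have odd: "odd q"
  proof
    assume "even q"
    hence "q = 2" using q by (metis primes_dvd_imp_eq two_is_prime_nat)
    moreover from this have "odd p" using p pq by (metis primes_dvd_imp_eq two_is_prime_nat)
    ultimately show False using qp by simp
  qed
  have comp: "\<exists>T t. conjugates (int p) T A (companion t) \<and> mcong (int p) (companion t ^ q) 1" if "A \<in> ?S" for A
    using companion_of_order[OF P q not_dvd_int root1, of A] that by blast
  have "split_matrix p A q \<cong> split_matrix p B q" if AB: "A \<in> ?S" "B \<in> ?S" for A B
  proof -
    obtain T s where s: "conjugates (int p) T A (companion s)" "mcong (int p) (companion s ^ q) 1"
      using comp[OF AB(1)] by blast
    obtain U t where t: "conjugates (int p) U B (companion t)" "mcong (int p) (companion t ^ q) 1"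
      using comp[OF AB(2)] by blast
    obtain V k where k: "coprime k q" "conjugates (int p) V (companion s) (companion t ^ k)"
      using companion_conjugate_power[OF P q not_dvd_int root1 odd t(2) s(2)] .
    obtain V' where V': "conjugates (int p) V' (companion t ^ k) (companion s)" using conjugates_sym[OF P k(2)] .
    obtain T' where T': "conjugates (int p) T' (companion s) A" using conjugates_sym[OF P s(1)] .
    from conjugates_trans[OF P conjugates_trans[OF P conjugates_power[OF t(1)] V'] T']
    show ?thesis by (rule split_matrix_iso[OF p bounds(4) _ _ _ k(1), rotated 2]) (use AB in auto)
  qed
  moreover have "?S \<noteq> {} \<longleftrightarrow> q dvd p + 1"
  proof
    assume "q dvd p + 1"
    thus "?S \<noteq> {}" using matrix_of_order_exists[OF p q] by (metis (mono_tags, lifting) empty_iff mem_Collect_eq)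
  next
    assume "?S \<noteq> {}"
    then obtain t where "mcong (int p) (companion t ^ q) 1" using comp by blast
    thus "q dvd p + 1" using companion_order_dvd[OF p q _ qp root1] pq by blast
  qed
  ultimately show ?thesis by (subst count_square_elementary) auto
qed

end

section \<open>Diagonal matrices up to inversion of the exponent\<close>

text \<open>
  Each orbit of the involution contains exactly one \<open>x\<close> with \<open>x \<le> \<sigma>(x)\<close>, its smallest element.
\<close>

lemma card_involution_le:
  fixes S :: "nat set" and \<sigma> :: "nat \<Rightarrow> nat"
  assumes fin: "finite S" and inv: "\<And>x. x \<in> S \<Longrightarrow> \<sigma> x \<in> S" "\<And>x. x \<in> S \<Longrightarrow> \<sigma> (\<sigma> x) = x"
  shows "2 * card {x\<in>S. x \<le> \<sigma> x} = card S + card {x\<in>S. \<sigma> x = x}"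
proof -
  have "bij_betw \<sigma> {x\<in>S. x \<le> \<sigma> x} {x\<in>S. \<sigma> x \<le> x}"
    by (rule bij_betw_byWitness[where f' = \<sigma>]) (auto simp: inv)
  hence "card {x\<in>S. \<sigma> x \<le> x} = card {x\<in>S. x \<le> \<sigma> x}" by (simp add: bij_betw_same_card)
  moreover have "{x\<in>S. x \<le> \<sigma> x} \<union> {x\<in>S. \<sigma> x \<le> x} = S" by auto
  moreover have "{x\<in>S. x \<le> \<sigma> x} \<inter> {x\<in>S. \<sigma> x \<le> x} = {x\<in>S. \<sigma> x = x}" by auto
  ultimately show ?thesis
    using card_Un_Int[of "{x\<in>S. x \<le> \<sigma> x}" "{x\<in>S. \<sigma> x \<le> x}"] fin by simp
qed

text \<open>
  The inverse modulo \<open>q\<close> by Fermat. The residue \<open>0\<close> is its own partner, as it belongs to the matrix \<open>diag(lam, 1)\<close>.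
\<close>

definition residue_inverse :: "nat \<Rightarrow> nat \<Rightarrow> nat" where
  "residue_inverse q k = (if k = 0 then 0 else k ^ (q - 2) mod q)"

context distinct_primes
begin

abbreviation "\<sigma> \<equiv> residue_inverse q"

lemma residue_inverse_less: "\<sigma> k < q"
  using bounds by (simp add: residue_inverse_def)

lemma residue_inverse_mult:
  assumes "0 < k" "k < q" shows "[k * \<sigma> k = 1] (mod q)"
proof -
  have "\<not> q dvd k" using assms by (auto dest: dvd_imp_le)
  hence "[k ^ (q - 1) = 1] (mod q)" using fermat_theorem[OF q] by blast
  moreover have "k ^ (q - 1) = k * k ^ (q - 2)"
    using bounds(3) by (metis Suc_1 Suc_diff_Suc diff_Suc_1 diff_diff_left plus_1_eq_Suc power_Suc)
  moreover have "[k * (k ^ (q - 2) mod q) = k * k ^ (q - 2)] (mod q)" by (intro cong_mult cong_refl) simp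
  ultimately show ?thesis using assms by (metis cong_trans less_irrefl residue_inverse_def)
qed

lemma residue_inverse_unique:
  assumes kl: "[k * l = 1] (mod q)" and "l < q" "k < q"
  shows "l = \<sigma> k"
proof -
  have k0: "0 < k" using kl bounds by (cases "k = 0") (auto simp: cong_def)
  have "[k * l = k * \<sigma> k] (mod q)" using kl residue_inverse_mult[OF k0 assms(3)] by (metis cong_sym cong_trans)
  moreover have "coprime k q" using q k0 assms(3) by (metis coprime_commute nat_dvd_not_less prime_imp_coprime_nat)
  ultimately have "[l = \<sigma> k] (mod q)" using cong_mult_lcancel_nat by blast
  thus ?thesis using assms residue_inverse_less[of k] by (simp add: cong_def)
qed

lemma residue_inverse_involution: "k < q \<Longrightarrow> \<sigma> (\<sigma> k) = k"
proof (cases "k = 0")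
  case False
  assume k: "k < q"
  have "[\<sigma> k * k = 1] (mod q)" using residue_inverse_mult[of k] False k by (simp add: mult.commute)
  thus ?thesis using residue_inverse_unique[of "\<sigma> k" k] k residue_inverse_less by simp
qed (simp add: residue_inverse_def)

lemma residue_inverse_fixed: "{k\<in>{..<q}. \<sigma> k = k} = {0, 1, q - 1}"
proof (intro equalityI subsetI)
  fix k assume k: "k \<in> {k\<in>{..<q}. \<sigma> k = k}"
  show "k \<in> {0, 1, q - 1}"
  proof (cases "k = 0")
    case False
    hence "[k * k = 1] (mod q)" using residue_inverse_mult[of k] k by simp
    hence "q dvd k * k - 1" using False cong_altdef_nat[of 1 "k * k" q] by simp
    moreover have "k * k - 1 = (k - 1) * (k + 1)" by (simp add: algebra_simps diff_mult_distrib)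
    ultimately have "q dvd k - 1 \<or> q dvd k + 1" using q prime_dvd_mult_iff by metis
    thus ?thesis
    proof
      assume "q dvd k - 1"
      moreover have "k - 1 < q" using k by auto
      ultimately have "k - 1 = 0" by (metis dvd_imp_le linorder_not_le not_gr_zero)
      thus ?thesis using False by simp
    next
      assume "q dvd k + 1"
      hence "q \<le> k + 1" by (intro dvd_imp_le) auto
      thus ?thesis using k by auto
    qed
  qed simp
next
  fix k assume k: "k \<in> {0, 1, q - 1}"
  have "[(q - 1) * (q - 1) = 1] (mod q)"
  proof -
    have "[int (q - 1) * int (q - 1) = (- 1) * (- 1)] (mod int q)"
      using bounds by (intro cong_mult) (auto simp: cong_iff_dvd_diff of_nat_diff)
    hence "[int ((q - 1) * (q - 1)) = int 1] (mod int q)" by simp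
    thus ?thesis by (simp only: cong_int_iff)
  qed
  hence "q - 1 = \<sigma> (q - 1)" using bounds by (intro residue_inverse_unique) auto
  moreover have "1 = \<sigma> 1" using bounds by (intro residue_inverse_unique) auto
  moreover have "\<sigma> 0 = 0" by (simp add: residue_inverse_def)
  ultimately show "k \<in> {k\<in>{..<q}. \<sigma> k = k}" using k bounds by auto
qed

lemma card_residue_inverse_classes:
  "2 * card {k\<in>{..<q}. k \<le> \<sigma> k} = q + (if q = 2 then 2 else 3)"
proof -
  have "2 * card {k\<in>{..<q}. k \<le> \<sigma> k} = card {..<q} + card {k\<in>{..<q}. \<sigma> k = k}"
    by (rule card_involution_le) (auto simp: residue_inverse_less residue_inverse_involution)
  also have "card {k\<in>{..<q}. \<sigma> k = k} = (if q = 2 then 2 else 3)"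
    unfolding residue_inverse_fixed using bounds by (auto simp: card_insert_if)
  finally show ?thesis by simp
qed

lemma conjugates_swap: "conjugates (int p) (Mat2 0 1 1 0) (diag2 a b) (diag2 b a)"
proof -
  have "\<not> int p dvd - 1" using p by (metis dvd_minus_iff not_prime_unit prime_nat_int_transfer)
  thus ?thesis by (simp add: conjugates_def det2_def diag2_def times_mat2_def)
qed

lemma diag2_mcong: "[a = a'] (mod P) \<Longrightarrow> [b = b'] (mod P) \<Longrightarrow> mcong P (diag2 a b) (diag2 a' b')"
  by (simp add: mcong_def diag2_def)

text \<open>
  Let \<open>D k = diag(lam, lam ^ k)\<close>. A nontrivial \<open>A\<close> is conjugate to \<open>diag(lam ^ i, lam ^ j)\<close>, and after a swap of the
  entries \<open>i\<close> is prime to \<open>q\<close>; so \<open>A\<close> is conjugate to \<open>D k ^ i\<close> with \<open>k = j / i\<close> modulo \<open>q\<close>. For \<open>k \<noteq> 0\<close> with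
  inverse \<open>\<sigma> k\<close>, a swap of the entries turns \<open>D k ^ \<sigma> k\<close> into \<open>D (\<sigma> k)\<close>, so both parameters give the same group.
  Conversely, let \<open>T\<close> conjugate \<open>D k\<close> to \<open>D m ^ s\<close>. One of the two products in the determinant of \<open>T\<close> is nonzero, and its factors
  match the eigenvalues \<open>lam ^ s, lam ^ (m s)\<close> with \<open>lam, lam ^ k\<close> in one of the two orders: \<open>k = m\<close> or \<open>k m = 1\<close> modulo \<open>q\<close>.
\<close>

lemma count_elementary_square_diagonal:
  assumes qp: "q dvd p - 1"
  shows "num_types (p\<^sup>2 * q) (\<lambda>G. nsq G \<and> \<not> cyc G \<and> comm_group G = False) =
    card {k\<in>{..<q}. k \<le> \<sigma> k}" (is "num_types _ ?\<Phi> = card ?I")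
proof -
  have P: "prime (int p)" using p by simp
  obtain g where g: "residue_primroot p g"
    using prime_primitive_root_exists[of p] p bounds by auto
  obtain l where l: "ord p l = q" using ord_exists_primroot[OF g] qp totients by metis
  define lam where "lam = int l"
  have cop: "coprime p l" using l bounds by (metis ord_eq_0 less_irrefl)
  have lam_eq: "[lam ^ i = lam ^ j] (mod int p) \<longleftrightarrow> [i = j] (mod q)" for i j
    using order_divides_expdiff[OF cop, of i j] l cong_int_iff[of "l ^ i" "l ^ j" p] by (simp add: lam_def)
  have lam_q: "[lam ^ q = 1] (mod int p)" using lam_eq[of q 0] by (simp add: cong_def)
  have lam_n: "\<not> [lam ^ i = 1] (mod int p)" if "0 < i" "i < q" for i
    using lam_eq[of i 0] that by (simp add: cong_def)
  have lam_unit: "\<not> int p dvd lam ^ i" for i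
  proof
    assume "int p dvd lam ^ i"
    hence "int p dvd lam" using P prime_dvd_power by blast
    hence "int p dvd lam ^ q" using bounds by (simp add: dvd_power dvd_trans)
    hence "int p dvd 1" using lam_q by (simp add: cong_dvd_iff)
    thus False using P not_prime_unit by blast
  qed
  define D where "D k = diag2 lam (lam ^ k)" for k
  have Dpow: "D k ^ i = diag2 (lam ^ i) (lam ^ (k * i))" for k i
    by (simp add: D_def diag2_power power_mult)
  have Dq: "mcong (int p) (D k ^ q) 1" for k
  proof -
    have "mcong (int p) (D k ^ q) (diag2 1 1)"
      unfolding Dpow using lam_q lam_eq[of "k * q" 0] by (intro diag2_mcong) (simp_all add: cong_def)
    thus ?thesis by (simp add: diag2_def one_mat2_def)
  qed
  have D1: "\<not> mcong (int p) (D k) 1" for k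
    using lam_n[of 1] bounds by (auto simp: D_def diag2_def one_mat2_def mcong_def)
  have ex1: "\<exists>k<q. split_matrix p (D k) q \<cong> split_matrix p A q"
    if A: "mcong (int p) (A ^ q) 1" and T: "conjugates (int p) T A (diag2 (lam ^ i) (lam ^ j))" and i: "\<not> q dvd i" for A T i j
  proof -
    have ci: "coprime i q" using i q by (metis coprime_commute prime_imp_coprime_nat)
    obtain u where u: "[i * u = 1] (mod q)" using cong_solve_coprime_nat[OF ci] by auto
    \<comment> \<open>\<open>u\<close> is the inverse of \<open>i\<close>, so \<open>k\<close> is \<open>j / i\<close>.\<close>
    define k where "k = j * u mod q"
    have "[k * i = (j * u) * i] (mod q)" unfolding k_def by (intro cong_mult cong_refl) simp
    also have "(j * u) * i = j * (i * u)" by (simp add: ac_simps)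
    also have "[j * (i * u) = j * 1] (mod q)" by (intro cong_mult cong_refl u)
    finally have kij: "[j = k * i] (mod q)" by (simp add: cong_sym)
    have "mcong (int p) (diag2 (lam ^ i) (lam ^ j)) (D k ^ i)"
      unfolding Dpow using lam_eq[of j "k * i"] kij by (intro diag2_mcong) auto
    hence T': "conjugates (int p) T A (D k ^ i)" by (rule conjugates_mcong_right[OF T])
    then obtain S where S: "conjugates (int p) S (D k ^ i) A" using conjugates_sym[OF P] by blast
    have iso: "split_matrix p A q \<cong> split_matrix p (D k) q" by (rule split_matrix_iso[OF p bounds(4) A Dq S ci])
    have "split_matrix p (D k) q \<cong> split_matrix p A q"
      by (rule group.iso_sym[OF split_matrix_group(1)[OF bounds(2,4) A] iso])
    moreover have "k < q" using bounds by (simp add: k_def)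
    ultimately show ?thesis by blast
  qed
  have ex2: "\<exists>k<q. split_matrix p (D k) q \<cong> split_matrix p A q"
    if A: "mcong (int p) (A ^ q) 1" "\<not> mcong (int p) A 1" for A
  proof -
    obtain T i j where T: "conjugates (int p) T A (diag2 (lam ^ i) (lam ^ j))"
      using diagonalizable[OF P bounds(4) not_dvd_int lam_q lam_n A(1)] .
    show ?thesis
    proof (cases "q dvd i")
      case False
      thus ?thesis using ex1[OF A(1) T] by blast
    next
      case True
      hence i: "[lam ^ i = 1] (mod int p)" using lam_eq[of i 0] by (simp add: cong_0_iff)
      have "\<not> q dvd j"
      proof
        assume "q dvd j"
        hence j: "[lam ^ j = 1] (mod int p)" using lam_eq[of j 0] by (simp add: cong_0_iff)
        have "mcong (int p) (diag2 (lam ^ i) (lam ^ j)) 1"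
          using diag2_mcong[OF i j] by (simp add: diag2_def one_mat2_def)
        hence "conjugates (int p) T A 1" by (rule conjugates_mcong_right[OF T])
        then obtain S where "conjugates (int p) S 1 A" using conjugates_sym[OF P] by blast
        thus False using conjugates_1D[OF P] A(2) by blast
      qed
      thus ?thesis using ex1[OF A(1) conjugates_trans[OF P T conjugates_swap]] by blast
    qed
  qed
  have swap: "split_matrix p (D (\<sigma> k)) q \<cong> split_matrix p (D k) q" if k: "k < q" for k
  proof (cases "k = 0")
    case True
    thus ?thesis by (simp add: residue_inverse_def iso_refl)
  next
    case False
    have inv: "[k * \<sigma> k = 1] (mod q)" using residue_inverse_mult False k by simp
    hence cop: "coprime (\<sigma> k) q" by (metis cong_imp_coprime cong_sym coprime_1_left coprime_mult_left_iff)
    have "[lam ^ (k * \<sigma> k) = lam ^ 1] (mod int p)" using lam_eq inv by blast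
    hence "mcong (int p) (diag2 (lam ^ \<sigma> k) lam) (D k ^ \<sigma> k)"
      unfolding Dpow by (intro diag2_mcong) (simp_all add: cong_sym)
    hence "conjugates (int p) (Mat2 0 1 1 0) (D k ^ \<sigma> k) (D (\<sigma> k))"
      unfolding D_def[of "\<sigma> k"] by (rule conjugates_mcong_left[OF conjugates_swap])
    thus ?thesis by (rule split_matrix_iso[OF p bounds(4) Dq Dq _ cop])
  qed
  show ?thesis
  proof (rule num_types_eq_card[where M = "\<lambda>k. split_matrix p (D k) q"])
    fix G assume G: "G \<in> groups_p2q"
    show "?\<Phi> G \<longleftrightarrow> (\<exists>k\<in>?I. split_matrix p (D k) q \<cong> G)"
    proof
      assume "?\<Phi> G"
      then obtain A where A: "mcong (int p) (A ^ q) 1" "\<not> mcong (int p) A 1" "split_matrix p A q \<cong> G"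
        using count_square_elementary_iff[OF G, of False] by blast
      then obtain k where k: "k < q" "split_matrix p (D k) q \<cong> split_matrix p A q" using ex2 by blast
      have iso: "split_matrix p (D k) q \<cong> G" using iso_trans[OF k(2) A(3)] .
      show "\<exists>k\<in>?I. split_matrix p (D k) q \<cong> G"
      proof (cases "k \<le> \<sigma> k")
        case True
        thus ?thesis using k(1) iso by blast
      next
        case False
        hence "\<sigma> k \<in> ?I" using residue_inverse_involution[OF k(1)] residue_inverse_less by simp
        thus ?thesis using iso_trans[OF swap[OF k(1)] iso] by blast
      qed
    next
      assume "\<exists>k\<in>?I. split_matrix p (D k) q \<cong> G"
      thus "?\<Phi> G" using count_square_elementary_iff[OF G, of False] Dq D1 by blast
    qed
  next
    fix k m assume km: "k \<in> ?I" "m \<in> ?I" "split_matrix p (D k) q \<cong> split_matrix p (D m) q"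
    obtain T s where T: "conjugates (int p) T (D m ^ s) (D k)"
      using split_matrix_isoD[OF p bounds(3) coprimes(1) Dq Dq km(3)] .
    obtain x y z w where [simp]: "T = Mat2 x y z w" by (metis mat2.exhaust)
    have c: "[lam ^ s * x = x * lam] (mod int p)" "[lam ^ s * y = y * lam ^ k] (mod int p)"
      "[lam ^ (m * s) * z = z * lam] (mod int p)" "[lam ^ (m * s) * w = w * lam ^ k] (mod int p)"
      using T unfolding conjugates_def Dpow by (auto simp: mcong_def times_mat2_def diag2_def D_def)
    have canc: "[i = j] (mod q)" if "[lam ^ i * v = v * lam ^ j] (mod int p)" "\<not> int p dvd v" for i j v
    proof -
      have "coprime v (int p)" using that(2) P by (metis coprime_commute prime_imp_coprime)
      hence "[lam ^ i = lam ^ j] (mod int p)"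
        using that(1)[unfolded mult.commute[of v "lam ^ j"]] cong_mult_rcancel[of v "int p"] by blast
      thus ?thesis using lam_eq by blast
    qed
    \<comment> \<open>One of the two products in the determinant survives modulo \<open>p\<close>.\<close>
    have "\<not> int p dvd x * w - y * z" using T by (simp add: conjugates_def det2_def)
    hence "\<not> (int p dvd x * w) \<or> \<not> (int p dvd y * z)" by auto
    hence "\<not> int p dvd x \<and> \<not> int p dvd w \<or> \<not> int p dvd y \<and> \<not> int p dvd z" by auto
    hence "[k = m] (mod q) \<or> [m * k = 1] (mod q)"
    proof
      assume "\<not> int p dvd x \<and> \<not> int p dvd w"
      hence s: "[s = 1] (mod q)" "[m * s = k] (mod q)" using canc[of s x 1] canc[of "m * s" w k] c by auto
      have "[m * s = m * 1] (mod q)" by (intro cong_mult cong_refl s)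
      thus ?thesis using s by (metis cong_sym cong_trans mult.right_neutral)
    next
      assume "\<not> int p dvd y \<and> \<not> int p dvd z"
      hence s: "[s = k] (mod q)" "[m * s = 1] (mod q)" using canc[of s y k] canc[of "m * s" z 1] c by auto
      have "[m * s = m * k] (mod q)" by (intro cong_mult cong_refl s)
      thus ?thesis using s by (metis cong_sym cong_trans)
    qed
    thus "k = m"
    proof
      assume "[k = m] (mod q)"
      thus ?thesis using km by (simp add: cong_def)
    next
      assume mk: "[m * k = 1] (mod q)"
      have "k = \<sigma> m" using residue_inverse_unique[OF mk] km by auto
      moreover have "m = \<sigma> k" using residue_inverse_unique[of k m] mk km by (auto simp: mult.commute)
      ultimately show ?thesis using km by auto
    qed
  next
    fix k
    show "group (split_matrix p (D k) q)" "finite (carrier (split_matrix p (D k) q))" "order (split_matrix p (D k) q) = p\<^sup>2 * q"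
      using split_matrix_group[OF bounds(2,4) Dq] by auto
  qed
qed

text \<open>
  The groups are split by \<open>nsq\<close>, then by \<open>cyc\<close>, and finally by commutativity or by the centre.
\<close>

lemma num_groups_eq:
  "num_groups (p\<^sup>2 * q) = 2 + (if q dvd p - 1 then 1 else 0)
     + (if q dvd p - 1 then card {k\<in>{..<q}. k \<le> \<sigma> k} else if q dvd p + 1 then 1 else 0)
     + 2 * (if p dvd q - 1 then 1 else 0) + (if p\<^sup>2 dvd q - 1 then 1 else 0)"
proof -
  let ?n = "p\<^sup>2 * q"
  have inv: "comm_group H \<longleftrightarrow> comm_group G" "cyc H \<longleftrightarrow> cyc G" "nsq H \<longleftrightarrow> nsq G" "nontrivial_centre H \<longleftrightarrow> nontrivial_centre G"
    if "G \<in> groups_p2q" "H \<in> groups_p2q" "G \<cong> H" for G H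
    using iso_invariants[OF groups_p2qD(1)[OF that(1)] groups_p2qD(1)[OF that(2)] that(3)] by blast+
  note split = num_types_split[of ?n nsq] num_types_split[of ?n cyc] num_types_split[of ?n comm_group]
    num_types_split[of ?n nontrivial_centre]
  have "num_types ?n (\<lambda>_. True) = num_types ?n (\<lambda>G. True \<and> nsq G) + num_types ?n (\<lambda>G. True \<and> \<not> nsq G)"
    by (rule split(1)) (use inv(3) in blast)
  hence "num_groups ?n = num_types ?n nsq + num_types ?n (\<lambda>G. \<not> nsq G)"
    by (simp add: num_groups_eq_num_types)
  also have "num_types ?n nsq = num_types ?n (\<lambda>G. nsq G \<and> cyc G) + num_types ?n (\<lambda>G. nsq G \<and> \<not> cyc G)"
    by (rule split(2)) (use inv(2) in blast)
  also have "num_types ?n (\<lambda>G. nsq G \<and> cyc G) =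
      num_types ?n (\<lambda>G. (nsq G \<and> cyc G) \<and> comm_group G) + num_types ?n (\<lambda>G. (nsq G \<and> cyc G) \<and> \<not> comm_group G)"
    by (rule split(3)) (use inv(1) in blast)
  also have "\<dots> = 1 + (if q dvd p - 1 then 1 else 0)"
    using count_cyclic count_cyclic_square_nonabelian by simp
  also have "num_types ?n (\<lambda>G. nsq G \<and> \<not> cyc G) =
      num_types ?n (\<lambda>G. (nsq G \<and> \<not> cyc G) \<and> comm_group G) + num_types ?n (\<lambda>G. (nsq G \<and> \<not> cyc G) \<and> \<not> comm_group G)"
    by (rule split(3)) (use inv(1) in blast)
  also have "\<dots> = 1 + (if q dvd p - 1 then card {k\<in>{..<q}. k \<le> \<sigma> k} else if q dvd p + 1 then 1 else 0)"
    using count_elementary_abelian count_elementary_square_diagonal count_elementary_square_irreducible by simp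
  also have "num_types ?n (\<lambda>G. \<not> nsq G) =
      num_types ?n (\<lambda>G. \<not> nsq G \<and> cyc G) + num_types ?n (\<lambda>G. \<not> nsq G \<and> \<not> cyc G)"
    by (rule split(2)) (use inv(2) in blast)
  also have "num_types ?n (\<lambda>G. \<not> nsq G \<and> cyc G) =
      num_types ?n (\<lambda>G. (\<not> nsq G \<and> cyc G) \<and> nontrivial_centre G) + num_types ?n (\<lambda>G. (\<not> nsq G \<and> cyc G) \<and> \<not> nontrivial_centre G)"
    by (rule split(4)) (use inv(4) in blast)
  also have "\<dots> = (if p dvd q - 1 then 1 else 0) + (if p\<^sup>2 dvd q - 1 then 1 else 0)"
    using count_prime_cyclic[of p True] count_prime_cyclic[of "p\<^sup>2" False] by simp
  finally show ?thesis by (simp add: count_prime_elementary)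
qed

end

theorem theorem14:
  fixes p q :: nat
  assumes "prime p" and "prime q" and "p \<noteq> q"
  shows "(q = 2 \<longrightarrow> num_groups (p\<^sup>2 * q) = 5) \<and>
         (q > 2 \<longrightarrow>
            real (num_groups (p\<^sup>2 * q)) =
              2 + (real q + 5) / 2 * real (divisor_ind (p - 1) q)
                + real (divisor_ind (p + 1) q)
                + 2 * real (divisor_ind (q - 1) p)
                + real (divisor_ind (q - 1) (p\<^sup>2)))"
proof -
  interpret distinct_primes p q using assms by unfold_locales
  have card: "2 * card {k\<in>{..<q}. k \<le> \<sigma> k} = q + (if q = 2 then 2 else 3)"
    by (rule card_residue_inverse_classes)
  show ?thesis
  proof (intro conjI impI)
    assume q2: "q = 2"
    have "odd p" using p pq q2 by (metis primes_dvd_imp_eq two_is_prime_nat)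
    hence "q dvd p - 1" using q2 by simp
    moreover have "\<not> p dvd q - 1" "\<not> p\<^sup>2 dvd q - 1" using bounds q2 by auto
    moreover have "card {k\<in>{..<q}. k \<le> \<sigma> k} = 2" using card q2 by simp
    ultimately show "num_groups (p\<^sup>2 * q) = 5" unfolding num_groups_eq by simp
  next
    assume q2: "q > 2"
    \<comment> \<open>For odd \<open>q\<close> the cases of diagonalizable and of irreducible matrices exclude each other.\<close>
    have excl: "\<not> (q dvd p - 1 \<and> q dvd p + 1)"
    proof
      assume "q dvd p - 1 \<and> q dvd p + 1"
      hence "q dvd (p + 1) - (p - 1)" using dvd_diff_nat[of q "p + 1" "p - 1"] by blast
      hence "q dvd 2" using bounds by simp
      thus False using q2 by (auto dest: dvd_imp_le)
    qed
    have "real (2 * card {k\<in>{..<q}. k \<le> \<sigma> k}) = real (q + 3)" using card q2 by simp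
    hence "real (card {k\<in>{..<q}. k \<le> \<sigma> k}) = (real q + 3) / 2" by simp
    thus "real (num_groups (p\<^sup>2 * q)) =
              2 + (real q + 5) / 2 * real (divisor_ind (p - 1) q)
                + real (divisor_ind (p + 1) q)
                + 2 * real (divisor_ind (q - 1) p)
                + real (divisor_ind (q - 1) (p\<^sup>2))"
      unfolding num_groups_eq using excl by (auto simp: divisor_ind_def)
  qed
qed

end
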